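(* Let $F=\sum_{n=1}^{178} c_n \sum_{E\in O_n} X(E)\in\mathbb{Z}[x_{ijk}: 1\le i,j\le 3,\ 1\le k\le 2]$, where $X(E)=\prod_{i,j,k}x_{ijk}^{e_{ijk}}$, where $O_n$ is the orbit of the exponent array $E_n$ under the symmetry group $G=(S_3\times S_3\times S_2)\rtimes S_2$, and where the pairs $(c_n,E_n)$, $n=1,\dots,178$, are those listed explicitly in the context. Then $F$ is (up to sign) the hyperdeterminant of a $3\times 3\times 2$ array. It is an irreducible homogeneous polynomial of degree $12$ in the $18$ variables $x_{ijk}$, it has exactly $16749$ monomials (with nonzero coefficient), its coefficients take exactly $41$ distinct integer values, and its monomials form exactly $178$ distinct orbits under $G$, namely $O_1,\dots,O_{178}$ (with sizes as listed in the context).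
   Context: **Hyperdeterminant.** The hyperdeterminant of a $3\times3\times2$ array $(a_{ijk})$ (in the sense of Gelfand, Kapranov and Zelevinsky) is the irreducible polynomial with integer coefficients of greatest common divisor 1, unique up to sign, whose zero set in $\mathbb{C}^{3}\otimes\mathbb{C}^3\otimes\mathbb{C}^2$ is the (closed) hypersurface dual to the Segre variety $\mathbb{P}^2\times\mathbb{P}^2\times\mathbb{P}^1\subset\mathbb{P}^{17}$. Equivalently, this hypersurface is the set of arrays for which there are nonzero $u\in\mathbb{C}^3$, $v\in\mathbb{C}^3$, $w\in\mathbb{C}^2$ at which all first partial derivatives of the trilinear form $\sum a_{ijk}u_iv_jw_k$ (with respect to all $u_i,v_j,w_k$) vanish. The hyperdeterminant is regarded as a polynomial in variables $x_{ijk}$ standing for the array entries. **Exponent arrays and group action.** An exponent array is $E=(e_{ijk})$, $1\le i,j\le3$, $1\le k\le2$, with nonnegative integer entries. The group $G=(S_3\times S_3\times S_2)\rtimes S_2$ acts on exponent arrays: $\alpha$ in the first $S_3$, $\beta$ in the second $S_3$ and $\gamma$ in the first $S_2$ act by $(\alpha\cdot E)_{ijk}=e_{\alpha(i),j,k}$, $(\beta\cdot E)_{ijk}=e_{i,\beta(j),k}$, $(\gamma\cdot E)_{ijk}=e_{i,j,\gamma(k)}$, and the nontrivial element of the last $S_2$ sends $E$ to the array with $(i,j,k)$ entry $e_{jik}$. Monomials $X(E)$ are permuted accordingly. **Encoding.** An exponent array is written as three blocks separated by commas, the $i$-th block being $e_{i11}e_{i21}e_{i31}|e_{i12}e_{i22}e_{i32}$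 (all entries are single digits). For example, "000|004, 020|020, 400|000" has $e_{132}=4$, $e_{221}=2$, $e_{222}=2$, $e_{311}=4$ and all other entries $0$. **List.** Each item is "$n$: $c_n$; $E_n$; size of the orbit $O_n$". 1: 1; 000|004, 020|020, 400|000; 36 2: -2; 000|004, 030|010, 300|100; 36 3: -2; 000|004, 020|110, 310|000; 144 4: 4; 000|004, 030|100, 300|010; 36 5: 1; 000|004, 020|200, 220|000; 72 6: -2; 000|004, 110|020, 310|000; 72 7: 8; 000|004, 120|010, 210|100; 36 8: 4; 000|004, 110|110, 220|000; 72 9: -10; 000|004, 120|100, 210|010; 36 10: 2; 001|003, 020|020, 300|100; 36 11: 6; 001|003, 010|120, 310|000; 144 12: 4; 001|003, 020|110, 210|100; 72 13: -8; 001|003, 020|110, 300|010; 72 14: -6; 001|003, 010|210, 220|000; 144 15: 8; 001|003, 020|200, 210|010; 72 16: 2; 001|003, 010|300, 130|000; 72 17: -10; 001|003, 110|020, 210|100; 72 18: 4; 001|003, 110|110, 120|100; 72 19: -6; 002|002, 020|020, 200|200; 6 20: -4; 002|002, 000|130, 310|000; 72 21: -8; 002|002, 010|120, 210|100; 72 22: 2; 002|002, 010|120, 300|010; 72 23: 20; 002|002, 020|110, 200|110; 36 24: 6; 002|002, 000|220, 220|000; 36 25: 10; 002|002, 010|210, 120|100; 36 26: -4; 002|002, 010|210, 210|010; 72 27: -8; 002|002, 020|200, 200|020; 18 28: -16; 002|002, 110|110, 110|110; 9 29: 4; 000|013, 011|110, 310|000; 72 30: 2; 000|013, 020|101, 310|000;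 144 31: 6; 000|013, 021|100, 210|100; 144 32: -12; 000|013, 021|100, 300|010; 144 33: 2; 000|013, 020|110, 301|000; 144 34: 2; 000|013, 030|100, 201|100; 144 35: -4; 000|013, 030|100, 300|001; 72 36: -2; 000|013, 011|200, 220|000; 144 37: -2; 000|013, 020|200, 211|000; 144 38: 4; 000|013, 110|011, 310|000; 36 39: -16; 000|013, 111|010, 210|100; 144 40: 4; 000|013, 111|010, 300|010; 72 41: 2; 000|013, 110|020, 301|000; 144 42: -8; 000|013, 120|001, 210|100; 72 43: 6; 000|013, 121|000, 110|200; 144 44: 6; 000|013, 121|000, 200|110; 144 45: -8; 000|013, 120|010, 201|100; 144 46: -4; 000|013, 101|110, 220|000; 144 47: -4; 000|013, 110|101, 220|000; 144 48: -8; 000|013, 111|100, 120|100; 144 49: 20; 000|013, 111|100, 210|010; 144 50: -8; 000|013, 110|110, 211|000; 144 51: 10; 000|013, 120|100, 201|010; 144 52: 10; 000|013, 120|100, 210|001; 72 53: -2; 000|013, 200|011, 220|000; 72 54: -4; 000|013, 201|010, 210|010; 144 55: -2; 000|013, 200|020, 211|000; 144 56: -6; 001|012, 011|110, 210|100; 72 57: -2; 001|012, 011|110, 300|010; 144 58: -10; 001|012, 020|101, 210|100; 144 59: 20; 001|012, 020|101, 300|010; 72 60: -10; 001|012, 021|100, 110|200; 72 61: 18; 001|012, 021|100, 200|110; 144 62: 4; 001|012, 020|110, 201|100; 144 63: 6; 001|012, 020|110, 300|001; 144 64: -8; 001|012, 030|100, 101|200; 72 65: -6; 001|012, 001|210,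 220|000; 144 66: 8; 001|012, 010|201, 220|000; 144 67: 2; 001|012, 011|200, 120|100; 144 68: 2; 001|012, 011|200, 210|010; 144 69: 16; 001|012, 010|210, 211|000; 144 70: 16; 001|012, 020|200, 111|100; 144 71: -20; 001|012, 020|200, 201|010; 144 72: -6; 001|012, 020|200, 210|001; 72 73: -8; 001|012, 010|300, 121|000; 144 74: 36; 001|012, 110|011, 210|100; 36 75: 22; 001|012, 111|010, 110|200; 144 76: -6; 001|012, 111|010, 200|110; 72 77: 4; 001|012, 110|020, 201|100; 72 78: 4; 001|012, 120|001, 110|200; 72 79: -10; 001|012, 121|000, 100|210; 72 80: 16; 001|012, 100|111, 220|000; 144 81: 18; 001|012, 101|110, 120|100; 144 82: -10; 001|012, 101|110, 210|010; 144 83: 2; 001|012, 100|120, 211|000; 144 84: 4; 001|012, 110|101, 120|100; 144 85: -24; 001|012, 110|101, 210|010; 72 86: -34; 001|012, 111|100, 110|110; 144 87: 2; 001|012, 111|100, 200|020; 144 88: 18; 001|012, 110|110, 201|010; 144 89: -26; 001|012, 120|100, 200|011; 72 90: -6; 001|012, 201|010, 200|020; 144 91: -2; 002|011, 010|111, 300|010; 72 92: -38; 002|011, 020|101, 200|110; 36 93: -24; 002|011, 020|110, 200|101; 24 94: -6; 002|011, 000|211, 220|000; 144 95: -12; 002|011, 010|201, 120|100; 144 96: 2; 002|011, 010|201, 210|010; 144 97: -12; 002|011, 010|210, 210|001; 144 98: 36; 002|011, 020|200, 200|011; 72 99: 6; 002|011, 010|300, 120|001; 72 100: -62; 002|011,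 110|011, 110|200; 36 101: -10; 002|011, 100|111, 120|100; 144 102: -10; 002|011, 100|111, 210|010; 72 103: 50; 002|011, 110|101, 110|110; 72 104: 2; 003|010, 000|121, 300|010; 36 105: 10; 003|010, 000|211, 120|100; 144 106: -4; 003|010, 000|211, 210|010; 144 107: 12; 003|010, 000|220, 210|001; 144 108: -22; 003|010, 010|201, 110|110; 144 109: 12; 003|010, 010|201, 200|020; 72 110: 6; 003|010, 010|210, 110|101; 72 111: -18; 003|010, 010|210, 200|011; 144 112: 18; 003|010, 010|300, 110|011; 36 113: 26; 003|010, 100|111, 110|110; 72 114: 1; 000|022, 002|200, 220|000; 72 115: 4; 000|022, 011|200, 211|000; 72 116: 4; 000|022, 101|101, 220|000; 72 117: 4; 000|022, 102|100, 120|100; 72 118: -10; 000|022, 102|100, 210|010; 144 119: 8; 000|022, 101|110, 211|000; 144 120: 16; 000|022, 111|100, 111|100; 36 121: -20; 000|022, 111|100, 201|010; 144 122: 1; 000|022, 200|002, 220|000; 36 123: 4; 000|022, 201|001, 210|010; 36 124: 4; 000|022, 200|011, 211|000; 72 125: 4; 000|022, 201|010, 210|001; 36 126: 4; 001|021, 002|200, 120|100; 36 127: -10; 001|021, 002|200, 210|010; 72 128: 8; 001|021, 001|210, 211|000; 144 129: -20; 001|021, 010|201, 211|000; 144 130: -12; 001|021, 011|200, 111|100; 72 131: 22; 001|021, 011|200, 201|010; 144 132: -6; 001|021, 011|200, 210|001; 144 133: 18; 001|021, 020|200, 201|001; 72 134: -26; 001|021, 101|101, 120|100; 72 135: 30;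 001|021, 101|101, 210|010; 72 136: -12; 001|021, 100|111, 211|000; 144 137: -10; 001|021, 101|110, 111|100; 144 138: 2; 001|021, 101|110, 210|001; 144 139: 18; 001|021, 110|101, 111|100; 144 140: 16; 001|021, 110|101, 210|001; 144 141: -26; 001|021, 110|110, 201|001; 36 142: 18; 001|021, 120|100, 200|002; 36 143: 4; 002|020, 000|211, 211|000; 72 144: -24; 002|020, 001|210, 210|001; 72 145: 18; 002|020, 010|201, 210|001; 72 146: -27; 002|020, 020|200, 200|002; 12 147: -26; 002|020, 100|111, 111|100; 72 148: 16; 002|020, 101|110, 101|110; 36 149: 44; 002|020, 101|110, 110|101; 72 150: -68; 002|020, 110|101, 110|101; 36 151: 36; 011|011, 101|101, 110|110; 6 152: 36; 011|011, 100|111, 111|100; 36 153: -104; 011|011, 101|110, 110|101; 18 154: -4; 000|112, 011|110, 211|000; 72 155: -2; 000|112, 020|101, 211|000; 144 156: -4; 000|112, 021|100, 111|100; 144 157: 26; 000|112, 021|100, 201|010; 72 158: -16; 000|112, 021|100, 210|001; 144 159: -4; 000|112, 110|011, 211|000; 72 160: -8; 000|112, 111|010, 111|100; 72 161: 24; 000|112, 111|010, 210|001; 144 162: -2; 000|112, 120|001, 210|001; 36 163: 54; 001|111, 011|110, 111|100; 36 164: -22; 001|111, 011|110, 201|010; 144 165: -8; 001|111, 011|110, 210|001; 144 166: -4; 001|111, 020|101, 201|010; 144 167: 38; 001|111, 020|101, 210|001; 72 168: 6; 001|111, 021|100, 110|101; 72 169: 10; 001|111, 011|200, 120|001; 144 170: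 -2; 001|111, 110|011, 111|100; 72 171: -36; 001|111, 110|011, 210|001; 72 172: 12; 002|110, 001|120, 210|001; 72 173: -30; 002|110, 020|101, 200|011; 12 174: -16; 002|110, 010|201, 120|001; 72 175: -32; 002|110, 011|200, 110|011; 72 176: 76; 002|110, 110|011, 110|101; 36 177: 10; 001|120, 101|011, 210|001; 72 178: -30; 011|101, 110|011, 101|110; 12 *)

theory Defs
  imports
    "HOL-Analysis.Derivative"
    "HOL-Analysis.Cartesian_Space"
    "HOL-Library.Poly_Mapping"
    "HOL-Library.Numeral_Type"
    "HOL-Computational_Algebra.Factorial_Ring"
begin

section \<open>Polynomials\<close>

text \<open>
  A polynomial over \<open>'a\<close> in the variables indexed by \<open>'n\<close> maps every monomial, given by its
  exponents, to its coefficient; the ring structure is the convolution product of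
  \<open>Poly_Mapping\<close>.
\<close>

type_synonym ('n, 'a) polynomial = "('n \<Rightarrow>\<^sub>0 nat) \<Rightarrow>\<^sub>0 'a"

definition peval :: "('n::finite, 'a::comm_semiring_1) polynomial \<Rightarrow> 'a ^ 'n \<Rightarrow> 'a" where
  "peval P x =
     (\<Sum>m\<in>Poly_Mapping.keys P.
        Poly_Mapping.lookup P m * (\<Prod>i\<in>UNIV. (x $ i) ^ Poly_Mapping.lookup m i))"

definition homogeneous_of_degree :: "nat \<Rightarrow> ('n::finite, 'a::zero) polynomial \<Rightarrow> bool" where
  "homogeneous_of_degree d P \<longleftrightarrow>
     (\<forall>m\<in>Poly_Mapping.keys P. (\<Sum>i\<in>UNIV. Poly_Mapping.lookup m i) = d)"

definition complex_zeros :: "('n::finite, int) polynomial \<Rightarrow> (complex ^ 'n) set" where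
  "complex_zeros P = {x. peval (Poly_Mapping.map of_int P) x = 0}"


section \<open>Dual varieties\<close>

definition vanishing_ideal :: "(complex ^ 'n::finite) set \<Rightarrow> ('n, complex) polynomial set" where
  "vanishing_ideal X = {f. \<forall>x\<in>X. peval f x = 0}"

definition zariski_closure :: "(complex ^ 'n::finite) set \<Rightarrow> (complex ^ 'n) set" where
  "zariski_closure X = {x. \<forall>f\<in>vanishing_ideal X. peval f x = 0}"

text \<open>
  The derivative below is the directional derivative
  \<open>\<Sum>i. (\<partial>f/\<partial>x\<^sub>i)(p) * t\<^sub>i\<close>, so this is the Zariski tangent space.
\<close>

definition tangent_space :: "(complex ^ 'n::finite) set \<Rightarrow> complex ^ 'n \<Rightarrow> (complex ^ 'n) set" where
  "tangent_space X p = {t. \<forall>f\<in>vanishing_ideal X. deriv (\<lambda>z. peval f (p + z *s t)) 0 = 0}"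

text \<open>
  Projective varieties are represented by their affine cones. The smooth points of an
  irreducible variety are those at which the dimension of the Zariski tangent space
  is minimal; the apex of the cone is not a projective point and is excluded.
\<close>

definition smooth_point :: "(complex ^ 'n::finite) set \<Rightarrow> complex ^ 'n \<Rightarrow> bool" where
  "smooth_point X p \<longleftrightarrow> p \<in> X \<and> p \<noteq> 0 \<and>
     (\<forall>q\<in>X. q \<noteq> 0 \<longrightarrow> vec.dim (tangent_space X p) \<le> vec.dim (tangent_space X q))"

text \<open>
  The cone over the dual of an irreducible projective variety: the Zariski closure of the set
  of hyperplanes tangent at some smooth point. The vector \<open>A\<close> stands for the linear form
  \<open>\<Sum>i. A\<^sub>i * x\<^sub>i\<close>.
\<close>

definition dual_variety :: "(complex ^ 'n::finite) set \<Rightarrow> (complex ^ 'n) set" where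
  "dual_variety X = zariski_closure
     {A. \<exists>p. smooth_point X p \<and> (\<forall>t\<in>tangent_space X p. (\<Sum>i\<in>UNIV. A $ i * t $ i) = 0)}"


section \<open>The hyperdeterminant of format 3, 3, 2\<close>

text \<open>
  In the numeral types the largest index is the residue class 0, that is, \<open>3 = 0\<close> in the
  type \<open>3\<close> and \<open>2 = 0\<close> in the type \<open>2\<close>.
\<close>

type_synonym idx = "3 \<times> 3 \<times> 2"
type_synonym exponents = "idx \<Rightarrow>\<^sub>0 nat"

definition segre_cone :: "(complex ^ idx) set" where
  "segre_cone =
     {p. \<exists>(u :: complex ^ 3) (v :: complex ^ 3) (w :: complex ^ 2).
           p = vec_lambda (\<lambda>(i, j, k). u $ i * v $ j * w $ k)}"

text \<open>
  These conditions determine the hyperdeterminant up to sign, so the predicate holds of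
  exactly two polynomials, which are negatives of each other.
\<close>

definition is_hyperdeterminant :: "(idx, int) polynomial \<Rightarrow> bool" where
  "is_hyperdeterminant P \<longleftrightarrow>
     irreducible P \<and>
     Gcd (Poly_Mapping.lookup P ` Poly_Mapping.keys P) = 1 \<and>
     complex_zeros P = dual_variety segre_cone"


section \<open>Symmetries of exponent arrays\<close>

text \<open>
  The index permutations by which \<open>(S\<^sub>3 \<times> S\<^sub>3 \<times> S\<^sub>2) \<rtimes> S\<^sub>2\<close> acts; the
  last factor exchanges the first two indices.
\<close>

definition index_symmetries :: "(idx \<Rightarrow> idx) set" where
  "index_symmetries =
     {\<pi>. \<exists>(\<alpha> :: 3 \<Rightarrow> 3) (\<beta> :: 3 \<Rightarrow> 3) (\<gamma> :: 2 \<Rightarrow> 2). bij \<alpha> \<and> bij \<beta> \<and> bij \<gamma> \<and>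
          (\<pi> = (\<lambda>(i, j, k). (\<alpha> i, \<beta> j, \<gamma> k)) \<or> \<pi> = (\<lambda>(i, j, k). (\<alpha> j, \<beta> i, \<gamma> k)))}"

text \<open>
  For injective \<open>\<pi>\<close>, \<open>map_key \<pi> E\<close> is the array whose entry at \<open>x\<close> is the entry
  of \<open>E\<close> at \<open>\<pi> x\<close>.
\<close>

definition sym_orbit :: "exponents \<Rightarrow> exponents set" where
  "sym_orbit E = (\<lambda>\<pi>. Poly_Mapping.map_key \<pi> E) ` index_symmetries"

definition monomial_of :: "exponents \<Rightarrow> (idx, int) polynomial" where
  "monomial_of E = Poly_Mapping.single E 1"


section \<open>The list of coefficients and orbit representatives\<close>

text \<open>
  Every row consists of a coefficient, an exponent array and the size of its orbit. The array is
  given by three blocks; the \<open>i\<close>-th block is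
  \<open>[[e\<^sub>i\<^sub>1\<^sub>1, e\<^sub>i\<^sub>2\<^sub>1, e\<^sub>i\<^sub>3\<^sub>1], [e\<^sub>i\<^sub>1\<^sub>2, e\<^sub>i\<^sub>2\<^sub>2, e\<^sub>i\<^sub>3\<^sub>2]]\<close>,
  so the position of the entry within the array is \<open>i\<close>, then \<open>k\<close>, then \<open>j\<close>.
\<close>

definition exponents_of_blocks :: "nat list list list \<Rightarrow> exponents" where
  "exponents_of_blocks bs =
     (\<Sum>i<3. \<Sum>j<3. \<Sum>k<2.
        Poly_Mapping.single (of_nat (i + 1), of_nat (j + 1), of_nat (k + 1)) (bs ! i ! k ! j))"

definition table :: "(int \<times> nat list list list \<times> nat) list" where
  "table = [
   (1, [[[0,0,0], [0,0,4]], [[0,2,0], [0,2,0]], [[4,0,0], [0,0,0]]], 36),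
   (-2, [[[0,0,0], [0,0,4]], [[0,3,0], [0,1,0]], [[3,0,0], [1,0,0]]], 36),
   (-2, [[[0,0,0], [0,0,4]], [[0,2,0], [1,1,0]], [[3,1,0], [0,0,0]]], 144),
   (4, [[[0,0,0], [0,0,4]], [[0,3,0], [1,0,0]], [[3,0,0], [0,1,0]]], 36),
   (1, [[[0,0,0], [0,0,4]], [[0,2,0], [2,0,0]], [[2,2,0], [0,0,0]]], 72),
   (-2, [[[0,0,0], [0,0,4]], [[1,1,0], [0,2,0]], [[3,1,0], [0,0,0]]], 72),
   (8, [[[0,0,0], [0,0,4]], [[1,2,0], [0,1,0]], [[2,1,0], [1,0,0]]], 36),
   (4, [[[0,0,0], [0,0,4]], [[1,1,0], [1,1,0]], [[2,2,0], [0,0,0]]], 72),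
   (-10, [[[0,0,0], [0,0,4]], [[1,2,0], [1,0,0]], [[2,1,0], [0,1,0]]], 36),
   (2, [[[0,0,1], [0,0,3]], [[0,2,0], [0,2,0]], [[3,0,0], [1,0,0]]], 36),
   (6, [[[0,0,1], [0,0,3]], [[0,1,0], [1,2,0]], [[3,1,0], [0,0,0]]], 144),
   (4, [[[0,0,1], [0,0,3]], [[0,2,0], [1,1,0]], [[2,1,0], [1,0,0]]], 72),
   (-8, [[[0,0,1], [0,0,3]], [[0,2,0], [1,1,0]], [[3,0,0], [0,1,0]]], 72),
   (-6, [[[0,0,1], [0,0,3]], [[0,1,0], [2,1,0]], [[2,2,0], [0,0,0]]], 144),
   (8, [[[0,0,1], [0,0,3]], [[0,2,0], [2,0,0]], [[2,1,0], [0,1,0]]], 72),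
   (2, [[[0,0,1], [0,0,3]], [[0,1,0], [3,0,0]], [[1,3,0], [0,0,0]]], 72),
   (-10, [[[0,0,1], [0,0,3]], [[1,1,0], [0,2,0]], [[2,1,0], [1,0,0]]], 72),
   (4, [[[0,0,1], [0,0,3]], [[1,1,0], [1,1,0]], [[1,2,0], [1,0,0]]], 72),
   (-6, [[[0,0,2], [0,0,2]], [[0,2,0], [0,2,0]], [[2,0,0], [2,0,0]]], 6),
   (-4, [[[0,0,2], [0,0,2]], [[0,0,0], [1,3,0]], [[3,1,0], [0,0,0]]], 72),
   (-8, [[[0,0,2], [0,0,2]], [[0,1,0], [1,2,0]], [[2,1,0], [1,0,0]]], 72),
   (2, [[[0,0,2], [0,0,2]], [[0,1,0], [1,2,0]], [[3,0,0], [0,1,0]]], 72),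
   (20, [[[0,0,2], [0,0,2]], [[0,2,0], [1,1,0]], [[2,0,0], [1,1,0]]], 36),
   (6, [[[0,0,2], [0,0,2]], [[0,0,0], [2,2,0]], [[2,2,0], [0,0,0]]], 36),
   (10, [[[0,0,2], [0,0,2]], [[0,1,0], [2,1,0]], [[1,2,0], [1,0,0]]], 36),
   (-4, [[[0,0,2], [0,0,2]], [[0,1,0], [2,1,0]], [[2,1,0], [0,1,0]]], 72),
   (-8, [[[0,0,2], [0,0,2]], [[0,2,0], [2,0,0]], [[2,0,0], [0,2,0]]], 18),
   (-16, [[[0,0,2], [0,0,2]], [[1,1,0], [1,1,0]], [[1,1,0], [1,1,0]]], 9),
   (4, [[[0,0,0], [0,1,3]], [[0,1,1], [1,1,0]], [[3,1,0], [0,0,0]]], 72),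
   (2, [[[0,0,0], [0,1,3]], [[0,2,0], [1,0,1]], [[3,1,0], [0,0,0]]], 144),
   (6, [[[0,0,0], [0,1,3]], [[0,2,1], [1,0,0]], [[2,1,0], [1,0,0]]], 144),
   (-12, [[[0,0,0], [0,1,3]], [[0,2,1], [1,0,0]], [[3,0,0], [0,1,0]]], 144),
   (2, [[[0,0,0], [0,1,3]], [[0,2,0], [1,1,0]], [[3,0,1], [0,0,0]]], 144),
   (2, [[[0,0,0], [0,1,3]], [[0,3,0], [1,0,0]], [[2,0,1], [1,0,0]]], 144),
   (-4, [[[0,0,0], [0,1,3]], [[0,3,0], [1,0,0]], [[3,0,0], [0,0,1]]], 72),
   (-2, [[[0,0,0], [0,1,3]], [[0,1,1], [2,0,0]], [[2,2,0], [0,0,0]]], 144),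
   (-2, [[[0,0,0], [0,1,3]], [[0,2,0], [2,0,0]], [[2,1,1], [0,0,0]]], 144),
   (4, [[[0,0,0], [0,1,3]], [[1,1,0], [0,1,1]], [[3,1,0], [0,0,0]]], 36),
   (-16, [[[0,0,0], [0,1,3]], [[1,1,1], [0,1,0]], [[2,1,0], [1,0,0]]], 144),
   (4, [[[0,0,0], [0,1,3]], [[1,1,1], [0,1,0]], [[3,0,0], [0,1,0]]], 72),
   (2, [[[0,0,0], [0,1,3]], [[1,1,0], [0,2,0]], [[3,0,1], [0,0,0]]], 144),
   (-8, [[[0,0,0], [0,1,3]], [[1,2,0], [0,0,1]], [[2,1,0], [1,0,0]]], 72),
   (6, [[[0,0,0], [0,1,3]], [[1,2,1], [0,0,0]], [[1,1,0], [2,0,0]]], 144),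
   (6, [[[0,0,0], [0,1,3]], [[1,2,1], [0,0,0]], [[2,0,0], [1,1,0]]], 144),
   (-8, [[[0,0,0], [0,1,3]], [[1,2,0], [0,1,0]], [[2,0,1], [1,0,0]]], 144),
   (-4, [[[0,0,0], [0,1,3]], [[1,0,1], [1,1,0]], [[2,2,0], [0,0,0]]], 144),
   (-4, [[[0,0,0], [0,1,3]], [[1,1,0], [1,0,1]], [[2,2,0], [0,0,0]]], 144),
   (-8, [[[0,0,0], [0,1,3]], [[1,1,1], [1,0,0]], [[1,2,0], [1,0,0]]], 144),
   (20, [[[0,0,0], [0,1,3]], [[1,1,1], [1,0,0]], [[2,1,0], [0,1,0]]], 144),
   (-8, [[[0,0,0], [0,1,3]], [[1,1,0], [1,1,0]], [[2,1,1], [0,0,0]]], 144),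
   (10, [[[0,0,0], [0,1,3]], [[1,2,0], [1,0,0]], [[2,0,1], [0,1,0]]], 144),
   (10, [[[0,0,0], [0,1,3]], [[1,2,0], [1,0,0]], [[2,1,0], [0,0,1]]], 72),
   (-2, [[[0,0,0], [0,1,3]], [[2,0,0], [0,1,1]], [[2,2,0], [0,0,0]]], 72),
   (-4, [[[0,0,0], [0,1,3]], [[2,0,1], [0,1,0]], [[2,1,0], [0,1,0]]], 144),
   (-2, [[[0,0,0], [0,1,3]], [[2,0,0], [0,2,0]], [[2,1,1], [0,0,0]]], 144),
   (-6, [[[0,0,1], [0,1,2]], [[0,1,1], [1,1,0]], [[2,1,0], [1,0,0]]], 72),
   (-2, [[[0,0,1], [0,1,2]], [[0,1,1], [1,1,0]], [[3,0,0], [0,1,0]]], 144),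
   (-10, [[[0,0,1], [0,1,2]], [[0,2,0], [1,0,1]], [[2,1,0], [1,0,0]]], 144),
   (20, [[[0,0,1], [0,1,2]], [[0,2,0], [1,0,1]], [[3,0,0], [0,1,0]]], 72),
   (-10, [[[0,0,1], [0,1,2]], [[0,2,1], [1,0,0]], [[1,1,0], [2,0,0]]], 72),
   (18, [[[0,0,1], [0,1,2]], [[0,2,1], [1,0,0]], [[2,0,0], [1,1,0]]], 144),
   (4, [[[0,0,1], [0,1,2]], [[0,2,0], [1,1,0]], [[2,0,1], [1,0,0]]], 144),
   (6, [[[0,0,1], [0,1,2]], [[0,2,0], [1,1,0]], [[3,0,0], [0,0,1]]], 144),
   (-8, [[[0,0,1], [0,1,2]], [[0,3,0], [1,0,0]], [[1,0,1], [2,0,0]]], 72),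
   (-6, [[[0,0,1], [0,1,2]], [[0,0,1], [2,1,0]], [[2,2,0], [0,0,0]]], 144),
   (8, [[[0,0,1], [0,1,2]], [[0,1,0], [2,0,1]], [[2,2,0], [0,0,0]]], 144),
   (2, [[[0,0,1], [0,1,2]], [[0,1,1], [2,0,0]], [[1,2,0], [1,0,0]]], 144),
   (2, [[[0,0,1], [0,1,2]], [[0,1,1], [2,0,0]], [[2,1,0], [0,1,0]]], 144),
   (16, [[[0,0,1], [0,1,2]], [[0,1,0], [2,1,0]], [[2,1,1], [0,0,0]]], 144),
   (16, [[[0,0,1], [0,1,2]], [[0,2,0], [2,0,0]], [[1,1,1], [1,0,0]]], 144),
   (-20, [[[0,0,1], [0,1,2]], [[0,2,0], [2,0,0]], [[2,0,1], [0,1,0]]], 144),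
   (-6, [[[0,0,1], [0,1,2]], [[0,2,0], [2,0,0]], [[2,1,0], [0,0,1]]], 72),
   (-8, [[[0,0,1], [0,1,2]], [[0,1,0], [3,0,0]], [[1,2,1], [0,0,0]]], 144),
   (36, [[[0,0,1], [0,1,2]], [[1,1,0], [0,1,1]], [[2,1,0], [1,0,0]]], 36),
   (22, [[[0,0,1], [0,1,2]], [[1,1,1], [0,1,0]], [[1,1,0], [2,0,0]]], 144),
   (-6, [[[0,0,1], [0,1,2]], [[1,1,1], [0,1,0]], [[2,0,0], [1,1,0]]], 72),
   (4, [[[0,0,1], [0,1,2]], [[1,1,0], [0,2,0]], [[2,0,1], [1,0,0]]], 72),
   (4, [[[0,0,1], [0,1,2]], [[1,2,0], [0,0,1]], [[1,1,0], [2,0,0]]], 72),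
   (-10, [[[0,0,1], [0,1,2]], [[1,2,1], [0,0,0]], [[1,0,0], [2,1,0]]], 72),
   (16, [[[0,0,1], [0,1,2]], [[1,0,0], [1,1,1]], [[2,2,0], [0,0,0]]], 144),
   (18, [[[0,0,1], [0,1,2]], [[1,0,1], [1,1,0]], [[1,2,0], [1,0,0]]], 144),
   (-10, [[[0,0,1], [0,1,2]], [[1,0,1], [1,1,0]], [[2,1,0], [0,1,0]]], 144),
   (2, [[[0,0,1], [0,1,2]], [[1,0,0], [1,2,0]], [[2,1,1], [0,0,0]]], 144),
   (4, [[[0,0,1], [0,1,2]], [[1,1,0], [1,0,1]], [[1,2,0], [1,0,0]]], 144),
   (-24, [[[0,0,1], [0,1,2]], [[1,1,0], [1,0,1]], [[2,1,0], [0,1,0]]], 72),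
   (-34, [[[0,0,1], [0,1,2]], [[1,1,1], [1,0,0]], [[1,1,0], [1,1,0]]], 144),
   (2, [[[0,0,1], [0,1,2]], [[1,1,1], [1,0,0]], [[2,0,0], [0,2,0]]], 144),
   (18, [[[0,0,1], [0,1,2]], [[1,1,0], [1,1,0]], [[2,0,1], [0,1,0]]], 144),
   (-26, [[[0,0,1], [0,1,2]], [[1,2,0], [1,0,0]], [[2,0,0], [0,1,1]]], 72),
   (-6, [[[0,0,1], [0,1,2]], [[2,0,1], [0,1,0]], [[2,0,0], [0,2,0]]], 144),
   (-2, [[[0,0,2], [0,1,1]], [[0,1,0], [1,1,1]], [[3,0,0], [0,1,0]]], 72),
   (-38, [[[0,0,2], [0,1,1]], [[0,2,0], [1,0,1]], [[2,0,0], [1,1,0]]], 36),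
   (-24, [[[0,0,2], [0,1,1]], [[0,2,0], [1,1,0]], [[2,0,0], [1,0,1]]], 24),
   (-6, [[[0,0,2], [0,1,1]], [[0,0,0], [2,1,1]], [[2,2,0], [0,0,0]]], 144),
   (-12, [[[0,0,2], [0,1,1]], [[0,1,0], [2,0,1]], [[1,2,0], [1,0,0]]], 144),
   (2, [[[0,0,2], [0,1,1]], [[0,1,0], [2,0,1]], [[2,1,0], [0,1,0]]], 144),
   (-12, [[[0,0,2], [0,1,1]], [[0,1,0], [2,1,0]], [[2,1,0], [0,0,1]]], 144),
   (36, [[[0,0,2], [0,1,1]], [[0,2,0], [2,0,0]], [[2,0,0], [0,1,1]]], 72),
   (6, [[[0,0,2], [0,1,1]], [[0,1,0], [3,0,0]], [[1,2,0], [0,0,1]]], 72),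
   (-62, [[[0,0,2], [0,1,1]], [[1,1,0], [0,1,1]], [[1,1,0], [2,0,0]]], 36),
   (-10, [[[0,0,2], [0,1,1]], [[1,0,0], [1,1,1]], [[1,2,0], [1,0,0]]], 144),
   (-10, [[[0,0,2], [0,1,1]], [[1,0,0], [1,1,1]], [[2,1,0], [0,1,0]]], 72),
   (50, [[[0,0,2], [0,1,1]], [[1,1,0], [1,0,1]], [[1,1,0], [1,1,0]]], 72),
   (2, [[[0,0,3], [0,1,0]], [[0,0,0], [1,2,1]], [[3,0,0], [0,1,0]]], 36),
   (10, [[[0,0,3], [0,1,0]], [[0,0,0], [2,1,1]], [[1,2,0], [1,0,0]]], 144),
   (-4, [[[0,0,3], [0,1,0]], [[0,0,0], [2,1,1]], [[2,1,0], [0,1,0]]], 144),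
   (12, [[[0,0,3], [0,1,0]], [[0,0,0], [2,2,0]], [[2,1,0], [0,0,1]]], 144),
   (-22, [[[0,0,3], [0,1,0]], [[0,1,0], [2,0,1]], [[1,1,0], [1,1,0]]], 144),
   (12, [[[0,0,3], [0,1,0]], [[0,1,0], [2,0,1]], [[2,0,0], [0,2,0]]], 72),
   (6, [[[0,0,3], [0,1,0]], [[0,1,0], [2,1,0]], [[1,1,0], [1,0,1]]], 72),
   (-18, [[[0,0,3], [0,1,0]], [[0,1,0], [2,1,0]], [[2,0,0], [0,1,1]]], 144),
   (18, [[[0,0,3], [0,1,0]], [[0,1,0], [3,0,0]], [[1,1,0], [0,1,1]]], 36),
   (26, [[[0,0,3], [0,1,0]], [[1,0,0], [1,1,1]], [[1,1,0], [1,1,0]]], 72),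
   (1, [[[0,0,0], [0,2,2]], [[0,0,2], [2,0,0]], [[2,2,0], [0,0,0]]], 72),
   (4, [[[0,0,0], [0,2,2]], [[0,1,1], [2,0,0]], [[2,1,1], [0,0,0]]], 72),
   (4, [[[0,0,0], [0,2,2]], [[1,0,1], [1,0,1]], [[2,2,0], [0,0,0]]], 72),
   (4, [[[0,0,0], [0,2,2]], [[1,0,2], [1,0,0]], [[1,2,0], [1,0,0]]], 72),
   (-10, [[[0,0,0], [0,2,2]], [[1,0,2], [1,0,0]], [[2,1,0], [0,1,0]]], 144),
   (8, [[[0,0,0], [0,2,2]], [[1,0,1], [1,1,0]], [[2,1,1], [0,0,0]]], 144),
   (16, [[[0,0,0], [0,2,2]], [[1,1,1], [1,0,0]], [[1,1,1], [1,0,0]]], 36),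
   (-20, [[[0,0,0], [0,2,2]], [[1,1,1], [1,0,0]], [[2,0,1], [0,1,0]]], 144),
   (1, [[[0,0,0], [0,2,2]], [[2,0,0], [0,0,2]], [[2,2,0], [0,0,0]]], 36),
   (4, [[[0,0,0], [0,2,2]], [[2,0,1], [0,0,1]], [[2,1,0], [0,1,0]]], 36),
   (4, [[[0,0,0], [0,2,2]], [[2,0,0], [0,1,1]], [[2,1,1], [0,0,0]]], 72),
   (4, [[[0,0,0], [0,2,2]], [[2,0,1], [0,1,0]], [[2,1,0], [0,0,1]]], 36),
   (4, [[[0,0,1], [0,2,1]], [[0,0,2], [2,0,0]], [[1,2,0], [1,0,0]]], 36),
   (-10, [[[0,0,1], [0,2,1]], [[0,0,2], [2,0,0]], [[2,1,0], [0,1,0]]], 72),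
   (8, [[[0,0,1], [0,2,1]], [[0,0,1], [2,1,0]], [[2,1,1], [0,0,0]]], 144),
   (-20, [[[0,0,1], [0,2,1]], [[0,1,0], [2,0,1]], [[2,1,1], [0,0,0]]], 144),
   (-12, [[[0,0,1], [0,2,1]], [[0,1,1], [2,0,0]], [[1,1,1], [1,0,0]]], 72),
   (22, [[[0,0,1], [0,2,1]], [[0,1,1], [2,0,0]], [[2,0,1], [0,1,0]]], 144),
   (-6, [[[0,0,1], [0,2,1]], [[0,1,1], [2,0,0]], [[2,1,0], [0,0,1]]], 144),
   (18, [[[0,0,1], [0,2,1]], [[0,2,0], [2,0,0]], [[2,0,1], [0,0,1]]], 72),
   (-26, [[[0,0,1], [0,2,1]], [[1,0,1], [1,0,1]], [[1,2,0], [1,0,0]]], 72),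
   (30, [[[0,0,1], [0,2,1]], [[1,0,1], [1,0,1]], [[2,1,0], [0,1,0]]], 72),
   (-12, [[[0,0,1], [0,2,1]], [[1,0,0], [1,1,1]], [[2,1,1], [0,0,0]]], 144),
   (-10, [[[0,0,1], [0,2,1]], [[1,0,1], [1,1,0]], [[1,1,1], [1,0,0]]], 144),
   (2, [[[0,0,1], [0,2,1]], [[1,0,1], [1,1,0]], [[2,1,0], [0,0,1]]], 144),
   (18, [[[0,0,1], [0,2,1]], [[1,1,0], [1,0,1]], [[1,1,1], [1,0,0]]], 144),
   (16, [[[0,0,1], [0,2,1]], [[1,1,0], [1,0,1]], [[2,1,0], [0,0,1]]], 144),
   (-26, [[[0,0,1], [0,2,1]], [[1,1,0], [1,1,0]], [[2,0,1], [0,0,1]]], 36),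
   (18, [[[0,0,1], [0,2,1]], [[1,2,0], [1,0,0]], [[2,0,0], [0,0,2]]], 36),
   (4, [[[0,0,2], [0,2,0]], [[0,0,0], [2,1,1]], [[2,1,1], [0,0,0]]], 72),
   (-24, [[[0,0,2], [0,2,0]], [[0,0,1], [2,1,0]], [[2,1,0], [0,0,1]]], 72),
   (18, [[[0,0,2], [0,2,0]], [[0,1,0], [2,0,1]], [[2,1,0], [0,0,1]]], 72),
   (-27, [[[0,0,2], [0,2,0]], [[0,2,0], [2,0,0]], [[2,0,0], [0,0,2]]], 12),
   (-26, [[[0,0,2], [0,2,0]], [[1,0,0], [1,1,1]], [[1,1,1], [1,0,0]]], 72),
   (16, [[[0,0,2], [0,2,0]], [[1,0,1], [1,1,0]], [[1,0,1], [1,1,0]]], 36),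
   (44, [[[0,0,2], [0,2,0]], [[1,0,1], [1,1,0]], [[1,1,0], [1,0,1]]], 72),
   (-68, [[[0,0,2], [0,2,0]], [[1,1,0], [1,0,1]], [[1,1,0], [1,0,1]]], 36),
   (36, [[[0,1,1], [0,1,1]], [[1,0,1], [1,0,1]], [[1,1,0], [1,1,0]]], 6),
   (36, [[[0,1,1], [0,1,1]], [[1,0,0], [1,1,1]], [[1,1,1], [1,0,0]]], 36),
   (-104, [[[0,1,1], [0,1,1]], [[1,0,1], [1,1,0]], [[1,1,0], [1,0,1]]], 18),
   (-4, [[[0,0,0], [1,1,2]], [[0,1,1], [1,1,0]], [[2,1,1], [0,0,0]]], 72),
   (-2, [[[0,0,0], [1,1,2]], [[0,2,0], [1,0,1]], [[2,1,1], [0,0,0]]], 144),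
   (-4, [[[0,0,0], [1,1,2]], [[0,2,1], [1,0,0]], [[1,1,1], [1,0,0]]], 144),
   (26, [[[0,0,0], [1,1,2]], [[0,2,1], [1,0,0]], [[2,0,1], [0,1,0]]], 72),
   (-16, [[[0,0,0], [1,1,2]], [[0,2,1], [1,0,0]], [[2,1,0], [0,0,1]]], 144),
   (-4, [[[0,0,0], [1,1,2]], [[1,1,0], [0,1,1]], [[2,1,1], [0,0,0]]], 72),
   (-8, [[[0,0,0], [1,1,2]], [[1,1,1], [0,1,0]], [[1,1,1], [1,0,0]]], 72),
   (24, [[[0,0,0], [1,1,2]], [[1,1,1], [0,1,0]], [[2,1,0], [0,0,1]]], 144),
   (-2, [[[0,0,0], [1,1,2]], [[1,2,0], [0,0,1]], [[2,1,0], [0,0,1]]], 36),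
   (54, [[[0,0,1], [1,1,1]], [[0,1,1], [1,1,0]], [[1,1,1], [1,0,0]]], 36),
   (-22, [[[0,0,1], [1,1,1]], [[0,1,1], [1,1,0]], [[2,0,1], [0,1,0]]], 144),
   (-8, [[[0,0,1], [1,1,1]], [[0,1,1], [1,1,0]], [[2,1,0], [0,0,1]]], 144),
   (-4, [[[0,0,1], [1,1,1]], [[0,2,0], [1,0,1]], [[2,0,1], [0,1,0]]], 144),
   (38, [[[0,0,1], [1,1,1]], [[0,2,0], [1,0,1]], [[2,1,0], [0,0,1]]], 72),
   (6, [[[0,0,1], [1,1,1]], [[0,2,1], [1,0,0]], [[1,1,0], [1,0,1]]], 72),
   (10, [[[0,0,1], [1,1,1]], [[0,1,1], [2,0,0]], [[1,2,0], [0,0,1]]], 144),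
   (-2, [[[0,0,1], [1,1,1]], [[1,1,0], [0,1,1]], [[1,1,1], [1,0,0]]], 72),
   (-36, [[[0,0,1], [1,1,1]], [[1,1,0], [0,1,1]], [[2,1,0], [0,0,1]]], 72),
   (12, [[[0,0,2], [1,1,0]], [[0,0,1], [1,2,0]], [[2,1,0], [0,0,1]]], 72),
   (-30, [[[0,0,2], [1,1,0]], [[0,2,0], [1,0,1]], [[2,0,0], [0,1,1]]], 12),
   (-16, [[[0,0,2], [1,1,0]], [[0,1,0], [2,0,1]], [[1,2,0], [0,0,1]]], 72),
   (-32, [[[0,0,2], [1,1,0]], [[0,1,1], [2,0,0]], [[1,1,0], [0,1,1]]], 72),
   (76, [[[0,0,2], [1,1,0]], [[1,1,0], [0,1,1]], [[1,1,0], [1,0,1]]], 36),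
   (10, [[[0,0,1], [1,2,0]], [[1,0,1], [0,1,1]], [[2,1,0], [0,0,1]]], 72),
   (-30, [[[0,1,1], [1,0,1]], [[1,1,0], [0,1,1]], [[1,0,1], [1,1,0]]], 12)]"

definition coeff_at :: "nat \<Rightarrow> int" where
  "coeff_at n = fst (table ! (n - 1))"

definition exponents_at :: "nat \<Rightarrow> exponents" where
  "exponents_at n = exponents_of_blocks (fst (snd (table ! (n - 1))))"

definition size_at :: "nat \<Rightarrow> nat" where
  "size_at n = snd (snd (table ! (n - 1)))"

definition orbit_at :: "nat \<Rightarrow> exponents set" where
  "orbit_at n = sym_orbit (exponents_at n)"

definition F332 :: "(idx, int) polynomial" where
  "F332 = (\<Sum>n = 1..178. of_int (coeff_at n) * (\<Sum>E\<in>orbit_at n. monomial_of E))"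

end

theory Submission
  imports
    Defs
    "HOL-Library.Product_Lexorder"
    "HOL-Library.List_Lexorder"
    "HOL-Computational_Algebra.Fundamental_Theorem_Algebra"
    "HOL-Analysis.Determinants"
begin

text \<open>
  Writing an array as a pencil \<open>s A\<^sub>1 + t A\<^sub>2\<close> of \<open>3 \<times> 3\<close> matrices, the hyperdeterminant is the
  discriminant \<open>D\<close> of the binary cubic \<open>det (s A\<^sub>1 + t A\<^sub>2)\<close> (Schlaefli's method).

  A hyperplane \<open>A\<close> is tangent to the Segre variety at \<open>u \<otimes> v \<otimes> w\<close> iff \<open>u\<close> and \<open>v\<close> are left and
  right kernel vectors of the member \<open>M\<close> of the pencil at \<open>w\<close> and \<open>u A\<^sub>1 v = u A\<^sub>2 v = 0\<close>. Since
  \<open>u \<otimes> v\<close> is proportional to the cofactor matrix of \<open>M\<close> if that is nonzero, this says that \<open>w\<close> is a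
  double root of the cubic. So the tangent hyperplanes already form the closed set \<open>D = 0\<close>.

  A factor of \<open>D\<close> is homogeneous in the variables of each row (that is, of each \<open>i\<close>) and of each
  column. Specialising all but one such line to numbers and that line to linear polynomials in one
  variable turns \<open>D\<close> into an irreducible quartic, so one of the two factors does not involve the line.
  If different rows belonged to different factors, some variable would not occur in \<open>D\<close>.

  All monomials of \<open>D\<close> have row and column sums 4 and slice sums 6, and there are at most 16749
  such arrays. The representatives \<open>E\<^sub>n\<close> are the lexicographically least elements of their orbits, so
  the orbits are disjoint; their sizes follow from counting stabilizers and add up to 16749. Hence
  they exhaust the monomials of \<open>D\<close>, and as \<open>D\<close> is invariant under the group it remains to extract
  its coefficients at the representatives.
\<close>

abbreviation "lookup \<equiv> Poly_Mapping.lookup"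
abbreviation "keys \<equiv> Poly_Mapping.keys"
abbreviation "single \<equiv> Poly_Mapping.single"

subsection \<open>Evaluation homomorphisms\<close>

text \<open>Coefficients pass through \<open>\<phi>\<close> and the values may lie in any ring. So
  one notion covers values at complex points, renaming of variables, specialisation to
  \<open>int poly\<close> and the grading substitution.\<close>

definition eval_poly ::
  "('a::comm_semiring_1 \<Rightarrow> 'b::comm_semiring_1) \<Rightarrow> ('n::finite \<Rightarrow> 'b) \<Rightarrow> ('n, 'a) polynomial \<Rightarrow> 'b"
  where "eval_poly \<phi> X P = (\<Sum>m\<in>keys P. \<phi> (lookup P m) * (\<Prod>i\<in>UNIV. X i ^ lookup m i))"

definition Var :: "'n \<Rightarrow> ('n, 'a::comm_semiring_1) polynomial" where
  "Var i = single (single i 1) 1"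

lemma sum_singles: "(\<Sum>m\<in>keys P. single m (lookup P m)) = P"
  by (rule poly_mapping_eqI)
    (auto simp: lookup_sum lookup_single when_def in_keys_iff sum.delta)

locale coeff_hom =
  fixes \<phi> :: "'a::comm_ring_1 \<Rightarrow> 'b::comm_ring_1"
  assumes hom_zero: "\<phi> 0 = 0" and hom_one: "\<phi> 1 = 1"
    and hom_add: "\<phi> (a + b) = \<phi> a + \<phi> b"
    and hom_mult: "\<phi> (a * b) = \<phi> a * \<phi> b"
begin

lemma eval_superset:
  assumes "finite A" "keys P \<subseteq> A"
  shows "eval_poly \<phi> X P = (\<Sum>m\<in>A. \<phi> (lookup P m) * (\<Prod>i\<in>UNIV. X i ^ lookup m i))"
  unfolding eval_poly_def using assms
  by (intro sum.mono_neutral_left) (auto simp: in_keys_iff hom_zero)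

lemma eval_add: "eval_poly \<phi> X (P + Q) = eval_poly \<phi> X P + eval_poly \<phi> X Q"
proof -
  let ?A = "keys P \<union> keys Q"
  have "keys (P + Q) \<subseteq> ?A" by (rule keys_add)
  then show ?thesis
    by (subst (1 2 3) eval_superset[of ?A])
      (auto simp: lookup_add hom_add algebra_simps sum.distrib)
qed

lemma eval_zero: "eval_poly \<phi> X 0 = 0"
  by (simp add: eval_poly_def)

lemma eval_sum: "eval_poly \<phi> X (sum f A) = (\<Sum>a\<in>A. eval_poly \<phi> X (f a))"
  by (induction A rule: infinite_finite_induct) (auto simp: eval_add eval_zero)

lemma eval_single: "eval_poly \<phi> X (single m c) = \<phi> c * (\<Prod>i\<in>UNIV. X i ^ lookup m i)"
  by (simp add: eval_superset[of "{m}"])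

lemma eval_single_mult:
  "eval_poly \<phi> X (single m c * single n d) = eval_poly \<phi> X (single m c) * eval_poly \<phi> X (single n d)"
  by (simp only: mult_single eval_single hom_mult lookup_add power_add prod.distrib ac_simps)

lemma eval_mult: "eval_poly \<phi> X (P * Q) = eval_poly \<phi> X P * eval_poly \<phi> X Q"
proof -
  let ?s = "\<lambda>P m. single m (lookup P m)"
  have "P * Q = (\<Sum>m\<in>keys P. \<Sum>n\<in>keys Q. ?s P m * ?s Q n)"
    by (simp only: sum_singles flip: sum_product)
  then have "eval_poly \<phi> X (P * Q) =
      (\<Sum>m\<in>keys P. \<Sum>n\<in>keys Q. eval_poly \<phi> X (?s P m) * eval_poly \<phi> X (?s Q n))"
    by (simp only: eval_sum eval_single_mult)
  also have "\<dots> = (\<Sum>m\<in>keys P. eval_poly \<phi> X (?s P m)) * (\<Sum>n\<in>keys Q. eval_poly \<phi> X (?s Q n))"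
    by (rule sum_product[symmetric])
  also have "\<dots> = eval_poly \<phi> X P * eval_poly \<phi> X Q"
    by (simp only: sum_singles flip: eval_sum)
  finally show ?thesis .
qed

lemma eval_one: "eval_poly \<phi> X 1 = 1"
  using eval_single[of X 0 1] by (simp add: hom_one)

lemma eval_uminus: "eval_poly \<phi> X (- P) = - eval_poly \<phi> X P"
  using eval_add[of X P "- P"] by (simp add: eval_zero eq_neg_iff_add_eq_0 add.commute)

lemma eval_diff: "eval_poly \<phi> X (P - Q) = eval_poly \<phi> X P - eval_poly \<phi> X Q"
  using eval_add[of X P "- Q"] by (simp add: eval_uminus)

lemma eval_power: "eval_poly \<phi> X (P ^ n) = eval_poly \<phi> X P ^ n"
  by (induction n) (auto simp: eval_one eval_mult)

lemma eval_of_nat: "eval_poly \<phi> X (of_nat n) = of_nat n"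
  by (induction n) (auto simp: eval_zero eval_one eval_add)

lemma eval_numeral: "eval_poly \<phi> X (numeral k) = numeral k"
  using eval_of_nat[of X "numeral k"] by simp

lemma eval_of_int: "eval_poly \<phi> X (of_int n) = of_int n"
  by (cases n) (auto simp: eval_of_nat eval_uminus eval_diff eval_one)

lemma eval_Var: "eval_poly \<phi> X (Var i) = X i"
proof -
  have "(\<Prod>j\<in>UNIV. X j ^ lookup (single i 1) j) = (\<Prod>j\<in>UNIV. if j = i then X i else 1)"
    by (intro prod.cong) (auto simp: lookup_single when_def)
  then show ?thesis by (simp add: Var_def eval_single hom_one prod.delta)
qed

lemma eval_sum_list: "eval_poly \<phi> X (sum_list Ps) = (\<Sum>P\<leftarrow>Ps. eval_poly \<phi> X P)"
  by (induction Ps) (auto simp: eval_zero eval_add)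

lemmas eval_simps = eval_zero eval_one eval_add eval_mult eval_uminus eval_diff eval_power
  eval_numeral eval_of_int eval_Var eval_sum_list

end

interpretation hom_of_int: coeff_hom "of_int :: int \<Rightarrow> 'a::comm_ring_1"
  by unfold_locales auto

interpretation hom_id: coeff_hom "\<lambda>x :: 'a::comm_ring_1. x"
  by unfold_locales auto

lemma peval_eq_eval_poly: "peval P x = eval_poly (\<lambda>c. c) (($) x) P"
  by (simp add: peval_def eval_poly_def)

lemma peval_map_of_int:
  fixes x :: "complex ^ 'n::finite"
  shows "peval (Poly_Mapping.map of_int P) x = eval_poly of_int (($) x) P"
proof -
  have "keys (Poly_Mapping.map of_int P :: ('n, complex) polynomial) = keys P"
    by (auto simp: in_keys_iff map.rep_eq when_def)
  then show ?thesis
    by (simp add: peval_def eval_poly_def map.rep_eq when_def in_keys_iff)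
qed

subsection \<open>Gradings\<close>

definition weight :: "('n::finite \<Rightarrow> nat) \<Rightarrow> ('n \<Rightarrow>\<^sub>0 nat) \<Rightarrow> nat" where
  "weight w m = (\<Sum>i\<in>UNIV. w i * lookup m i)"

definition isobaric :: "('n::finite \<Rightarrow> nat) \<Rightarrow> nat \<Rightarrow> ('n, 'a::zero) polynomial \<Rightarrow> bool" where
  "isobaric w d P \<longleftrightarrow> (\<forall>m\<in>keys P. weight w m = d)"

lemma weight_add: "weight w (m + n) = weight w m + weight w n"
  by (simp add: weight_def lookup_add algebra_simps sum.distrib)

lemma isobaric_mult:
  assumes "isobaric w d P" "isobaric w e Q"
  shows "isobaric w (d + e) (P * Q)"
  using assms keys_mult[of P Q] by (fastforce simp: isobaric_def weight_add)

lemma isobaric_add: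
  assumes "isobaric w d P" "isobaric w d Q"
  shows "isobaric w d (P + Q)"
  using assms keys_add[of P Q] by (fastforce simp: isobaric_def)

lemma isobaric_zero: "isobaric w d 0"
  by (simp add: isobaric_def)

lemma isobaric_uminus:
  fixes P :: "('n::finite, 'a::ab_group_add) polynomial"
  assumes "isobaric w d P"
  shows "isobaric w d (- P)"
  using assms by (simp add: isobaric_def in_keys_iff)

lemma isobaric_diff:
  fixes P :: "('n::finite, 'a::ab_group_add) polynomial"
  assumes "isobaric w d P" "isobaric w d Q"
  shows "isobaric w d (P - Q)"
  using isobaric_add[OF assms(1) isobaric_uminus[OF assms(2)]] by simp

lemma isobaric_sum_list: "(\<And>P. P \<in> set Ps \<Longrightarrow> isobaric w d P) \<Longrightarrow> isobaric w d (sum_list Ps)"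
  by (induction Ps) (auto simp: isobaric_zero isobaric_add)

lemma weight_single: "weight w (single i c) = w i * c"
proof -
  have "weight w (single i c) = (\<Sum>j\<in>UNIV. if j = i then w i * c else 0)"
    unfolding weight_def by (intro sum.cong) (auto simp: lookup_single when_def)
  then show ?thesis by (simp add: sum.delta)
qed

lemma isobaric_Var: "isobaric w (w i) (Var i :: ('n::finite, 'a::comm_ring_1) polynomial)"
  by (simp add: isobaric_def Var_def weight_single)

lemma isobaric_one: "isobaric w 0 (1 :: ('n::finite, 'a::comm_ring_1) polynomial)"
  by (simp add: isobaric_def weight_def)

lemma isobaric_of_nat: "isobaric w 0 (of_nat n :: ('n::finite, 'a::comm_ring_1) polynomial)"
  by (induction n) (auto simp: isobaric_zero isobaric_one isobaric_add)

lemma isobaric_numeral: "isobaric w 0 (numeral k :: ('n::finite, 'a::comm_ring_1) polynomial)"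
  using isobaric_of_nat[of w "numeral k"] by simp

subsection \<open>Coefficients of products\<close>

text \<open>Multiplication by a variable shifts exponents. Coefficients of products of variables can
  thus be found by dividing the monomial by one variable at a time.\<close>

lemma lookup_Var_mult:
  fixes Q :: "('n, int) polynomial"
  shows "lookup (Var p * Q) E = (if lookup E p = 0 then 0 else lookup Q (E - single p 1))"
proof -
  \<comment> \<open>Subtraction of exponents is truncated, so it inverts addition only where the
    exponent at \<open>p\<close> is positive.\<close>
  have split: "E = single p 1 + m \<longleftrightarrow> lookup E p \<noteq> 0 \<and> m = E - single p 1" for m
  proof
    assume "E = single p 1 + m"
    then show "lookup E p \<noteq> 0 \<and> m = E - single p 1" by (auto simp: lookup_add)
  next
    assume "lookup E p \<noteq> 0 \<and> m = E - single p 1"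
    then show "E = single p 1 + m"
      by (intro poly_mapping_eqI) (auto simp: lookup_add lookup_minus lookup_single when_def)
  qed
  have "Var p * Q = (\<Sum>m\<in>keys Q. single (single p 1 + m) (lookup Q m))"
  proof -
    have "Var p * Q = Var p * (\<Sum>m\<in>keys Q. single m (lookup Q m))" by (simp add: sum_singles)
    also have "\<dots> = (\<Sum>m\<in>keys Q. single (single p 1 + m) (lookup Q m))"
      by (simp add: sum_distrib_left Var_def mult_single)
    finally show ?thesis .
  qed
  then have "lookup (Var p * Q) E = (\<Sum>m\<in>keys Q. lookup Q m when single p 1 + m = E)"
    by (simp add: lookup_sum lookup_single)
  also have "\<dots> = (\<Sum>m\<in>keys Q. if m = E - single p 1 then (if lookup E p \<noteq> 0 then lookup Q m else 0) else 0)"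
    by (intro sum.cong refl) (simp only: when_def eq_commute[of _ E] split, simp)
  also have "\<dots> = (if lookup E p = 0 then 0 else lookup Q (E - single p 1))"
    by (auto simp: sum.delta in_keys_iff)
  finally show ?thesis .
qed

lemma lookup_of_int_mult:
  fixes Q :: "('n, int) polynomial"
  shows "lookup (of_int c * Q) E = c * lookup Q E"
proof -
  have "of_int c * Q = Poly_Mapping.map ((*) c) Q"
    by (simp add: mult_map_scale_conv_mult flip: single_of_int)
  then show ?thesis by (simp add: map.rep_eq when_def)
qed

lemma lookup_numeral_mult:
  fixes Q :: "('n, int) polynomial"
  shows "lookup (numeral k * Q) E = numeral k * lookup Q E"
  using lookup_of_int_mult[of "numeral k" Q E] by simp

lemma lookup_sum_list: "lookup (sum_list Ps) E = (\<Sum>P\<leftarrow>Ps. lookup P E)"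
  by (induction Ps) (auto simp: lookup_add)

subsection \<open>The discriminant of the pencil\<close>

text \<open>The Leibniz formula of a 3 by 3 determinant: a sign, then the columns chosen in rows 1,
  2, 3, counted from 0.\<close>

definition perm_signs :: "(int \<times> nat \<times> nat \<times> nat) list" where
  "perm_signs = [(1,0,1,2), (-1,0,2,1), (-1,1,0,2), (1,1,2,0), (1,2,0,1), (-1,2,1,0)]"

text \<open>The ways to take the entry from the second slice (\<open>True\<close>) in exactly
  \<open>l\<close> of the three rows.\<close>

definition slice_choices :: "nat \<Rightarrow> (bool \<times> bool \<times> bool) list" where
  "slice_choices l =
     (if l = 0 then [(False, False, False)]
      else if l = 1 then [(True, False, False), (False, True, False), (False, False, True)]
      else if l = 2 then [(False, True, True), (True, False, True), (True, True, False)]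
      else [(True, True, True)])"

definition col :: "nat \<Rightarrow> 3" where
  "col j = (if j = 0 then 1 else if j = 1 then 2 else 3)"

definition slice :: "bool \<Rightarrow> 2" where
  "slice k = (if k then 2 else 1)"

text \<open>With A and B the two slices, this is the coefficient of s^(3-l) t^l in det (s A + t
  B).\<close>

definition cubic_coeff :: "(idx \<Rightarrow> 'a::comm_ring_1) \<Rightarrow> nat \<Rightarrow> 'a" where
  "cubic_coeff X l = (\<Sum>(s, j1, j2, j3)\<leftarrow>perm_signs. \<Sum>(k1, k2, k3)\<leftarrow>slice_choices l.
     of_int s * (X (1, col j1, slice k1) * (X (2, col j2, slice k2) * X (3, col j3, slice k3))))"

text \<open>The discriminant of c0 s^3 + c1 s^2 t + c2 s t^2 + c3 t^3. The order and nesting of the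
  factors match the lists in \<open>disc_coeff\<close>.\<close>

definition cubic_disc :: "(nat \<Rightarrow> 'a::comm_ring_1) \<Rightarrow> 'a" where
  "cubic_disc c = c 1 * (c 1 * (c 2 * c 2)) - 4 * (c 0 * (c 2 * (c 2 * c 2)))
     - 4 * (c 3 * (c 1 * (c 1 * c 1))) - 27 * (c 0 * (c 3 * (c 0 * c 3)))
     + 18 * (c 0 * (c 3 * (c 1 * c 2)))"

definition pencil_disc :: "(idx \<Rightarrow> 'a::comm_ring_1) \<Rightarrow> 'a" where
  "pencil_disc X = cubic_disc (cubic_coeff X)"

definition disc_poly :: "(idx, int) polynomial" where
  "disc_poly = pencil_disc Var"

context coeff_hom begin

lemma eval_cubic_coeff:
  "eval_poly \<phi> X (cubic_coeff Y l) = cubic_coeff (\<lambda>p. eval_poly \<phi> X (Y p)) l"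
  by (simp add: cubic_coeff_def eval_sum_list o_def case_prod_unfold eval_mult eval_of_int)

lemma eval_pencil_disc:
  "eval_poly \<phi> X (pencil_disc Y) = pencil_disc (\<lambda>p. eval_poly \<phi> X (Y p))"
  by (simp add: pencil_disc_def cubic_disc_def eval_simps eval_cubic_coeff)

lemma eval_disc_poly: "eval_poly \<phi> X (pencil_disc Var) = pencil_disc X"
  by (simp add: eval_pencil_disc eval_Var)

end

lemma UNIV_idx: "(UNIV :: idx set) = {1,2,3} \<times> {1,2,3} \<times> {1,2}"
  unfolding UNIV_Times_UNIV[symmetric] UNIV_3 UNIV_2 ..

subsection \<open>Exponent arrays as grids\<close>

text \<open>Concrete lists of rows, with the exponents of both slices paired in each entry.
  Coefficients, orbits and comparisons can then be computed by evaluation.\<close>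

type_synonym grid = "(nat \<times> nat) list list"

definition grid_row :: "exponents \<Rightarrow> 3 \<Rightarrow> (nat \<times> nat) list" where
  "grid_row E i = map (\<lambda>j. (lookup E (i, j, 1), lookup E (i, j, 2))) [1, 2, 3]"

definition grid :: "exponents \<Rightarrow> grid" where
  "grid E = [grid_row E 1, grid_row E 2, grid_row E 3]"

lemma grid_inject: "grid E = grid F \<longleftrightarrow> E = F"
proof
  assume "grid E = grid F"
  then have "lookup E p = lookup F p" for p
  proof -
    have "p \<in> {1,2,3} \<times> {1,2,3} \<times> {1,2}" using UNIV_idx by blast
    with \<open>grid E = grid F\<close> show ?thesis by (auto simp: grid_def grid_row_def)
  qed
  then show "E = F" by (rule poly_mapping_eqI)
qed simp

definition zero_grid :: grid where
  "zero_grid = replicate 3 (replicate 3 (0, 0))"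

lemma grid_eq_zero_iff: "grid E = zero_grid \<longleftrightarrow> E = 0"
proof -
  have "zero_grid = grid 0" by (simp add: zero_grid_def grid_def grid_row_def numeral_3_eq_3)
  then show ?thesis by (metis grid_inject)
qed

text \<open>Division of a monomial by a variable, seen in the row of that variable;
  \<open>None\<close> means that the variable does not divide it.\<close>

fun decr :: "nat \<Rightarrow> bool \<Rightarrow> (nat \<times> nat) list \<Rightarrow> (nat \<times> nat) list option" where
  "decr 0 False ((Suc x, y) # r) = Some ((x, y) # r)"
| "decr 0 True ((x, Suc y) # r) = Some ((x, y) # r)"
| "decr (Suc j) k (z # r) = map_option (Cons z) (decr j k r)"
| "decr _ _ _ = None"

lemma decr_grid_row:
  assumes "j < 3"
  shows "decr j k (grid_row E i) =
    (if lookup E (i, col j, slice k) = 0 then None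
     else Some (grid_row (E - single (i, col j, slice k) 1) i))"
proof -
  have "j = 0 \<or> j = 1 \<or> j = 2" using assms by auto
  then show ?thesis
    apply (elim disjE; cases k; cases "lookup E (i, col j, slice k)")
    apply (simp_all add: grid_row_def col_def slice_def lookup_minus lookup_single numeral_2_eq_2)
    done
qed

lemma grid_row_diff: "i \<noteq> i' \<Longrightarrow> grid_row (E - single (i', j, k) c) i = grid_row E i"
  by (simp add: grid_row_def lookup_minus lookup_single when_def)

lemma grid_row_diff_left:
  "i \<noteq> i' \<Longrightarrow> grid_row (E - single (i', j, k) c - m) i = grid_row (E - m) i"
  "i \<noteq> i' \<Longrightarrow> grid_row (E - single (i', j, k) c - m - n) i = grid_row (E - m - n) i"
  by (simp_all add: grid_row_def lookup_minus lookup_single when_def)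

text \<open>Coefficient extraction from a product of coefficients of the cubic: each term of the
  first factor takes one variable from every row, and the quotient goes to the remaining
  factors.\<close>

fun product_coeff :: "nat list \<Rightarrow> grid \<Rightarrow> int" where
  "product_coeff [] M = (if M = zero_grid then 1 else 0)"
| "product_coeff (l # ls) [p, q, r] = (\<Sum>(s, j1, j2, j3)\<leftarrow>perm_signs. \<Sum>(k1, k2, k3)\<leftarrow>slice_choices l.
     (case decr j1 k1 p of None \<Rightarrow> 0 | Some p' \<Rightarrow>
     (case decr j2 k2 q of None \<Rightarrow> 0 | Some q' \<Rightarrow>
     (case decr j3 k3 r of None \<Rightarrow> 0 | Some r' \<Rightarrow> s * product_coeff ls [p', q', r']))))"
| "product_coeff (l # ls) _ = 0"

text \<open>The three variables of a Leibniz term lie in different rows, so the three divisions do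
  not interfere and can be carried out row by row.\<close>

lemma lookup_prod_cubic_coeff:
  "lookup (prod_list (map (cubic_coeff Var) ls)) E = product_coeff ls (grid E)"
proof (induction ls arbitrary: E)
  case Nil
  then show ?case by (simp add: grid_eq_zero_iff lookup_one when_def)
next
  case (Cons l ls)
  let ?Q = "prod_list (map (cubic_coeff Var) ls) :: (idx, int) polynomial"
  have step: "lookup (of_int s * (Var (1, col j1, slice k1) * (Var (2, col j2, slice k2) * Var (3, col j3, slice k3))) * ?Q) E =
     (case decr j1 k1 (grid_row E 1) of None \<Rightarrow> 0 | Some p' \<Rightarrow>
     (case decr j2 k2 (grid_row E 2) of None \<Rightarrow> 0 | Some q' \<Rightarrow>
     (case decr j3 k3 (grid_row E 3) of None \<Rightarrow> 0 | Some r' \<Rightarrow> s * product_coeff ls [p', q', r'])))"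
    if "j1 < 3" "j2 < 3" "j3 < 3" for s j1 j2 j3 k1 k2 k3
  proof -
    have neq: "(1::3) \<noteq> 2" "(2::3) \<noteq> 1" "(1::3) \<noteq> 3" "(3::3) \<noteq> 1" "(2::3) \<noteq> 3" "(3::3) \<noteq> 2" by auto
    show ?thesis
      unfolding mult.assoc lookup_of_int_mult lookup_Var_mult Cons.IH decr_grid_row[OF that(1)] decr_grid_row[OF that(2)] decr_grid_row[OF that(3)]
      by (simp add: grid_def grid_row_diff grid_row_diff_left neq lookup_minus lookup_single del: One_nat_def)
  qed
  have "lookup (prod_list (map (cubic_coeff Var) (l # ls))) E =
     (\<Sum>(s, j1, j2, j3)\<leftarrow>perm_signs. \<Sum>(k1, k2, k3)\<leftarrow>slice_choices l.
        lookup (of_int s * (Var (1, col j1, slice k1) * (Var (2, col j2, slice k2) * Var (3, col j3, slice k3))) * ?Q) E)"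
    by (simp add: cubic_coeff_def sum_list_mult_const[symmetric] lookup_sum_list o_def case_prod_unfold)
  also have "\<dots> = product_coeff (l # ls) (grid E)"
    unfolding grid_def product_coeff.simps
  proof (intro arg_cong[where f = sum_list] map_cong refl, goal_cases)
    case (1 x)
    obtain s j1 j2 j3 where x: "x = (s, j1, j2, j3)" by (cases x)
    with 1 have j: "j1 < 3" "j2 < 3" "j3 < 3" by (auto simp: perm_signs_def)
    show ?case
      unfolding x prod.case
      by (intro arg_cong[where f = sum_list] map_cong refl) (auto simp only: step[OF j] split: prod.split)
  qed
  finally show ?case .
qed

definition disc_coeff :: "grid \<Rightarrow> int" where
  "disc_coeff M = product_coeff [1, 1, 2, 2] M - 4 * product_coeff [0, 2, 2, 2] M
     - 4 * product_coeff [3, 1, 1, 1] M - 27 * product_coeff [0, 3, 0, 3] M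
     + 18 * product_coeff [0, 3, 1, 2] M"

lemma lookup_disc_poly: "lookup disc_poly E = disc_coeff (grid E)"
  unfolding disc_coeff_def lookup_prod_cubic_coeff[symmetric]
  by (simp add: disc_poly_def pencil_disc_def cubic_disc_def lookup_add lookup_minus lookup_numeral_mult)

subsection \<open>Homogeneity\<close>

definition row_weight :: "3 \<Rightarrow> idx \<Rightarrow> nat" where
  "row_weight i = (\<lambda>(i', j, k). of_bool (i' = i))"

definition col_weight :: "3 \<Rightarrow> idx \<Rightarrow> nat" where
  "col_weight j = (\<lambda>(i, j', k). of_bool (j' = j))"

definition slice_weight :: "2 \<Rightarrow> idx \<Rightarrow> nat" where
  "slice_weight k = (\<lambda>(i, j, k'). of_bool (k' = k))"

lemma isobaric_cubic_coeff:
  assumes "\<And>s j1 j2 j3 k1 k2 k3. (s, j1, j2, j3) \<in> set perm_signs \<Longrightarrow> (k1, k2, k3) \<in> set (slice_choices l) \<Longrightarrow>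
     w (1, col j1, slice k1) + (w (2, col j2, slice k2) + w (3, col j3, slice k3)) = d"
  shows "isobaric w d (cubic_coeff Var l :: (idx, int) polynomial)"
proof -
  have "isobaric w d (of_int s * (Var (1, col j1, slice k1) * (Var (2, col j2, slice k2) * Var (3, col j3, slice k3))) :: (idx, int) polynomial)"
    if "(s, j1, j2, j3) \<in> set perm_signs" "(k1, k2, k3) \<in> set (slice_choices l)" for s j1 j2 j3 k1 k2 k3
  proof -
    have "s = 1 \<or> s = -1" using that by (auto simp: perm_signs_def)
    moreover have "isobaric w d (Var (1, col j1, slice k1) * (Var (2, col j2, slice k2) * Var (3, col j3, slice k3)) :: (idx, int) polynomial)"
      unfolding assms[OF that, symmetric] by (intro isobaric_mult isobaric_Var)
    ultimately show ?thesis by (auto intro: isobaric_uminus)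
  qed
  then show ?thesis
    unfolding cubic_coeff_def by (intro isobaric_sum_list) (auto intro!: isobaric_sum_list)
qed

text \<open>Here \<open>f l\<close> is the weight of the coefficient with index \<open>l\<close>,
  and the five equations say that the five terms of the discriminant have equal weight.\<close>

lemma isobaric_disc_poly:
  assumes c: "\<And>l. l < 4 \<Longrightarrow> isobaric w (f l) (cubic_coeff Var l :: (idx, int) polynomial)"
    and f: "f 0 + 3 * f 2 = d" "f 3 + 3 * f 1 = d" "2 * f 1 + 2 * f 2 = d" "2 * f 0 + 2 * f 3 = d"
      "f 0 + f 3 + f 1 + f 2 = d"
  shows "isobaric w d disc_poly"
proof -
  have e: "isobaric w (n + 0) P = isobaric w n P" "isobaric w (0 + n) P = isobaric w n P"
    for n and P :: "(idx, int) polynomial" by auto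
  have num: "isobaric w d (numeral k * P)" if "isobaric w d P" for k and P :: "(idx, int) polynomial"
    using isobaric_mult[OF isobaric_numeral that] by simp
  have p4: "isobaric w d (cubic_coeff Var l1 * (cubic_coeff Var l2 * (cubic_coeff Var l3 * cubic_coeff Var l4)) :: (idx, int) polynomial)"
    if "f l1 + (f l2 + (f l3 + f l4)) = d" "l1 < 4" "l2 < 4" "l3 < 4" "l4 < 4" for l1 l2 l3 l4
    unfolding that(1)[symmetric] by (intro isobaric_mult c that)
  show ?thesis
    unfolding disc_poly_def pencil_disc_def cubic_disc_def
    by (intro isobaric_add isobaric_diff num p4) (use f in auto)
qed

lemma disc_poly_row: "isobaric (row_weight i) 4 disc_poly"
proof (rule isobaric_disc_poly[where f = "\<lambda>_. 1"])
  show "isobaric (row_weight i) 1 (cubic_coeff Var l :: (idx, int) polynomial)" for l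
    using exhaust_3[of i] by (intro isobaric_cubic_coeff) (auto simp: row_weight_def)
qed auto

lemma disc_poly_col: "isobaric (col_weight j) 4 disc_poly"
proof (rule isobaric_disc_poly[where f = "\<lambda>_. 1"])
  show "isobaric (col_weight j) 1 (cubic_coeff Var l :: (idx, int) polynomial)" for l
    using exhaust_3[of j] by (intro isobaric_cubic_coeff) (auto simp: col_weight_def perm_signs_def col_def)
qed auto

lemma disc_poly_slice: "isobaric (slice_weight k) 6 disc_poly"
\<comment> \<open>The coefficient with index \<open>l\<close> takes \<open>l\<close> entries from
  the second slice and the other \<open>3 - l\<close> from the first.\<close>
proof (rule isobaric_disc_poly[where f = "\<lambda>l. if k = 1 then 3 - l else l"])
  show "isobaric (slice_weight k) (if k = 1 then 3 - l else l) (cubic_coeff Var l :: (idx, int) polynomial)" if "l < 4" for l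
    using exhaust_2[of k] that
    by (intro isobaric_cubic_coeff) (auto simp: slice_weight_def slice_choices_def slice_def split: if_splits)
qed auto

definition margin_arrays :: "exponents set" where
  "margin_arrays = {E. (\<forall>i. weight (row_weight i) E = 4) \<and> (\<forall>j. weight (col_weight j) E = 4) \<and>
     (\<forall>k. weight (slice_weight k) E = 6)}"

lemma keys_disc_poly_subset: "keys disc_poly \<subseteq> margin_arrays"
  using disc_poly_row disc_poly_col disc_poly_slice by (auto simp: margin_arrays_def isobaric_def)

subsection \<open>Invariance of the discriminant\<close>

lemma lookup_map_key: "inj f \<Longrightarrow> lookup (Poly_Mapping.map_key f p) x = lookup p (f x)"
  by (simp add: map_key.rep_eq)

lemma Var_power: "Var p ^ n = single (single p n) (1 :: int)"
  by (induction n) (simp_all add: Var_def mult_single single_add[symmetric])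

lemma prod_single: "(\<Prod>i\<in>A. single (f i) (1 :: int)) = single (\<Sum>i\<in>A. f i) 1"
  by (induction A rule: infinite_finite_induct) (simp_all add: mult_single)

text \<open>The exponent of variable \<open>i\<close> moves to variable \<open>\<pi> i\<close>, so
  the exponent array is composed with the inverse of \<open>\<pi>\<close>.\<close>

lemma monomial_rename:
  fixes m :: "'n::finite \<Rightarrow>\<^sub>0 nat"
  assumes "bij \<pi>"
  shows "(\<Prod>i\<in>UNIV. Var (\<pi> i) ^ lookup m i) = single (Poly_Mapping.map_key (inv \<pi>) m) (1 :: int)"
proof -
  have inj: "inj (inv \<pi>)" using assms by (simp add: bij_imp_bij_inv bij_is_inj)
  have "lookup (\<Sum>i\<in>UNIV. single (\<pi> i) (lookup m i)) q = lookup m (inv \<pi> q)" for q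
  proof -
    have "lookup (\<Sum>i\<in>UNIV. single (\<pi> i) (lookup m i)) q = (\<Sum>i\<in>UNIV. if i = inv \<pi> q then lookup m i else 0)"
      unfolding lookup_sum lookup_single
      by (intro sum.cong) (use assms in \<open>auto simp: when_def bij_inv_eq_iff\<close>)
    then show ?thesis by (simp add: sum.delta)
  qed
  then have "(\<Sum>i\<in>UNIV. single (\<pi> i) (lookup m i)) = Poly_Mapping.map_key (inv \<pi>) m"
    by (intro poly_mapping_eqI) (simp add: lookup_map_key inj)
  then show ?thesis by (simp add: Var_power prod_single)
qed

text \<open>A bijective renaming is injective on monomials, so no two terms are merged.\<close>

lemma lookup_rename:
  fixes P :: "('n::finite, int) polynomial"
  assumes "bij \<pi>"
  shows "lookup (eval_poly of_int (\<lambda>i. Var (\<pi> i)) P) (Poly_Mapping.map_key (inv \<pi>) E) = lookup P E"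
proof -
  have inj: "inj (inv \<pi>)" using assms by (simp add: bij_imp_bij_inv bij_is_inj)
  have eq: "Poly_Mapping.map_key (inv \<pi>) m = Poly_Mapping.map_key (inv \<pi>) n \<longleftrightarrow> m = n" for m n :: "'n \<Rightarrow>\<^sub>0 nat"
  proof
    assume *: "Poly_Mapping.map_key (inv \<pi>) m = Poly_Mapping.map_key (inv \<pi>) n"
    show "m = n"
    proof (rule poly_mapping_eqI)
      fix k
      show "lookup m k = lookup n k"
        using arg_cong[OF *, of "\<lambda>f. lookup f (\<pi> k)"] assms by (simp add: lookup_map_key inj bij_is_inj)
    qed
  qed simp
  have "lookup (eval_poly of_int (\<lambda>i. Var (\<pi> i)) P) (Poly_Mapping.map_key (inv \<pi>) E) =
      (\<Sum>m\<in>keys P. if m = E then lookup P m else 0)"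
    unfolding eval_poly_def monomial_rename[OF assms] lookup_sum lookup_of_int_mult lookup_single when_def eq
    by (intro sum.cong) auto
  also have "\<dots> = lookup P E" by (simp add: sum.delta in_keys_iff)
  finally show ?thesis .
qed

section \<open>The permutations that generate the index symmetries\<close>

definition idx_map :: "(3 \<Rightarrow> 3) \<Rightarrow> (3 \<Rightarrow> 3) \<Rightarrow> (2 \<Rightarrow> 2) \<Rightarrow> idx \<Rightarrow> idx" where
  "idx_map \<alpha> \<beta> \<gamma> = (\<lambda>(i, j, k). (\<alpha> i, \<beta> j, \<gamma> k))"

definition transpose_idx :: "idx \<Rightarrow> idx" where
  "transpose_idx = (\<lambda>(i, j, k). (j, i, k))"

definition perm3 :: "3 \<times> 3 \<times> 3 \<Rightarrow> 3 \<Rightarrow> 3" where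
  "perm3 = (\<lambda>(a, b, c) i. if i = 1 then a else if i = 2 then b else c)"

text \<open>The order agrees with that of \<open>perms3\<close>, which makes
  \<open>perms3_grid\<close> an equality of lists.\<close>

definition perms_of_3 :: "(3 \<Rightarrow> 3) list" where
  "perms_of_3 = map perm3 [(1,2,3), (1,3,2), (2,1,3), (2,3,1), (3,1,2), (3,2,1)]"

definition swap2 :: "2 \<Rightarrow> 2" where
  "swap2 k = (if k = 1 then 2 else 1)"

lemma neq3: "(1::3) \<noteq> 2" "(2::3) \<noteq> 1" "(1::3) \<noteq> 3" "(3::3) \<noteq> 1" "(2::3) \<noteq> 3" "(3::3) \<noteq> 2"
  by auto

lemma fun3_eq_iff: "f = g \<longleftrightarrow> f 1 = g 1 \<and> f 2 = g 2 \<and> f 3 = g 3" for f g :: "3 \<Rightarrow> 'a"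
  by (simp add: fun_eq_iff forall_3)

lemma fun2_eq_iff: "f = g \<longleftrightarrow> f 1 = g 1 \<and> f 2 = g 2" for f g :: "2 \<Rightarrow> 'a"
  by (simp add: fun_eq_iff forall_2)

lemma set_perms_of_3: "set perms_of_3 = {\<alpha>. bij \<alpha>}"
proof -
  have "bij \<alpha> \<longleftrightarrow> \<alpha> \<in> set perms_of_3" for \<alpha> :: "3 \<Rightarrow> 3"
  proof
    assume "bij \<alpha>"
    then have "\<alpha> 1 \<noteq> \<alpha> 2" "\<alpha> 1 \<noteq> \<alpha> 3" "\<alpha> 2 \<noteq> \<alpha> 3"
      by (simp_all only: bij_is_inj inj_eq neq3 not_False_eq_True)
    then have "(\<alpha> 1, \<alpha> 2, \<alpha> 3) \<in> set [(1,2,3), (1,3,2), (2,1,3), (2,3,1), (3,1,2), (3,2,1)]"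
      using exhaust_3[of "\<alpha> 1"] exhaust_3[of "\<alpha> 2"] exhaust_3[of "\<alpha> 3"] by (elim disjE) simp_all
    then have "perm3 (\<alpha> 1, \<alpha> 2, \<alpha> 3) \<in> set perms_of_3"
      unfolding perms_of_3_def set_map by (rule imageI)
    moreover have "perm3 (\<alpha> 1, \<alpha> 2, \<alpha> 3) = \<alpha>" by (simp add: fun3_eq_iff perm3_def)
    ultimately show "\<alpha> \<in> set perms_of_3" by simp
  next
    assume "\<alpha> \<in> set perms_of_3"
    then have "inj \<alpha>"
      unfolding inj_def by (auto simp: perms_of_3_def perm3_def forall_3)
    then show "bij \<alpha>" by (simp add: bij_def finite_UNIV_inj_surj)
  qed
  then show ?thesis by blast
qed

lemma bij_2_iff: "bij \<gamma> \<longleftrightarrow> \<gamma> = id \<or> \<gamma> = swap2" for \<gamma> :: "2 \<Rightarrow> 2"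
proof
  assume "bij \<gamma>"
  then have "\<gamma> 1 \<noteq> \<gamma> 2" by (simp add: bij_is_inj inj_eq)
  then show "\<gamma> = id \<or> \<gamma> = swap2"
    using exhaust_2[of "\<gamma> 1"] exhaust_2[of "\<gamma> 2"] by (auto simp: fun2_eq_iff swap2_def)
next
  assume "\<gamma> = id \<or> \<gamma> = swap2"
  then have "inj \<gamma>" by (auto simp: inj_def forall_2 swap2_def)
  then show "bij \<gamma>" by (simp add: bij_def finite_UNIV_inj_surj)
qed

text \<open>A row permutation multiplies the determinant of every member of the pencil by its sign.
  As \<open>s\<close> is the same for all \<open>l\<close>, it cancels in the discriminant, which
  has even degree 4 in the coefficients.\<close>

lemma cubic_coeff_rows:
  assumes "bij \<alpha>"
  obtains s :: int where "s = 1 \<or> s = - 1"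
    "\<And>l. cubic_coeff (\<lambda>p. X (idx_map \<alpha> id id p)) l = of_int s * cubic_coeff X l"
proof -
  have "\<alpha> \<in> set perms_of_3" using assms by (simp add: set_perms_of_3)
  then have "\<exists>s::int. (s = 1 \<or> s = - 1) \<and> (\<forall>l. cubic_coeff (\<lambda>p. X (idx_map \<alpha> id id p)) l = of_int s * cubic_coeff X l)"
    unfolding perms_of_3_def
    apply (simp add: perm3_def idx_map_def cubic_coeff_def perm_signs_def slice_choices_def col_def slice_def)
    apply (elim disjE; simp)
         apply (rule exI[of _ 1]; simp add: algebra_simps)
        apply (rule exI[of _ "-1"]; simp add: algebra_simps)
       apply (rule exI[of _ "-1"]; simp add: algebra_simps)
      apply (rule exI[of _ 1]; simp add: algebra_simps)
     apply (rule exI[of _ 1]; simp add: algebra_simps)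
    apply (rule exI[of _ "-1"]; simp add: algebra_simps)
    done
  then show thesis using that by blast
qed

lemma cubic_coeff_transpose: "cubic_coeff (\<lambda>p. X (transpose_idx p)) l = cubic_coeff X l"
  by (simp add: transpose_idx_def cubic_coeff_def perm_signs_def slice_choices_def col_def slice_def algebra_simps)

text \<open>Exchanging the slices exchanges s and t and so reverses the cubic; the discriminant is
  symmetric under this reversal.\<close>

lemma cubic_coeff_swap: "l < 4 \<Longrightarrow> cubic_coeff (\<lambda>p. X (idx_map id id swap2 p)) l = cubic_coeff X (3 - l)"
proof -
  assume "l < 4"
  then have "l = 0 \<or> l = 1 \<or> l = 2 \<or> l = 3" by auto
  then show ?thesis
    by (elim disjE) (simp_all add: idx_map_def swap2_def cubic_coeff_def perm_signs_def slice_choices_def col_def slice_def algebra_simps)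
qed

lemma pencil_disc_rows: "bij \<alpha> \<Longrightarrow> pencil_disc (\<lambda>p. X (idx_map \<alpha> id id p)) = pencil_disc X"
proof -
  assume "bij \<alpha>"
  then obtain s :: int where s: "s = 1 \<or> s = - 1"
    "\<And>l. cubic_coeff (\<lambda>p. X (idx_map \<alpha> id id p)) l = of_int s * cubic_coeff X l"
    using cubic_coeff_rows[of \<alpha> X] by blast
  then show ?thesis by (auto simp: pencil_disc_def cubic_disc_def)
qed

lemma pencil_disc_transpose: "pencil_disc (\<lambda>p. X (transpose_idx p)) = pencil_disc X"
  by (simp add: pencil_disc_def cubic_disc_def cubic_coeff_transpose)

lemma pencil_disc_cols: "bij \<beta> \<Longrightarrow> pencil_disc (\<lambda>p. X (idx_map id \<beta> id p)) = pencil_disc X"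
proof -
  assume "bij \<beta>"
  \<comment> \<open>A column permutation is a row permutation conjugated by the
    transposition.\<close>
  have "pencil_disc (\<lambda>p. X (idx_map id \<beta> id p)) =
      pencil_disc (\<lambda>p. (\<lambda>q. X (transpose_idx q)) (idx_map \<beta> id id (transpose_idx p)))"
    by (simp add: idx_map_def transpose_idx_def case_prod_unfold)
  also have "\<dots> = pencil_disc (\<lambda>p. (\<lambda>q. X (transpose_idx q)) (idx_map \<beta> id id p))"
    by (rule pencil_disc_transpose)
  also have "\<dots> = pencil_disc (\<lambda>q. X (transpose_idx q))"
    by (rule pencil_disc_rows[OF \<open>bij \<beta>\<close>])
  finally show ?thesis by (simp add: pencil_disc_transpose)
qed

lemma pencil_disc_swap: "pencil_disc (\<lambda>p. X (idx_map id id swap2 p)) = pencil_disc X"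
  by (simp add: pencil_disc_def cubic_disc_def cubic_coeff_swap algebra_simps)

lemma pencil_disc_slices: "bij \<gamma> \<Longrightarrow> pencil_disc (\<lambda>p. X (idx_map id id \<gamma> p)) = pencil_disc X"
proof -
  have "idx_map id id id = id" by (auto simp: idx_map_def)
  moreover assume "bij \<gamma>"
  ultimately show ?thesis by (auto simp: bij_2_iff pencil_disc_swap)
qed

lemma pencil_disc_idx_map:
  assumes "bij \<alpha>" "bij \<beta>" "bij \<gamma>"
  shows "pencil_disc (\<lambda>p. X (idx_map \<alpha> \<beta> \<gamma> p)) = pencil_disc X"
proof -
  have "pencil_disc (\<lambda>p. X (idx_map \<alpha> \<beta> \<gamma> p)) =
      pencil_disc (\<lambda>p. (\<lambda>q. (\<lambda>r. X (idx_map \<alpha> id id r)) (idx_map id \<beta> id q)) (idx_map id id \<gamma> p))"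
    by (simp add: idx_map_def case_prod_unfold)
  also have "\<dots> = pencil_disc (\<lambda>q. (\<lambda>r. X (idx_map \<alpha> id id r)) (idx_map id \<beta> id q))"
    by (rule pencil_disc_slices[OF assms(3)])
  also have "\<dots> = pencil_disc (\<lambda>r. X (idx_map \<alpha> id id r))"
    by (rule pencil_disc_cols[OF assms(2)])
  also have "\<dots> = pencil_disc X"
    by (rule pencil_disc_rows[OF assms(1)])
  finally show ?thesis .
qed

section \<open>The group laws for the index symmetries\<close>

lemma index_symmetries_eq:
  "index_symmetries = {idx_map \<alpha> \<beta> \<gamma> | \<alpha> \<beta> \<gamma>. bij \<alpha> \<and> bij \<beta> \<and> bij \<gamma>}
     \<union> {transpose_idx \<circ> idx_map \<alpha> \<beta> \<gamma> | \<alpha> \<beta> \<gamma>. bij \<alpha> \<and> bij \<beta> \<and> bij \<gamma>}"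
proof -
  have "transpose_idx \<circ> idx_map \<alpha> \<beta> \<gamma> = (\<lambda>(i, j, k). (\<beta> j, \<alpha> i, \<gamma> k))" for \<alpha> \<beta> \<gamma>
    by (auto simp: transpose_idx_def idx_map_def)
  then show ?thesis by (auto simp: index_symmetries_def idx_map_def)
qed

lemma pencil_disc_symmetric:
  assumes "\<pi> \<in> index_symmetries"
  shows "pencil_disc (\<lambda>p. X (\<pi> p)) = pencil_disc X"
  using assms pencil_disc_idx_map[of _ _ _ X] pencil_disc_idx_map[of _ _ _ "\<lambda>p. X (transpose_idx p)"]
  by (auto simp: index_symmetries_eq pencil_disc_transpose)

lemma idx_map_comp: "idx_map \<alpha> \<beta> \<gamma> \<circ> idx_map \<alpha>' \<beta>' \<gamma>' = idx_map (\<alpha> \<circ> \<alpha>') (\<beta> \<circ> \<beta>') (\<gamma> \<circ> \<gamma>')"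
  by (auto simp: idx_map_def)

lemma transpose_idx_involution: "transpose_idx \<circ> transpose_idx = id"
  by (auto simp: transpose_idx_def)

lemma index_symmetries_comp:
  assumes "\<pi> \<in> index_symmetries" "\<rho> \<in> index_symmetries"
  shows "\<pi> \<circ> \<rho> \<in> index_symmetries"
proof -
  \<comment> \<open>The transposition can be moved to the left at the price of exchanging the row
    and the column permutation.\<close>
  have t: "idx_map \<alpha> \<beta> \<gamma> \<circ> (transpose_idx \<circ> idx_map \<alpha>' \<beta>' \<gamma>') = transpose_idx \<circ> idx_map (\<beta> \<circ> \<alpha>') (\<alpha> \<circ> \<beta>') (\<gamma> \<circ> \<gamma>')"
    "transpose_idx \<circ> (transpose_idx \<circ> f) = f"
    for \<alpha> \<beta> \<gamma> \<alpha>' \<beta>' \<gamma>' and f :: "idx \<Rightarrow> idx"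
    by (auto simp: idx_map_def transpose_idx_def fun_eq_iff split: prod.split)
  have I: "idx_map \<alpha> \<beta> \<gamma> \<in> index_symmetries" "transpose_idx \<circ> idx_map \<alpha> \<beta> \<gamma> \<in> index_symmetries"
    if "bij \<alpha>" "bij \<beta>" "bij \<gamma>" for \<alpha> \<beta> \<gamma>
    using that by (auto simp: index_symmetries_eq)
  obtain \<alpha> \<beta> \<gamma> where 1: "bij \<alpha>" "bij \<beta>" "bij \<gamma>" "\<pi> = idx_map \<alpha> \<beta> \<gamma> \<or> \<pi> = transpose_idx \<circ> idx_map \<alpha> \<beta> \<gamma>"
    using assms(1) unfolding index_symmetries_eq by blast
  obtain \<alpha>' \<beta>' \<gamma>' where 2: "bij \<alpha>'" "bij \<beta>'" "bij \<gamma>'" "\<rho> = idx_map \<alpha>' \<beta>' \<gamma>' \<or> \<rho> = transpose_idx \<circ> idx_map \<alpha>' \<beta>' \<gamma>'"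
    using assms(2) unfolding index_symmetries_eq by blast
  show ?thesis
    using 1(4) 2(4) 1(1-3) 2(1-3)
    by (elim disjE) (simp_all only: comp_assoc t idx_map_comp I bij_comp)
qed

lemma index_symmetries_bij: "\<pi> \<in> index_symmetries \<Longrightarrow> bij \<pi>"
proof -
  have t: "bij transpose_idx"
    using transpose_idx_involution by (rule o_bij) (rule transpose_idx_involution)
  have "bij (idx_map \<alpha> \<beta> \<gamma>)" if "bij \<alpha>" "bij \<beta>" "bij \<gamma>" for \<alpha> \<beta> \<gamma>
  proof (rule o_bij)
    show "idx_map (inv \<alpha>) (inv \<beta>) (inv \<gamma>) \<circ> idx_map \<alpha> \<beta> \<gamma> = id"
      using that by (auto simp: idx_map_def bij_is_inj)
    show "idx_map \<alpha> \<beta> \<gamma> \<circ> idx_map (inv \<alpha>) (inv \<beta>) (inv \<gamma>) = id"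
      using that by (auto simp: idx_map_def bij_is_surj surj_f_inv_f)
  qed
  then show "\<pi> \<in> index_symmetries \<Longrightarrow> bij \<pi>"
    by (auto simp: index_symmetries_eq intro: bij_comp[OF _ t])
qed

lemma index_symmetries_id: "id \<in> index_symmetries"
proof -
  have "id = idx_map id id id" by (auto simp: idx_map_def)
  then show ?thesis by (auto simp: index_symmetries_eq)
qed

lemma finite_index_symmetries: "finite index_symmetries"
  by (rule finite_subset[OF subset_UNIV]) (simp add: finite_class.finite_UNIV)

text \<open>Composition with \<open>\<pi>\<close> is an injective self-map of a finite set, hence
  onto, so some symmetry is sent to the identity.\<close>

lemma index_symmetries_inv:
  assumes "\<pi> \<in> index_symmetries"
  shows "inv \<pi> \<in> index_symmetries"
proof -
  note cancel = inv_o_cancel[OF bij_is_inj[OF index_symmetries_bij[OF assms]]]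
  have "inj_on (\<lambda>\<rho>. \<pi> \<circ> \<rho>) index_symmetries"
  proof (rule inj_onI)
    fix \<rho> \<rho>' assume "\<pi> \<circ> \<rho> = \<pi> \<circ> \<rho>'"
    then have "inv \<pi> \<circ> (\<pi> \<circ> \<rho>) = inv \<pi> \<circ> (\<pi> \<circ> \<rho>')" by simp
    then show "\<rho> = \<rho>'" by (simp only: o_assoc cancel id_o)
  qed
  then have "(\<lambda>\<rho>. \<pi> \<circ> \<rho>) ` index_symmetries = index_symmetries"
    using index_symmetries_comp[OF assms] by (intro endo_inj_surj finite_index_symmetries) auto
  then obtain \<rho> where "\<rho> \<in> index_symmetries" "\<pi> \<circ> \<rho> = id"
    using index_symmetries_id by (metis imageE)
  have "inv \<pi> = inv \<pi> \<circ> (\<pi> \<circ> \<rho>)" by (simp add: \<open>\<pi> \<circ> \<rho> = id\<close>)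
  also have "\<dots> = \<rho>"
    by (simp only: o_assoc cancel id_o)
  finally show ?thesis using \<open>\<rho> \<in> index_symmetries\<close> by simp
qed

lemma lookup_disc_poly_symmetric:
  assumes "\<pi> \<in> index_symmetries"
  shows "lookup disc_poly (Poly_Mapping.map_key \<pi> E) = lookup disc_poly E"
proof -
  have b: "bij \<pi>" using assms by (rule index_symmetries_bij)
  \<comment> \<open>Renaming by a permutation acts on exponents through its inverse, so the renaming
    by \<open>inv \<pi>\<close> yields the action of \<open>\<pi>\<close>.\<close>
  have i: "inv \<pi> \<in> index_symmetries" using assms by (rule index_symmetries_inv)
  have "eval_poly of_int (\<lambda>i. Var (inv \<pi> i)) disc_poly = disc_poly"
    unfolding disc_poly_def hom_of_int.eval_disc_poly by (rule pencil_disc_symmetric[OF i])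
  with lookup_rename[of "inv \<pi>" disc_poly E] b show ?thesis
    by (simp add: bij_imp_bij_inv inv_inv_eq)
qed

subsection \<open>Comparison of grids\<close>

datatype ordering = LT | EQ | GT

fun nat_cmp :: "nat \<Rightarrow> nat \<Rightarrow> ordering" where
  "nat_cmp 0 0 = EQ"
| "nat_cmp 0 (Suc _) = LT"
| "nat_cmp (Suc _) 0 = GT"
| "nat_cmp (Suc a) (Suc b) = nat_cmp a b"

fun pair_cmp :: "nat \<times> nat \<Rightarrow> nat \<times> nat \<Rightarrow> ordering" where
  "pair_cmp (a, b) (c, d) = (case nat_cmp a c of LT \<Rightarrow> LT | EQ \<Rightarrow> nat_cmp b d | GT \<Rightarrow> GT)"

fun list_cmp :: "('a \<Rightarrow> 'a \<Rightarrow> ordering) \<Rightarrow> 'a list \<Rightarrow> 'a list \<Rightarrow> ordering" where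
  "list_cmp f [] [] = EQ"
| "list_cmp f [] (_ # _) = LT"
| "list_cmp f (_ # _) [] = GT"
| "list_cmp f (x # xs) (y # ys) = (case f x y of LT \<Rightarrow> LT | EQ \<Rightarrow> list_cmp f xs ys | GT \<Rightarrow> GT)"

definition grid_cmp :: "grid \<Rightarrow> grid \<Rightarrow> ordering" where
  "grid_cmp = list_cmp (list_cmp pair_cmp)"

text \<open>The link between the executable comparisons and the lexicographic orders on pairs and
  lists.\<close>

definition is_cmp :: "('a::linorder \<Rightarrow> 'a \<Rightarrow> ordering) \<Rightarrow> bool" where
  "is_cmp f \<longleftrightarrow> (\<forall>x y. f x y = (if x < y then LT else if x = y then EQ else GT))"

lemma is_cmp_nat_cmp: "is_cmp nat_cmp"
proof -
  have "nat_cmp x y = (if x < y then LT else if x = y then EQ else GT)" for x y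
    by (induction x y rule: nat_cmp.induct) auto
  then show ?thesis by (simp add: is_cmp_def)
qed

lemma is_cmp_pair_cmp: "is_cmp pair_cmp"
  using is_cmp_nat_cmp by (auto simp: is_cmp_def)

lemma is_cmp_list_cmp:
  assumes "is_cmp f"
  shows "is_cmp (list_cmp f)"
proof -
  have "list_cmp f xs ys = (if xs < ys then LT else if xs = ys then EQ else GT)" for xs ys
    using assms by (induction f xs ys rule: list_cmp.induct) (auto simp: is_cmp_def)
  then show ?thesis by (simp add: is_cmp_def)
qed

lemma grid_cmp_eq: "grid_cmp M N = (if M < N then LT else if M = N then EQ else GT)"
  using is_cmp_list_cmp[OF is_cmp_list_cmp[OF is_cmp_pair_cmp]] by (simp add: grid_cmp_def is_cmp_def)

subsection \<open>Orbits\<close>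

fun perms3 :: "'a list \<Rightarrow> 'a list list" where
  "perms3 [a, b, c] = [[a, b, c], [a, c, b], [b, a, c], [b, c, a], [c, a, b], [c, b, a]]"
| "perms3 _ = []"

fun transp3 :: "'a list list \<Rightarrow> 'a list list" where
  "transp3 [[a, b, c], [d, e, f], [g, h, i]] = [[a, d, g], [b, e, h], [c, f, i]]"
| "transp3 _ = []"

text \<open>
  A grid that is not minimal in its orbit gets a count greater than 144, the order of the
  group, so a count of at most 144 is the order of the stabilizer.
\<close>

fun cmp_count :: "ordering \<Rightarrow> int" where
  "cmp_count LT = 0" | "cmp_count EQ = 1" | "cmp_count GT = 145"

text \<open>Permuting rows, transposing and permuting rows again covers row and column permutations
  alike. The transposition in between only permutes the group elements among the summands.\<close>

definition stabilizer_count :: "grid \<Rightarrow> int" where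
  "stabilizer_count M = (\<Sum>M1\<leftarrow>[M, transp3 M]. \<Sum>M2\<leftarrow>[M1, map (map prod.swap) M1].
     \<Sum>M3\<leftarrow>perms3 M2. \<Sum>N\<leftarrow>perms3 (transp3 M3). cmp_count (grid_cmp M N))"

text \<open>The factors follow the nested sums of \<open>stabilizer_count\<close> from outside to
  inside. As the action reverses composition, the leftmost factor acts first.\<close>

definition idx_sym :: "(idx \<Rightarrow> idx) \<times> (2 \<Rightarrow> 2) \<times> (3 \<Rightarrow> 3) \<times> (3 \<Rightarrow> 3) \<Rightarrow> idx \<Rightarrow> idx" where
  "idx_sym = (\<lambda>(t, \<gamma>, \<alpha>, \<beta>). t \<circ> idx_map id id \<gamma> \<circ> idx_map \<alpha> id id \<circ> transpose_idx \<circ> idx_map \<beta> id id)"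

definition sym_params :: "((idx \<Rightarrow> idx) \<times> (2 \<Rightarrow> 2) \<times> (3 \<Rightarrow> 3) \<times> (3 \<Rightarrow> 3)) list" where
  "sym_params = List.product [id, transpose_idx] (List.product [id, swap2] (List.product perms_of_3 perms_of_3))"

lemma idx_sym_apply: "idx_sym (t, \<gamma>, \<alpha>, \<beta>) (i, j, k) = t (\<alpha> j, \<beta> i, \<gamma> k)"
  by (simp add: idx_sym_def idx_map_def transpose_idx_def)

lemma distinct_perms_of_3: "distinct perms_of_3"
  by (simp add: perms_of_3_def perm3_def fun3_eq_iff)

lemma transpose_idx_neq_id: "transpose_idx \<noteq> id"
proof
  assume "transpose_idx = id"
  then have "transpose_idx (1, 2, 1) = (1, 2, 1)" by simp
  then show False by (simp add: transpose_idx_def)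
qed

lemma swap2_neq_id: "swap2 \<noteq> id"
  by (simp add: fun2_eq_iff swap2_def)

lemma distinct_sym_params: "distinct sym_params"
  unfolding sym_params_def using distinct_perms_of_3 transpose_idx_neq_id swap2_neq_id
  by (intro distinct_product) auto

lemma inj_on_idx_sym: "inj_on idx_sym (set sym_params)"
proof (rule inj_onI)
  fix x y assume x: "x \<in> set sym_params" and y: "y \<in> set sym_params" and eq: "idx_sym x = idx_sym y"
  obtain t \<gamma> \<alpha> \<beta> where x': "x = (t, \<gamma>, \<alpha>, \<beta>)" by (cases x)
  obtain t' \<gamma>' \<alpha>' \<beta>' where y': "y = (t', \<gamma>', \<alpha>', \<beta>')" by (cases y)
  have t: "t = id \<or> t = transpose_idx" "t' = id \<or> t' = transpose_idx"
    and b: "bij \<alpha>" "bij \<beta>" "bij \<alpha>'" "bij \<beta>'"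
    using x y by (auto simp: x' y' sym_params_def set_perms_of_3)
  have E: "t (\<alpha> j, \<beta> i, \<gamma> k) = t' (\<alpha>' j, \<beta>' i, \<gamma>' k)" for i j k
    using fun_cong[OF eq, of "(i, j, k)"] by (simp add: x' y' idx_sym_apply)
  \<comment> \<open>Changing \<open>j\<close> alone changes the first component of the image if
    \<open>t\<close> is the identity and the second if it is the transposition. This recovers
    \<open>t\<close>.\<close>
  have "\<alpha> 1 \<noteq> \<alpha> 2" "\<beta> 1 \<noteq> \<beta> 2" "\<alpha>' 1 \<noteq> \<alpha>' 2" "\<beta>' 1 \<noteq> \<beta>' 2"
    using b by (simp_all add: bij_is_inj inj_eq)
  then have "t = t'"
    using t E[of 1 1 1] E[of 1 2 1] by (auto simp: transpose_idx_def)
  with t E have "\<alpha> j = \<alpha>' j \<and> \<beta> i = \<beta>' i \<and> \<gamma> k = \<gamma>' k" for i j k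
    by (elim disjE) (force simp: transpose_idx_def)+
  with \<open>t = t'\<close> show "x = y" by (auto simp: x' y')
qed

lemma idx_sym_image: "idx_sym ` set sym_params = index_symmetries"
proof -
  \<comment> \<open>Because of the built-in transposition, the parameter
    \<open>transpose_idx\<close> yields the symmetries that do not exchange the first two
    indices.\<close>
  have 1: "idx_sym (transpose_idx, \<gamma>, \<beta>, \<alpha>) = idx_map \<alpha> \<beta> \<gamma>" "idx_sym (id, \<gamma>, \<beta>, \<alpha>) = transpose_idx \<circ> idx_map \<alpha> \<beta> \<gamma>"
    for \<alpha> \<beta> \<gamma>
    by (auto simp: idx_sym_apply idx_map_def transpose_idx_def)
  have 2: "set sym_params = {id, transpose_idx} \<times> {\<gamma>. bij \<gamma>} \<times> {\<alpha>. bij \<alpha>} \<times> {\<beta>. bij \<beta>}"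
    by (auto simp: sym_params_def set_perms_of_3 bij_2_iff)
  show ?thesis
  proof (intro equalityI subsetI)
    fix \<pi> assume "\<pi> \<in> idx_sym ` set sym_params"
    then show "\<pi> \<in> index_symmetries"
      unfolding 2 index_symmetries_eq by (auto simp: 1)
  next
    fix \<pi> assume "\<pi> \<in> index_symmetries"
    then obtain \<alpha> \<beta> \<gamma> where *: "bij \<alpha>" "bij \<beta>" "bij \<gamma>" "\<pi> = idx_map \<alpha> \<beta> \<gamma> \<or> \<pi> = transpose_idx \<circ> idx_map \<alpha> \<beta> \<gamma>"
      unfolding index_symmetries_eq by blast
    then have "\<pi> = idx_sym (transpose_idx, \<gamma>, \<beta>, \<alpha>) \<or> \<pi> = idx_sym (id, \<gamma>, \<beta>, \<alpha>)"
      by (simp only: 1)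
    moreover have "(transpose_idx, \<gamma>, \<beta>, \<alpha>) \<in> set sym_params" "(id, \<gamma>, \<beta>, \<alpha>) \<in> set sym_params"
      using *(1-3) by (simp_all add: 2)
    ultimately show "\<pi> \<in> idx_sym ` set sym_params" by blast
  qed
qed

lemma card_index_symmetries: "card index_symmetries = 144"
proof -
  have "card index_symmetries = length sym_params"
    unfolding idx_sym_image[symmetric] card_image[OF inj_on_idx_sym]
    by (rule distinct_card[OF distinct_sym_params])
  then show ?thesis by (simp add: sym_params_def perms_of_3_def)
qed

lemma sum_list_product: "sum_list (map f (List.product xs ys)) = (\<Sum>x\<leftarrow>xs. \<Sum>y\<leftarrow>ys. f (x, y))"
  for f :: "'a \<times> 'b \<Rightarrow> 'c::comm_monoid_add"
  by (induction xs) (simp_all add: o_def)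

lemma idx_map_symmetry: "bij \<alpha> \<Longrightarrow> bij \<beta> \<Longrightarrow> bij \<gamma> \<Longrightarrow> idx_map \<alpha> \<beta> \<gamma> \<in> index_symmetries"
  by (auto simp: index_symmetries_eq)

lemma transpose_idx_symmetry: "transpose_idx \<in> index_symmetries"
proof -
  have "transpose_idx \<circ> idx_map id id id \<in> index_symmetries"
    unfolding index_symmetries_eq using bij_id by blast
  moreover have "transpose_idx \<circ> idx_map id id id = transpose_idx" by (auto simp: idx_map_def)
  ultimately show ?thesis by simp
qed

section \<open>The action on exponent arrays and on grids\<close>

abbreviation act :: "(idx \<Rightarrow> idx) \<Rightarrow> exponents \<Rightarrow> exponents" where
  "act \<equiv> Poly_Mapping.map_key"

lemma symmetry_inj: "\<pi> \<in> index_symmetries \<Longrightarrow> inj \<pi>"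
  using index_symmetries_bij bij_is_inj by blast

lemma act_comp:
  "\<pi> \<in> index_symmetries \<Longrightarrow> \<rho> \<in> index_symmetries \<Longrightarrow> act (\<pi> \<circ> \<rho>) E = act \<rho> (act \<pi> E)"
  by (simp add: map_key_compose symmetry_inj)

lemma act_id: "act id E = E"
  using map_key_id[of E] by (simp add: id_def)

lemma transp3_grid: "transp3 (grid E) = grid (act transpose_idx E)"
  by (simp add: grid_def grid_row_def lookup_map_key symmetry_inj[OF transpose_idx_symmetry]) (simp add: transpose_idx_def)

lemma swap_grid: "map (map prod.swap) (grid E) = grid (act (idx_map id id swap2) E)"
proof -
  have "idx_map id id swap2 \<in> index_symmetries" by (intro idx_map_symmetry) (auto simp: bij_2_iff)
  then show ?thesis
    by (simp add: grid_def grid_row_def lookup_map_key symmetry_inj) (simp add: idx_map_def swap2_def)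
qed

lemma perms3_grid: "perms3 (grid E) = map (\<lambda>\<alpha>. grid (act (idx_map \<alpha> id id) E)) perms_of_3"
proof -
  have "grid (act (idx_map \<alpha> id id) E) = [grid_row E (\<alpha> 1), grid_row E (\<alpha> 2), grid_row E (\<alpha> 3)]" if "\<alpha> \<in> set perms_of_3" for \<alpha>
  proof -
    have "idx_map \<alpha> id id \<in> index_symmetries" using that by (intro idx_map_symmetry) (auto simp: set_perms_of_3)
    then show ?thesis
      by (simp add: grid_def grid_row_def lookup_map_key symmetry_inj) (simp add: idx_map_def)
  qed
  then have "map (\<lambda>\<alpha>. grid (act (idx_map \<alpha> id id) E)) perms_of_3 = map (\<lambda>\<alpha>. [grid_row E (\<alpha> 1), grid_row E (\<alpha> 2), grid_row E (\<alpha> 3)]) perms_of_3"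
    by simp
  then show ?thesis by (simp add: grid_def perms_of_3_def perm3_def)
qed

text \<open>The parameters of the four nested sums run through every group element exactly
  once.\<close>

lemma stabilizer_count_grid:
  "stabilizer_count (grid E) = (\<Sum>\<pi>\<in>index_symmetries. cmp_count (grid_cmp (grid E) (grid (act \<pi> E))))"
proof -
  let ?c = "\<lambda>E'. cmp_count (grid_cmp (grid E) (grid E'))"
  have S: "idx_map \<alpha> id id \<in> index_symmetries" if "\<alpha> \<in> set perms_of_3" for \<alpha>
    using that by (intro idx_map_symmetry) (auto simp: set_perms_of_3)
  have G: "idx_map id id \<gamma> \<in> index_symmetries" if "\<gamma> = id \<or> \<gamma> = swap2" for \<gamma>
    using that by (intro idx_map_symmetry) (auto simp: bij_2_iff)
  have T: "t \<in> index_symmetries" if "t = id \<or> t = transpose_idx" for t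
    using that index_symmetries_id transpose_idx_symmetry by auto
  have act: "act (idx_sym (t, \<gamma>, \<alpha>, \<beta>)) E =
      act (idx_map \<beta> id id) (act transpose_idx (act (idx_map \<alpha> id id) (act (idx_map id id \<gamma>) (act t E))))"
    if "t = id \<or> t = transpose_idx" "\<gamma> = id \<or> \<gamma> = swap2" "\<alpha> \<in> set perms_of_3" "\<beta> \<in> set perms_of_3" for t \<gamma> \<alpha> \<beta>
    using S[OF that(3)] S[OF that(4)] G[OF that(2)] T[OF that(1)] transpose_idx_symmetry
    unfolding idx_sym_def prod.case by (simp add: act_comp index_symmetries_comp)
  have id_map: "idx_map id id id = id" by (auto simp: idx_map_def)
  have g1: "[grid E, grid (act transpose_idx E)] = map (\<lambda>t. grid (act t E)) [id, transpose_idx]"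
    by (simp add: transp3_grid act_id)
  have g2: "[grid F, map (map prod.swap) (grid F)] = map (\<lambda>\<gamma>. grid (act (idx_map id id \<gamma>) F)) [id, swap2]" for F
    by (simp add: swap_grid act_id id_map)
  have "stabilizer_count (grid E) = (\<Sum>t\<leftarrow>[id, transpose_idx]. \<Sum>\<gamma>\<leftarrow>[id, swap2]. \<Sum>\<alpha>\<leftarrow>perms_of_3. \<Sum>\<beta>\<leftarrow>perms_of_3.
      ?c (act (idx_map \<beta> id id) (act transpose_idx (act (idx_map \<alpha> id id) (act (idx_map id id \<gamma>) (act t E))))))"
    unfolding stabilizer_count_def g1 g2 transp3_grid perms3_grid map_map o_def ..
  also have "\<dots> = (\<Sum>t\<leftarrow>[id, transpose_idx]. \<Sum>\<gamma>\<leftarrow>[id, swap2]. \<Sum>\<alpha>\<leftarrow>perms_of_3. \<Sum>\<beta>\<leftarrow>perms_of_3.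
      ?c (act (idx_sym (t, \<gamma>, \<alpha>, \<beta>)) E))"
    by (intro arg_cong[where f = sum_list] map_cong refl) (simp add: act)
  also have "\<dots> = (\<Sum>x\<leftarrow>sym_params. ?c (act (idx_sym x) E))"
    unfolding sym_params_def sum_list_product ..
  also have "\<dots> = (\<Sum>x\<in>set sym_params. ?c (act (idx_sym x) E))"
    by (rule sum_list_distinct_conv_sum_set[OF distinct_sym_params])
  also have "\<dots> = (\<Sum>\<pi>\<in>index_symmetries. ?c (act \<pi> E))"
    unfolding idx_sym_image[symmetric] by (simp add: sum.reindex[OF inj_on_idx_sym])
  finally show ?thesis .
qed

text \<open>The fibre of \<pi> \<mapsto> \<open>act \<pi> E\<close> over \<open>act \<rho> E\<close>
  is the stabilizer composed with \<rho> on the right, so all fibres have the same size.\<close>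

lemma orbit_stabilizer:
  "card (sym_orbit E) * card {\<pi> \<in> index_symmetries. act \<pi> E = E} = 144"
proof -
  let ?S = "{\<pi> \<in> index_symmetries. act \<pi> E = E}"
  have fibre: "card {\<pi> \<in> index_symmetries. act \<pi> E = F} = card ?S" if F: "F \<in> sym_orbit E" for F
  proof -
    obtain \<rho> where \<rho>: "\<rho> \<in> index_symmetries" "F = act \<rho> E"
      using F by (auto simp: sym_orbit_def)
    note inv = index_symmetries_inv[OF \<rho>(1)] index_symmetries_bij[OF \<rho>(1)]
    have "{\<pi> \<in> index_symmetries. act \<pi> E = F} = (\<lambda>\<sigma>. \<sigma> \<circ> \<rho>) ` ?S"
    proof (intro equalityI subsetI)
      fix \<pi> assume \<pi>: "\<pi> \<in> {\<pi> \<in> index_symmetries. act \<pi> E = F}"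
      have "act (\<pi> \<circ> inv \<rho>) E = act (inv \<rho>) (act \<rho> E)"
        using \<pi> \<rho> inv by (simp add: act_comp)
      also have "\<dots> = act (\<rho> \<circ> inv \<rho>) E" using \<rho> inv by (simp add: act_comp)
      also have "\<dots> = E" using inv by (simp add: bij_is_surj surj_iff[THEN iffD1] act_id)
      finally have "\<pi> \<circ> inv \<rho> \<in> ?S" using \<pi> inv by (simp add: index_symmetries_comp)
      then have "(\<pi> \<circ> inv \<rho>) \<circ> \<rho> \<in> (\<lambda>\<sigma>. \<sigma> \<circ> \<rho>) ` ?S" by (rule imageI)
      moreover have "(\<pi> \<circ> inv \<rho>) \<circ> \<rho> = \<pi>"
        using inv by (simp add: comp_assoc bij_is_inj)
      ultimately show "\<pi> \<in> (\<lambda>\<sigma>. \<sigma> \<circ> \<rho>) ` ?S" by simp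
    next
      fix \<pi> assume "\<pi> \<in> (\<lambda>\<sigma>. \<sigma> \<circ> \<rho>) ` ?S"
      then show "\<pi> \<in> {\<pi> \<in> index_symmetries. act \<pi> E = F}"
        using \<rho> by (auto simp: act_comp index_symmetries_comp)
    qed
    moreover have "inj_on (\<lambda>\<sigma>. \<sigma> \<circ> \<rho>) ?S"
    proof (rule inj_onI)
      fix \<sigma> \<tau> assume "\<sigma> \<circ> \<rho> = \<tau> \<circ> \<rho>"
      then have "\<sigma> \<circ> (\<rho> \<circ> inv \<rho>) = \<tau> \<circ> (\<rho> \<circ> inv \<rho>)" by (simp only: o_assoc)
      then show "\<sigma> = \<tau>" using inv by (simp add: bij_is_surj surj_iff[THEN iffD1])
    qed
    ultimately show ?thesis by (simp add: card_image)
  qed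
  have "144 = (\<Sum>\<pi>\<in>index_symmetries. (1 :: nat))" by (simp add: card_index_symmetries)
  also have "\<dots> = (\<Sum>F\<in>sym_orbit E. \<Sum>\<pi>\<in>{\<pi> \<in> index_symmetries. act \<pi> E = F}. 1)"
    unfolding sym_orbit_def by (rule sum.image_gen[OF finite_index_symmetries])
  also have "\<dots> = card (sym_orbit E) * card ?S" by (simp add: fibre)
  finally show ?thesis by simp
qed

text \<open>A count that divides 144 contains no summand 145. So \<open>E\<close> is minimal in its
  orbit, the count is the order of its stabilizer, and \<open>s\<close> is the index of the
  latter.\<close>

lemma stabilizer_count_properties:
  assumes count: "stabilizer_count (grid E) * int s = 144"
  shows "card (sym_orbit E) = s" "\<pi> \<in> index_symmetries \<Longrightarrow> grid E \<le> grid (act \<pi> E)"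
proof -
  let ?c = "\<lambda>\<pi>. cmp_count (grid_cmp (grid E) (grid (act \<pi> E)))"
  have nonneg: "?c \<pi> \<ge> 0" for \<pi> by (cases "grid_cmp (grid E) (grid (act \<pi> E))") auto
  then have "stabilizer_count (grid E) \<ge> 0" unfolding stabilizer_count_grid by (intro sum_nonneg) auto
  moreover have "int s \<ge> 1" using count by (cases s) auto
  ultimately have le: "stabilizer_count (grid E) \<le> 144"
    using count by (metis mult.right_neutral mult_left_mono)
  have min: "grid E \<le> grid (act \<pi> E)" if "\<pi> \<in> index_symmetries" for \<pi>
  proof (rule ccontr)
    assume "\<not> grid E \<le> grid (act \<pi> E)"
    then have "\<not> grid E < grid (act \<pi> E)" "grid E \<noteq> grid (act \<pi> E)" by auto
    then have "?c \<pi> = 145" by (simp add: grid_cmp_eq)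
    moreover have "?c \<pi> \<le> stabilizer_count (grid E)"
      unfolding stabilizer_count_grid using that nonneg by (intro member_le_sum finite_index_symmetries) auto
    ultimately show False using le by simp
  qed
  then show "\<pi> \<in> index_symmetries \<Longrightarrow> grid E \<le> grid (act \<pi> E)" .
  have "stabilizer_count (grid E) = (\<Sum>\<pi>\<in>index_symmetries. if act \<pi> E = E then 1 else 0)"
    unfolding stabilizer_count_grid
  proof (intro sum.cong refl)
    fix \<pi> assume "\<pi> \<in> index_symmetries"
    from min[OF this] show "?c \<pi> = (if act \<pi> E = E then 1 else 0)"
      by (auto simp: grid_cmp_eq grid_inject)
  qed
  also have "\<dots> = int (card {\<pi> \<in> index_symmetries. act \<pi> E = E})"
    by (simp add: sum.If_cases finite_index_symmetries Collect_conj_eq)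
  finally have "int (card {\<pi> \<in> index_symmetries. act \<pi> E = E} * s) = int 144"
    using count by simp
  then have "s * card {\<pi> \<in> index_symmetries. act \<pi> E = E} = 144"
    by (simp only: of_nat_eq_iff mult.commute)
  moreover have "card {\<pi> \<in> index_symmetries. act \<pi> E = E} \<noteq> 0"
    using orbit_stabilizer[of E] by (metis mult_0_right zero_neq_numeral)
  moreover have "a = b" if "b * k = 144" "k \<noteq> 0" "a * k = 144" for a b k :: nat
    using that by (metis nonzero_mult_div_cancel_right)
  ultimately show "card (sym_orbit E) = s"
    using orbit_stabilizer[of E] by blast
qed

lemma sym_orbit_act:
  assumes "\<pi> \<in> index_symmetries"
  shows "sym_orbit (act \<pi> E) = sym_orbit E"
proof -
  have sub: "sym_orbit (act \<rho> F) \<subseteq> sym_orbit F" if "\<rho> \<in> index_symmetries" for \<rho> F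
  proof -
    have "act \<sigma> (act \<rho> F) = act (\<rho> \<circ> \<sigma>) F" if "\<sigma> \<in> index_symmetries" for \<sigma>
      by (rule act_comp[symmetric, OF \<open>\<rho> \<in> index_symmetries\<close> that])
    then show ?thesis
      using that by (auto simp: sym_orbit_def index_symmetries_comp)
  qed
  have "act (inv \<pi>) (act \<pi> E) = act (\<pi> \<circ> inv \<pi>) E"
    by (rule act_comp[symmetric, OF assms index_symmetries_inv[OF assms]])
  then have "E = act (inv \<pi>) (act \<pi> E)"
    by (simp only: surj_iff[THEN iffD1, OF bij_is_surj[OF index_symmetries_bij[OF assms]]] act_id)
  then show ?thesis using sub[OF assms] sub[OF index_symmetries_inv[OF assms], of "act \<pi> E"] by auto
qed

lemma mem_sym_orbit: "E \<in> sym_orbit E"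
  using index_symmetries_id by (auto simp: sym_orbit_def act_id image_iff intro!: bexI[of _ id])

subsection \<open>Counting the arrays with the margins of the discriminant\<close>

lemma weight_idx: "weight w E = (\<Sum>i\<in>UNIV. \<Sum>j\<in>UNIV. \<Sum>k\<in>UNIV. w (i, j, k) * lookup E (i, j, k))"
  by (simp add: weight_def sum.cartesian_product flip: UNIV_Times_UNIV)

definition margins_ok :: "grid \<Rightarrow> bool" where
  "margins_ok M \<longleftrightarrow> map (\<lambda>r. \<Sum>(x, y)\<leftarrow>r. x + y) M = [4, 4, 4] \<and>
     map (\<lambda>r. \<Sum>(x, y)\<leftarrow>r. x + y) (transp3 M) = [4, 4, 4] \<and>
     sum_list (map fst (concat M)) = 6 \<and> sum_list (map snd (concat M)) = 6"

lemma margin_arrays_iff: "E \<in> margin_arrays \<longleftrightarrow> margins_ok (grid E)"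
  by (simp add: margin_arrays_def weight_idx sum_3 sum_2 row_weight_def col_weight_def slice_weight_def
      forall_3 forall_2 margins_ok_def grid_def grid_row_def add_ac)

text \<open>In the application, \<open>ms\<close> holds the sums of the array over its two slices,
  and the lists are the possible exponents in the first slice.\<close>

fun boxes :: "nat list \<Rightarrow> nat \<Rightarrow> nat list set" where
  "boxes [] t = (if t = 0 then {[]} else {})"
| "boxes (m # ms) t = (\<Union>e\<in>{..min m t}. (#) e ` boxes ms (t - e))"

lemma mem_boxes: "xs \<in> boxes ms t \<longleftrightarrow> list_all2 (\<le>) xs ms \<and> sum_list xs = t"
proof (induction ms arbitrary: xs t)
  case (Cons m ms)
  show ?case
  proof (cases xs)
    case (Cons x xs')
    then have "xs \<in> boxes (m # ms) t \<longleftrightarrow> x \<le> m \<and> x \<le> t \<and> xs' \<in> boxes ms (t - x)"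
      by (auto simp: image_iff)
    then show ?thesis by (auto simp: Cons.IH Cons)
  qed auto
qed auto

lemma finite_boxes: "finite (boxes ms t)"
  by (induction ms t rule: boxes.induct) auto

text \<open>The lists in the following two functions hold the coefficients of truncated power series.\<close>

fun window_sum :: "nat \<Rightarrow> int list \<Rightarrow> int list" where
  "window_sum 0 p = p"
| "window_sum (Suc m) p = map2 (+) p (0 # butlast (window_sum m p))"

fun box_counts :: "nat list \<Rightarrow> int list" where
  "box_counts [] = [1, 0, 0, 0, 0, 0, 0]"
| "box_counts (m # ms) = window_sum m (box_counts ms)"

lemma length_window_sum: "length (window_sum m p) = length p"
  by (induction m) (auto split: nat.split simp: min_def)

lemma length_box_counts: "length (box_counts ms) = 7"
  by (induction ms) (simp_all add: length_window_sum)

text \<open>\<open>window_sum m\<close> multiplies a power series by 1 + x + ... + x^m. The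
  recursion is 1 + x (1 + ... + x^m), where \<open>0 # butlast\<close> is the truncated
  multiplication by x.\<close>

lemma nth_window_sum:
  "t < length p \<Longrightarrow> window_sum m p ! t = (\<Sum>e\<le>min m t. p ! (t - e))"
proof (induction m arbitrary: t)
  case (Suc m)
  show ?case
  proof (cases t)
    case 0
    then show ?thesis using Suc.prems by (simp add: length_window_sum)
  next
    case (Suc t')
    have "window_sum (Suc m) p ! t = p ! t + window_sum m p ! t'"
      using Suc.prems Suc by (simp add: length_window_sum nth_butlast)
    also have "\<dots> = p ! t + (\<Sum>e\<le>min m t'. p ! (t' - e))"
      using Suc.prems Suc by (simp add: Suc.IH)
    also have "\<dots> = (\<Sum>e\<le>Suc (min m t'). p ! (t - e))"
      by (subst sum.atMost_Suc_shift) (simp add: Suc)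
    finally show ?thesis by (simp add: Suc)
  qed
qed simp

text \<open>The generating function of the boxes is the product of the polynomials 1 + x + ... + x^m
  for m in \<open>ms\<close>, kept up to degree 6.\<close>

lemma card_boxes: "t < 7 \<Longrightarrow> int (card (boxes ms t)) = box_counts ms ! t"
proof (induction ms arbitrary: t)
  case Nil
  then show ?case by (auto simp: nth_Cons split: nat.split)
next
  case (Cons m ms)
  have "card (boxes (m # ms) t) = (\<Sum>e\<in>{..min m t}. card ((#) e ` boxes ms (t - e)))"
    unfolding boxes.simps by (rule card_UN_disjoint) (auto simp: finite_boxes)
  also have "int \<dots> = (\<Sum>e\<le>min m t. box_counts ms ! (t - e))"
    using Cons by (simp add: card_image)
  finally show ?case using Cons.prems by (simp add: nth_window_sum length_box_counts)
qed

text \<open>The 3 by 3 squares with row and column sums 4, written row by row. The upper left block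
  determines the rest, and the inequalities keep every completed entry nonnegative.\<close>

definition magic_squares :: "nat list list" where
  "magic_squares = concat (map (\<lambda>a. concat (map (\<lambda>b. concat (map (\<lambda>c. concat (map (\<lambda>d.
     if a + b \<le> 4 \<and> c + d \<le> 4 \<and> a + c \<le> 4 \<and> b + d \<le> 4 \<and> 4 \<le> a + b + c + d
     then [[a, b, 4 - (a + b), c, d, 4 - (c + d), 4 - (a + c), 4 - (b + d), a + b + c + d - 4]]
     else []) [0, 1, 2, 3, 4])) [0, 1, 2, 3, 4])) [0, 1, 2, 3, 4])) [0, 1, 2, 3, 4])"

lemma mem_magic_squares:
  assumes "a + b + c = 4" "d + e + f = 4" "g + h + i = 4" "a + d + g = 4" "b + e + h = 4" "c + f + i = 4"
  shows "[a, b, c, d, e, f, g, h, i] \<in> set magic_squares"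
proof -
  have r: "n \<in> set [0, 1, 2, 3, 4]" if "n \<le> 4" for n :: nat
    using that by (auto simp: le_Suc_eq numeral_eq_Suc)
  have "a \<in> set [0, 1, 2, 3, 4]" "b \<in> set [0, 1, 2, 3, 4]" "d \<in> set [0, 1, 2, 3, 4]" "e \<in> set [0, 1, 2, 3, 4]"
    using assms by - (rule r, linarith)+
  note mem = this
  have "a + b \<le> 4" "d + e \<le> 4" "a + d \<le> 4" "b + e \<le> 4" "4 \<le> a + b + d + e"
    "c = 4 - (a + b)" "f = 4 - (d + e)" "g = 4 - (a + d)" "h = 4 - (b + e)" "i = a + b + d + e - 4"
    using assms by linarith+
  note eqs = this
  have I: "x \<in> set xs \<Longrightarrow> y \<in> set (f x) \<Longrightarrow> y \<in> set (concat (map f xs))" for x xs f and y :: "nat list"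
    by auto
  show ?thesis
    unfolding magic_squares_def
    by (rule I[OF mem(1)], rule I[OF mem(2)], rule I[OF mem(3)], rule I[OF mem(4)]) (simp add: eqs(1-5), simp flip: eqs(6-10))
qed

lemma count_magic: "(\<Sum>ms\<leftarrow>magic_squares. box_counts ms ! 6) = 16749"
  by code_simp

fun totals :: "grid \<Rightarrow> nat list \<times> nat list" where
  "totals M = (map (\<lambda>(x, y). x + y) (concat M), map fst (concat M))"

text \<open>An array is determined by its sums over the two slices, which form one of the squares,
  together with its first slice, which has sum 6. This embeds the arrays into the pairs that
  \<open>count_magic\<close> counts.\<close>

lemma margin_arrays_finite_card: "finite margin_arrays" "card margin_arrays \<le> 16749"
proof -
  let ?T = "\<Union>ms\<in>set magic_squares. Pair ms ` boxes ms 6"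
  have fin: "finite ?T" by (auto simp: finite_boxes)
  have inj: "inj_on (totals \<circ> grid) margin_arrays"
  proof (rule inj_onI)
    fix E F assume "(totals \<circ> grid) E = (totals \<circ> grid) F"
    then have "grid E = grid F" by (simp add: grid_def grid_row_def)
    then show "E = F" by (simp add: grid_inject)
  qed
  have sub: "(totals \<circ> grid) ` margin_arrays \<subseteq> ?T"
  proof (rule image_subsetI)
    fix E assume "E \<in> margin_arrays"
    then have ok: "margins_ok (grid E)" by (simp add: margin_arrays_iff)
    obtain a a' b b' c c' d d' e e' f f' g g' h h' i i' where
      M: "grid E = [[(a, a'), (b, b'), (c, c')], [(d, d'), (e, e'), (f, f')], [(g, g'), (h, h'), (i, i')]]"
      by (simp add: grid_def grid_row_def)
    have eqs: "a + a' + b + b' + c + c' = 4" "d + d' + e + e' + f + f' = 4" "g + g' + h + h' + i + i' = 4"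
     "a + a' + d + d' + g + g' = 4" "b + b' + e + e' + h + h' = 4" "c + c' + f + f' + i + i' = 4"
     "a + b + c + d + e + f + g + h + i = 6"
      using ok by (simp_all add: M margins_ok_def)
    have "[a + a', b + b', c + c', d + d', e + e', f + f', g + g', h + h', i + i'] \<in> set magic_squares"
      by (rule mem_magic_squares) (use eqs in linarith)+
    moreover have "[a, b, c, d, e, f, g, h, i] \<in> boxes [a + a', b + b', c + c', d + d', e + e', f + f', g + g', h + h', i + i'] 6"
      unfolding mem_boxes using eqs(7) by (simp add: add.assoc)
    moreover have "(totals \<circ> grid) E = ([a + a', b + b', c + c', d + d', e + e', f + f', g + g', h + h', i + i'],
        [a, b, c, d, e, f, g, h, i])"
      by (simp add: M)
    moreover have "(ms, xs) \<in> ?T" if "ms \<in> set magic_squares" "xs \<in> boxes ms 6" for ms xs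
      using that by auto
    ultimately show "(totals \<circ> grid) E \<in> ?T" by (simp only:)
  qed
  show "finite margin_arrays"
    using inj finite_subset[OF sub fin] by (rule finite_imageD[rotated])
  have "card margin_arrays \<le> card ?T"
    using card_mono[OF fin sub] by (simp only: card_image[OF inj])
  also have "\<dots> \<le> (\<Sum>ms\<in>set magic_squares. card (Pair ms ` boxes ms 6))"
    by (rule card_UN_le) simp
  also have "\<dots> = (\<Sum>ms\<in>set magic_squares. card (boxes ms 6))"
    by (simp add: card_image inj_on_def)
  also have "\<dots> \<le> (\<Sum>ms\<leftarrow>magic_squares. card (boxes ms 6))"
  proof -
    have "sum f (set xs) \<le> sum_list (map f xs)" for f :: "nat list \<Rightarrow> nat" and xs
      by (induction xs) (auto simp: insert_absorb sum.insert_if)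
    then show ?thesis .
  qed
  finally have "int (card margin_arrays) \<le> int (\<Sum>ms\<leftarrow>magic_squares. card (boxes ms 6))"
    by simp
  also have "int (sum_list (map f xs)) = (\<Sum>x\<leftarrow>xs. int (f x))" for f :: "nat list \<Rightarrow> nat" and xs
    by (induction xs) auto
  also have "(\<Sum>ms\<leftarrow>magic_squares. int (card (boxes ms 6))) = 16749"
    unfolding count_magic[symmetric] by (simp add: card_boxes)
  finally show "card margin_arrays \<le> 16749" by simp
qed

subsection \<open>The table\<close>

definition grid_of :: "nat list list list \<Rightarrow> grid" where
  "grid_of bs = map (\<lambda>b. zip (b ! 0) (b ! 1)) bs"

definition well_formed :: "nat list list list \<Rightarrow> bool" where
  "well_formed bs \<longleftrightarrow> length bs = 3 \<and> list_all (\<lambda>b. length b = 2 \<and> list_all (\<lambda>r. length r = 3) b) bs"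

lemma grid_exponents_of_blocks:
  assumes "well_formed bs"
  shows "grid (exponents_of_blocks bs) = grid_of bs"
proof -
  obtain a b c a' b' c' d e f d' e' f' g h i g' h' i' where
    bs: "bs = [[[a, b, c], [a', b', c']], [[d, e, f], [d', e', f']], [[g, h, i], [g', h', i']]]"
    using assms by (auto simp: well_formed_def numeral_eq_Suc length_Suc_conv)
  have 3: "{..<3} = {0, 1, 2::nat}" and 2: "{..<2} = {0, 1::nat}" by auto
  show ?thesis
    unfolding bs exponents_of_blocks_def 3 2
    by (simp add: grid_of_def grid_def grid_row_def lookup_add lookup_single when_def)
qed

definition row_ok :: "int \<times> nat list list list \<times> nat \<Rightarrow> bool" where
  "row_ok r = (case r of (c, bs, s) \<Rightarrow> well_formed bs \<and> c \<noteq> 0 \<and>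
     stabilizer_count (grid_of bs) * int s = 144 \<and> disc_coeff (grid_of bs) = c)"

text \<open>For a transitive order, comparing neighbours is enough to make all entries
  distinct.\<close>

fun increasing :: "grid list \<Rightarrow> bool" where
  "increasing (M # N # Ms) \<longleftrightarrow> grid_cmp M N = LT \<and> increasing (N # Ms)"
| "increasing _ \<longleftrightarrow> True"

section \<open>Checks of the table by computation\<close>

lemma length_table: "length table = 178"
  by (simp add: table_def)

lemma increasing_table: "increasing (map (\<lambda>r. grid_of (fst (snd r))) table)"
  by code_simp

lemma sum_sizes: "(\<Sum>r\<leftarrow>table. int (snd (snd r))) = 16749"
  by code_simp

lemma card_coeffs: "card (set (map fst table)) = 41"
  by code_simp

text \<open>The central computation: for each row, its representative is minimal in its orbit, the
  orbit size is right, and the coefficient of the discriminant is the listed one.\<close>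

lemma table_ok: "list_all row_ok table"
  by code_simp

context
  fixes n assumes n: "n \<in> {1..178::nat}"
begin

lemma table_row:
  "table ! (n - 1) \<in> set table" "row_ok (table ! (n - 1))"
  "table ! (n - 1) = (coeff_at n, fst (snd (table ! (n - 1))), size_at n)"
proof -
  show "table ! (n - 1) \<in> set table" using n length_table by (intro nth_mem) auto
  with table_ok show "row_ok (table ! (n - 1))" by (auto simp: list_all_iff)
qed (simp add: coeff_at_def size_at_def)

lemma grid_exponents_at: "grid (exponents_at n) = grid_of (fst (snd (table ! (n - 1))))"
  using table_row(2) unfolding exponents_at_def row_ok_def
  by (intro grid_exponents_of_blocks) (simp add: case_prod_unfold)

lemma row_at:
  "coeff_at n \<noteq> 0" "stabilizer_count (grid (exponents_at n)) * int (size_at n) = 144"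
  "lookup disc_poly (exponents_at n) = coeff_at n"
  using table_row(2) unfolding lookup_disc_poly grid_exponents_at row_ok_def
  by (simp_all add: case_prod_unfold coeff_at_def size_at_def)

lemma card_orbit_at: "card (orbit_at n) = size_at n"
  unfolding orbit_at_def by (rule stabilizer_count_properties(1)[OF row_at(2)])

lemma lookup_orbit_at:
  assumes "E \<in> orbit_at n"
  shows "lookup disc_poly E = coeff_at n"
  using assms row_at(3) by (auto simp: orbit_at_def sym_orbit_def lookup_disc_poly_symmetric)

lemma orbit_at_eq: "E \<in> orbit_at n \<Longrightarrow> sym_orbit E = orbit_at n"
  by (auto simp: orbit_at_def sym_orbit_def[of "exponents_at n"] sym_orbit_act)

end

lemma distinct_grids: "distinct (map (\<lambda>r. grid_of (fst (snd r))) table)"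
proof -
  have "sorted_wrt (<) Ms" if "increasing Ms" for Ms
    using that
  proof (induction Ms rule: increasing.induct)
    case (1 M N Ms)
    then show ?case
      by (subst sorted_wrt2) (auto simp: grid_cmp_eq transp_def split: if_splits)
  qed auto
  from this[OF increasing_table] show ?thesis by (simp add: strict_sorted_iff)
qed

text \<open>Two orbits with a common element coincide. Both representatives are then the least
  element of the same orbit, and the grids of the table are distinct.\<close>

lemma orbits_disjoint:
  assumes "n \<in> {1..178}" "m \<in> {1..178}" "E \<in> orbit_at n" "E \<in> orbit_at m"
  shows "n = m"
proof -
  have eq: "orbit_at n = orbit_at m"
    using orbit_at_eq[OF assms(1,3)] orbit_at_eq[OF assms(2,4)] by simp
  have le: "grid (exponents_at n) \<le> grid (exponents_at m)"
    if "n \<in> {1..178}" "orbit_at n = orbit_at m" for n m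
  proof -
    have "exponents_at m \<in> orbit_at n" using mem_sym_orbit that(2) by (simp add: orbit_at_def)
    then obtain \<pi> where "\<pi> \<in> index_symmetries" "exponents_at m = act \<pi> (exponents_at n)"
      by (auto simp: orbit_at_def sym_orbit_def)
    then show ?thesis using stabilizer_count_properties(2)[OF row_at(2)[OF that(1)]] by simp
  qed
  have "grid (exponents_at n) = grid (exponents_at m)"
    using le[OF assms(1) eq] le[OF assms(2) eq[symmetric]] by (rule order.antisym)
  then have "map (\<lambda>r. grid_of (fst (snd r))) table ! (n - 1) = map (\<lambda>r. grid_of (fst (snd r))) table ! (m - 1)"
    using assms(1,2) by (subst (1 2) nth_map) (auto simp: grid_exponents_at length_table)
  then have "n - 1 = m - 1"
    using assms(1,2) distinct_grids by (subst (asm) nth_eq_iff_index_eq) (auto simp: length_table)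
  then show ?thesis using assms(1,2) by auto
qed

lemma finite_sym_orbit: "finite (sym_orbit E)"
  by (simp add: sym_orbit_def finite_index_symmetries)

lemma sum_table: "(\<Sum>n\<in>{1..178}. f (table ! (n - 1))) = (\<Sum>r\<leftarrow>table. f r)"
  for f :: "_ \<Rightarrow> 'a::comm_monoid_add"
proof -
  have "(\<Sum>r\<leftarrow>table. f r) = (\<Sum>n\<in>{0..<178}. f (table ! n))"
    by (subst sum_list_sum_nth) (simp add: length_table)
  also have "\<dots> = (\<Sum>n\<in>{1..178}. f (table ! (n - 1)))"
    by (rule sum.reindex_bij_witness[of _ "\<lambda>n. n - 1" Suc]) auto
  finally show ?thesis by simp
qed

lemma orbit_at_subset_keys: "n \<in> {1..178} \<Longrightarrow> orbit_at n \<subseteq> keys disc_poly"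
  using lookup_orbit_at row_at(1) by (auto simp: in_keys_iff)

text \<open>A sandwich: the orbits lie in the support, the support lies in
  \<open>margin_arrays\<close>, and the orbits together already have as many elements as the bound
  for \<open>margin_arrays\<close> allows.\<close>

lemma keys_disc_poly: "keys disc_poly = (\<Union>n\<in>{1..178}. orbit_at n)"
  and card_keys_disc_poly: "card (keys disc_poly) = 16749"
proof -
  let ?U = "\<Union>n\<in>{1..178}. orbit_at n"
  have "card ?U = (\<Sum>n\<in>{1..178}. card (orbit_at n))"
    using orbits_disjoint by (intro card_UN_disjoint) (auto simp: orbit_at_def finite_sym_orbit)
  also have "\<dots> = (\<Sum>n\<in>{1..178}. size_at n)" by (simp add: card_orbit_at)
  also have "int \<dots> = 16749"
    unfolding size_at_def of_nat_sum sum_table[of "\<lambda>r. int (snd (snd r))"] by (rule sum_sizes)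
  finally have card: "card ?U = 16749" by simp
  have "?U \<subseteq> keys disc_poly" using orbit_at_subset_keys by blast
  moreover have "keys disc_poly \<subseteq> ?U"
  proof -
    have "?U = margin_arrays"
      using calculation keys_disc_poly_subset card margin_arrays_finite_card
      by (intro card_seteq) auto
    then show ?thesis using keys_disc_poly_subset by simp
  qed
  ultimately show "keys disc_poly = ?U" by (rule equalityI[rotated])
  with card show "card (keys disc_poly) = 16749" by simp
qed

lemma F332_eq_disc_poly: "F332 = disc_poly"
proof (rule poly_mapping_eqI)
  fix E
  have 1: "lookup (\<Sum>F\<in>orbit_at n. monomial_of F) E = (if E \<in> orbit_at n then 1 else 0)" for n
    unfolding monomial_of_def lookup_sum lookup_single when_def
    using finite_sym_orbit by (simp add: orbit_at_def sum.delta)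
  have F: "lookup F332 E = (\<Sum>n\<in>{1..178}. if E \<in> orbit_at n then coeff_at n else 0)"
    unfolding F332_def by (subst lookup_sum) (intro sum.cong refl, simp add: lookup_of_int_mult 1)
  show "lookup F332 E = lookup disc_poly E"
  proof (cases "E \<in> keys disc_poly")
    case True
    then obtain n where n: "n \<in> {1..178}" "E \<in> orbit_at n" unfolding keys_disc_poly by blast
    have "lookup F332 E = (\<Sum>m\<in>{1..178}. if m = n then coeff_at n else 0)"
      unfolding F using n orbits_disjoint by (intro sum.cong) auto
    also have "\<dots> = coeff_at n" using n by (simp add: sum.delta)
    finally show ?thesis using lookup_orbit_at[OF n] by simp
  next
    case False
    then have "E \<notin> orbit_at n" if "n \<in> {1..178}" for n using that unfolding keys_disc_poly by blast
    then have "lookup F332 E = 0" unfolding F by (intro sum.neutral) auto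
    then show ?thesis using False by (simp add: in_keys_iff)
  qed
qed

section \<open>Degree, coefficient values and orbits of the discriminant\<close>

lemma disc_poly_homogeneous: "homogeneous_of_degree 12 disc_poly"
proof -
  have "isobaric (\<lambda>_. 1) 12 disc_poly"
    by (rule isobaric_disc_poly[where f = "\<lambda>_. 3"]) (auto intro: isobaric_cubic_coeff)
  then show ?thesis by (simp add: homogeneous_of_degree_def isobaric_def weight_def)
qed

lemma coefficient_values: "lookup disc_poly ` keys disc_poly = set (map fst table)"
proof -
  have "lookup disc_poly ` keys disc_poly = coeff_at ` {1..178}"
  proof (intro equalityI subsetI)
    fix c assume "c \<in> lookup disc_poly ` keys disc_poly"
    then show "c \<in> coeff_at ` {1..178}" unfolding keys_disc_poly by (auto simp: lookup_orbit_at)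
  next
    fix c assume "c \<in> coeff_at ` {1..178}"
    then obtain n where n: "n \<in> {1..178}" "c = coeff_at n" by blast
    have "exponents_at n \<in> orbit_at n" by (simp add: orbit_at_def mem_sym_orbit)
    then show "c \<in> lookup disc_poly ` keys disc_poly"
      using n row_at(3)[OF n(1)] orbit_at_subset_keys[OF n(1)] by (metis imageI subsetD)
  qed
  also have "\<dots> = fst ` (\<lambda>n. table ! (n - 1)) ` {1..178}"
    by (simp add: coeff_at_def image_image)
  also have "(\<lambda>n. table ! (n - 1)) ` {1..178} = set table"
  proof -
    have "(\<lambda>n. table ! (n - 1)) ` {1..178} = (!) table ` (\<lambda>n. n - 1) ` {1..178}"
      by (simp add: image_image)
    also have "(\<lambda>n. n - 1) ` {1..178} = {0..<178::nat}"
      by (auto simp: image_iff intro!: bexI[of _ "Suc _"])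
    finally show ?thesis using nth_image[of 178 table] length_table by (simp add: lessThan_atLeast0)
  qed
  finally show ?thesis by simp
qed

lemma orbits_of_keys: "sym_orbit ` keys disc_poly = orbit_at ` {1..178}"
proof -
  have "orbit_at n \<noteq> {}" for n using mem_sym_orbit by (auto simp: orbit_at_def)
  then show ?thesis unfolding keys_disc_poly by (force simp: orbit_at_eq)
qed

lemma inj_on_orbit_at: "inj_on orbit_at {1..178}"
  using orbits_disjoint mem_sym_orbit by (intro inj_onI) (metis orbit_at_def)

subsection \<open>Irreducibility\<close>

text \<open>Each of the values 1 and -1 is attained at most as often as the degree says.\<close>

lemma degree_0_of_prime_values:
  fixes f g h :: "int poly"
  assumes "f = g * h" and "finite A" and "2 * degree f < card A"
    and prime: "\<And>n. n \<in> A \<Longrightarrow> prime \<bar>poly f n\<bar>"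
  shows "degree g = 0 \<or> degree h = 0"
proof (rule ccontr)
  assume "\<not> ?thesis"
  then have deg: "degree g > 0" "degree h > 0" by auto
  then have nz: "g \<noteq> 0" "h \<noteq> 0" by auto
  let ?S = "\<lambda>p c. {n :: int. poly p n = c}"
  have card: "card (?S p c) \<le> degree p" "finite (?S p c)" if "degree p > 0" for p :: "int poly" and c
  proof -
    have eq: "?S p c = {n. poly (p - [:c:]) n = 0}" by simp
    have nz: "p - [:c:] \<noteq> 0" using that by auto
    have "degree (p - [:c:]) \<le> degree p" using degree_diff_le_max[of p "[:c:]"] by simp
    then show "card (?S p c) \<le> degree p"
      unfolding eq using card_poly_roots_bound[OF nz] by simp
    show "finite (?S p c)" unfolding eq by (rule poly_roots_finite[OF nz])
  qed
  \<comment> \<open>A product of two integers that is prime up to sign has a factor 1 or -1.\<close>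
  have "A \<subseteq> (?S g 1 \<union> ?S g (-1)) \<union> (?S h 1 \<union> ?S h (-1))"
  proof
    fix n assume "n \<in> A"
    then have "prime \<bar>poly g n * poly h n\<bar>" using prime assms(1) by auto
    then have "prime_elem (poly g n * poly h n)" by simp
    then have "irreducible (poly g n * poly h n)" by (rule prime_elem_imp_irreducible)
    then have "is_unit (poly g n) \<or> is_unit (poly h n)" by (rule irreducibleD) simp
    then have "\<bar>poly g n\<bar> = 1 \<or> \<bar>poly h n\<bar> = 1" by simp
    then show "n \<in> (?S g 1 \<union> ?S g (-1)) \<union> (?S h 1 \<union> ?S h (-1))" by (auto simp: abs_if split: if_splits)
  qed
  then have "card A \<le> card ((?S g 1 \<union> ?S g (-1)) \<union> (?S h 1 \<union> ?S h (-1)))"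
    by (rule card_mono[rotated]) (use card(2) deg in blast)
  also have "\<dots> \<le> (card (?S g 1) + card (?S g (-1))) + (card (?S h 1) + card (?S h (-1)))"
    by (meson add_mono card_Un_le order_trans)
  also have "\<dots> \<le> (degree g + degree g) + (degree h + degree h)"
    by (intro add_mono card(1) deg)
  also have "\<dots> = 2 * degree f" using nz assms(1) by (simp add: degree_mult_eq)
  finally show False using assms(3) by simp
qed

text \<open>The order of vanishing at 0 is at most the degree, with equality for monomials. Both are
  additive on products, so equality passes to the factors.\<close>

lemma monom_factor:
  fixes p q :: "'a::idom poly"
  assumes "p * q = monom c n" "c \<noteq> 0"
  obtains k a where "p = monom a k"
proof -
  have nz: "p * q \<noteq> 0" using assms by auto
  then have "p \<noteq> 0" "q \<noteq> 0" by auto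
  have "order 0 (p * q) = degree (p * q)"
    using assms by (simp add: degree_monom_eq)
  then have "order 0 p + order 0 q = degree p + degree q"
    using nz by (simp add: order_mult degree_mult_eq)
  moreover have "order 0 p \<le> degree p" "order 0 q \<le> degree q"
    using \<open>p \<noteq> 0\<close> \<open>q \<noteq> 0\<close> by (simp_all add: order_degree)
  ultimately have "order 0 p = degree p" by simp
  then have "monom 1 (degree p) dvd p"
    using order_1[of 0 p] by (simp add: monom_altdef)
  then obtain r where r: "p = monom 1 (degree p) * r" by (elim dvdE)
  then have "r \<noteq> 0" using \<open>p \<noteq> 0\<close> by auto
  then have "degree r = 0" using r by (metis add_cancel_right_right degree_mult_eq degree_monom_eq monom_eq_0_iff one_neq_zero)
  then obtain a where "r = [:a:]" by (rule degree_eq_zeroE)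
  with r have "p = monom a (degree p)" by (metis monom_0 mult_monom add.right_neutral mult_1)
  then show thesis by (rule that)
qed

text \<open>Multiplying each variable \<open>p\<close> by T^(w p), for a new variable T, turns an
  isobaric polynomial into a monomial in T, and factors of a monomial are monomials.\<close>

lemma isobaric_factor:
  fixes G H :: "(idx, int) polynomial"
  assumes "isobaric w d (G * H)" "G * H \<noteq> 0"
  obtains a where "isobaric w a G"
proof -
  define \<Psi> where "\<Psi> = eval_poly (of_int :: int \<Rightarrow> (idx, int) polynomial poly) (\<lambda>p. monom (Var p) (w p))"
  have mono: "(\<Prod>p\<in>UNIV. monom (Var p :: (idx, int) polynomial) (w p) ^ lookup m p) = monom (single m 1) (weight w m)"
    for m :: exponents
  proof -
    have "(\<Prod>p\<in>A. monom (Var p :: (idx, int) polynomial) (w p) ^ lookup m p) =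
        monom (\<Prod>p\<in>A. Var p ^ lookup m p) (\<Sum>p\<in>A. w p * lookup m p :: nat)" for A :: "idx set"
      by (induction A rule: infinite_finite_induct) (simp_all add: monom_power mult_monom)
    moreover have "(\<Prod>p\<in>UNIV. Var p ^ lookup m p) = single m (1 :: int)"
      using monomial_rename[OF bij_id, of m] by (simp only: id_apply inv_id act_id)
    ultimately show ?thesis by (simp add: weight_def)
  qed
  have \<Psi>: "\<Psi> P = (\<Sum>m\<in>keys P. monom (single m (lookup P m)) (weight w m))" for P
  proof -
    have "of_int c * monom (single m 1) k = monom (single m c) k" for c :: int and m :: exponents and k
    proof -
      have "of_int c * single m 1 = single m c"
        by (rule poly_mapping_eqI) (simp add: lookup_of_int_mult lookup_single when_def)
      then show ?thesis by (simp add: of_int_monom mult_monom)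
    qed
    then show ?thesis by (simp add: \<Psi>_def eval_poly_def mono)
  qed
  have "\<Psi> (G * H) = (\<Sum>m\<in>keys (G * H). monom (single m (lookup (G * H) m)) d)"
    unfolding \<Psi> using assms(1) by (intro sum.cong) (auto simp: isobaric_def)
  also have "\<dots> = monom (G * H) d"
    by (simp add: monom_sum[symmetric] sum_singles)
  finally have "\<Psi> G * \<Psi> H = monom (G * H) d"
    by (simp add: \<Psi>_def hom_of_int.eval_mult)
  then obtain k a where "\<Psi> G = monom a k" using assms(2) by (rule monom_factor)
  have "weight w m = k" if m: "m \<in> keys G" for m
  proof (rule ccontr)
    assume "weight w m \<noteq> k"
    then have "0 = lookup (coeff (\<Psi> G) (weight w m)) m" using \<open>\<Psi> G = monom a k\<close> by simp
    also have "\<dots> = (\<Sum>m'\<in>keys G. if m' = m then lookup G m else 0)"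
      unfolding \<Psi> coeff_sum lookup_sum by (intro sum.cong) (auto simp: lookup_single when_def)
    also have "\<dots> = lookup G m" using m by (simp add: sum.delta)
    finally show False using m by (simp add: in_keys_iff)
  qed
  then show thesis by (intro that[of k]) (simp add: isobaric_def)
qed

lemma degree_eval_isobaric:
  fixes X :: "idx \<Rightarrow> int poly"
  assumes "isobaric w a P" "\<And>p. degree (X p) \<le> w p"
  shows "degree (eval_poly of_int X P) \<le> a"
  unfolding eval_poly_def
proof (rule degree_sum_le)
  fix m assume m: "m \<in> keys P"
  have "degree (\<Prod>p\<in>UNIV. X p ^ lookup m p) \<le> (\<Sum>p\<in>UNIV. degree (X p ^ lookup m p))"
    using degree_prod_sum_le[of UNIV "\<lambda>p. X p ^ lookup m p"] by (simp add: o_def)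
  also have "\<dots> \<le> weight w m"
    unfolding weight_def
    by (intro sum_mono order_trans[OF degree_power_le]) (simp add: assms(2) mult.commute)
  also have "\<dots> = a" using assms(1) m by (simp add: isobaric_def)
  finally have "degree (\<Prod>p\<in>UNIV. X p ^ lookup m p) \<le> a" .
  then show "degree (of_int (lookup P m) * (\<Prod>p\<in>UNIV. X p ^ lookup m p)) \<le> a"
    by (intro order_trans[OF degree_mult_le]) simp
qed simp

text \<open>Chosen to be prime up to sign at nine integers, one more than the eight that two factors
  of positive degree would allow.\<close>

definition quartic :: "int poly" where
  "quartic = [:-307, -230, 19, 22, -3:]"

lemma quartic_values: "\<forall>n\<in>{-3, -2, -1, 0, 1, 2, 4, 5, 6}. prime \<bar>poly quartic n\<bar>"
proof -
  have primes: "list_all prime [5, 83, 107, 139, 283, 307, 499, 563 :: int]" by code_simp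
  have "\<bar>poly quartic n\<bar> \<in> set [5, 83, 107, 139, 283, 307, 499, 563]"
    if "n \<in> {-3, -2, -1, 0, 1, 2, 4, 5, 6}" for n
    using that by (auto simp: quartic_def)
  with primes show ?thesis by (simp only: list_all_iff) blast
qed

text \<open>
  If a factor had positive degree in the given line, it would specialise to a factor of positive degree
  of the quartic.
\<close>

lemma line_factor:
  fixes G H :: "(idx, int) polynomial" and X :: "idx \<Rightarrow> int poly"
  assumes GH: "G * H = disc_poly" and w: "isobaric w 4 disc_poly" "\<And>p. degree (X p) \<le> w p"
    and X: "pencil_disc X = quartic"
  shows "isobaric w 0 G \<or> isobaric w 0 H"
proof -
  let ?e = "eval_poly of_int X :: (idx, int) polynomial \<Rightarrow> int poly"
  have "?e disc_poly = quartic"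
    unfolding disc_poly_def hom_of_int.eval_disc_poly by (rule X)
  then have f: "quartic = ?e G * ?e H" by (simp add: GH[symmetric] hom_of_int.eval_mult)
  have "quartic \<noteq> 0" by (simp add: quartic_def)
  then have nz: "disc_poly \<noteq> 0" using \<open>?e disc_poly = quartic\<close> by (auto simp: hom_of_int.eval_zero)
  obtain a where a: "isobaric w a G" using isobaric_factor[of w 4 G H] w(1) nz GH by auto
  obtain b where b: "isobaric w b H" using isobaric_factor[of w 4 H G] w(1) nz GH by (auto simp: mult.commute)
  have "isobaric w (a + b) disc_poly" using isobaric_mult[OF a b] by (simp add: GH)
  then have "a + b = 4"
  proof -
    have "keys disc_poly \<noteq> {}" using nz by simp
    then obtain m where "m \<in> keys disc_poly" by blast
    then have "weight w m = 4" "weight w m = a + b"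
      using w(1) \<open>isobaric w (a + b) disc_poly\<close> unfolding isobaric_def by blast+
    then show ?thesis by simp
  qed
  have "degree (?e G) + degree (?e H) = 4"
  proof -
    have "?e G \<noteq> 0" "?e H \<noteq> 0" using f \<open>quartic \<noteq> 0\<close> by auto
    then have "degree (?e G) + degree (?e H) = degree quartic"
      by (simp add: f degree_mult_eq)
    then show ?thesis by (simp add: quartic_def)
  qed
  moreover have "degree (?e G) \<le> a" "degree (?e H) \<le> b"
    using a b w(2) by (auto intro: degree_eval_isobaric)
  \<comment> \<open>The degrees are bounded by \<open>a\<close> and \<open>b\<close>, and both pairs
    add up to 4, so the specialisation loses no degree.\<close>
  ultimately have "degree (?e G) = a" "degree (?e H) = b" using \<open>a + b = 4\<close> by auto
  moreover have "degree (?e G) = 0 \<or> degree (?e H) = 0"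
  proof (rule degree_0_of_prime_values[OF f])
    let ?A = "{-3, -2, -1, 0, 1, 2, 4, 5, 6 :: int}"
    show "2 * degree quartic < card ?A" by (simp add: quartic_def)
    show "prime \<bar>poly quartic n\<bar>" if "n \<in> ?A" for n
      using bspec[OF quartic_values that] .
  qed simp
  ultimately show ?thesis using a b by auto
qed

text \<open>
  The minors of the last two rows are \<open>s\<^sup>2\<close>, \<open>s t\<close> and \<open>t\<^sup>2\<close> up to sign, so the first row yields the
  coefficients \<open>-2 - y\<close>, \<open>3 + y\<close>, \<open>1 - y\<close> and \<open>1\<close> of the cubic.
\<close>

definition line_spec :: "idx \<Rightarrow> int poly" where
  "line_spec = (\<lambda>(i, j, k).
     if i = 1 then (if j = 1 then (if k = 1 then [:1, -1:] else 1)
                    else if j = 2 then 0 else (if k = 1 then [:-2, -1:] else [:3, 1:]))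
     else if i = 2 then (if j = 1 \<and> k = 1 \<or> j = 2 \<and> k = 2 then 1 else 0)
     else (if j = 2 \<and> k = 1 \<or> j = 3 \<and> k = 2 then 1 else 0))"

lemma pencil_disc_line_spec: "pencil_disc line_spec = quartic"
  by (simp add: pencil_disc_def cubic_disc_def cubic_coeff_def perm_signs_def slice_choices_def
      line_spec_def col_def slice_def quartic_def algebra_simps one_pCons numeral_poly)

lemma degree_line_spec: "degree (line_spec (i, j, k)) \<le> of_bool (i = 1)"
  by (simp add: line_spec_def)

text \<open>Exchanging row \<open>i\<close> with row 1 carries the specialisation of row 1 over to
  row \<open>i\<close> and leaves the discriminant unchanged.\<close>

lemma row_factor:
  assumes "G * H = disc_poly"
  shows "isobaric (row_weight i) 0 G \<or> isobaric (row_weight i) 0 H"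
proof -
  define \<alpha> :: "3 \<Rightarrow> 3" where "\<alpha> = Transposition.transpose 1 i"
  have \<alpha>: "bij \<alpha>" by (simp add: \<alpha>_def)
  show ?thesis
  proof (rule line_factor[OF assms disc_poly_row])
    show "degree (line_spec (idx_map \<alpha> id id p)) \<le> row_weight i p" for p
    proof (cases p)
      case (fields i' j k)
      have "\<alpha> i' = 1 \<longleftrightarrow> i' = i"
        by (auto simp: \<alpha>_def Transposition.transpose_def split: if_splits)
      then show ?thesis
        using degree_line_spec[of "\<alpha> i'" j k] by (simp add: fields idx_map_def row_weight_def)
    qed
    show "pencil_disc (\<lambda>p. line_spec (idx_map \<alpha> id id p)) = quartic"
      by (simp add: pencil_disc_rows \<alpha> pencil_disc_line_spec)
  qed
qed

text \<open>One column meets every row, so the first column can link all rows to the same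
  factor.\<close>

lemma col_factor:
  assumes "G * H = disc_poly"
  shows "isobaric (col_weight 1) 0 G \<or> isobaric (col_weight 1) 0 H"
proof (rule line_factor[OF assms disc_poly_col])
  show "degree (line_spec (transpose_idx p)) \<le> col_weight 1 p" for p
    using degree_line_spec by (cases p) (simp add: transpose_idx_def col_weight_def)
  show "pencil_disc (\<lambda>p. line_spec (transpose_idx p)) = quartic"
    by (simp add: pencil_disc_transpose pencil_disc_line_spec)
qed

section \<open>Factors of weight zero and irreducibility\<close>

lemma isobaric_0_lookup:
  assumes "isobaric w 0 P" "m \<in> keys P" "w p > 0"
  shows "lookup m p = 0"
proof -
  have "(\<Sum>i\<in>UNIV. w i * lookup m i) = 0"
    using assms(1,2) unfolding isobaric_def weight_def by blast
  then have "w p * lookup m p = 0" by (simp add: sum_eq_0_iff)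
  then show ?thesis using assms(3) by simp
qed

lemma all_rows_constant:
  assumes "\<And>i. isobaric (row_weight i) 0 P"
  shows "P = single 0 (lookup P 0)"
proof -
  have "m = 0" if "m \<in> keys P" for m
  proof (rule poly_mapping_eqI)
    fix p :: idx
    obtain i j k where p: "p = (i, j, k)" by (cases p)
    show "lookup m p = lookup 0 p"
      using isobaric_0_lookup[OF assms[of i] that, of p] by (simp add: p row_weight_def)
  qed
  then have "keys P \<subseteq> {0}" by auto
  then show ?thesis
    by (intro poly_mapping_eqI) (auto simp: lookup_single when_def in_keys_iff)
qed

text \<open>A constant factor divides every coefficient, in particular the coefficient 1.\<close>

lemma constant_factor_unit:
  fixes P Q :: "(idx, int) polynomial"
  assumes "single 0 c * Q = P" "lookup P m = 1"
  shows "(single 0 c :: (idx, int) polynomial) dvd 1"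
proof -
  have "lookup P m = c * lookup Q m"
    using assms(1) lookup_of_int_mult[of c Q m] by (simp flip: single_of_int)
  then have "c dvd 1" using assms(2) by (metis dvd_triv_left)
  then obtain d where "1 = c * d" by (elim dvdE)
  then have "(1 :: (idx, int) polynomial) = single 0 c * single 0 d"
    by (simp add: mult_single flip: single_one)
  then show ?thesis by (rule dvdI)
qed

lemma irreducible_disc_poly:
  assumes one: "lookup disc_poly m = 1" and every: "\<And>p. \<exists>n\<in>keys disc_poly. lookup n p \<noteq> 0"
  shows "irreducible disc_poly"
proof (rule irreducibleI)
  have nz: "m \<in> keys disc_poly" using one by (simp add: in_keys_iff)
  then show "disc_poly \<noteq> 0" by auto
  show "\<not> disc_poly dvd 1"
  proof
    assume "disc_poly dvd 1"
    then obtain Q where Q: "1 = disc_poly * Q" by (elim dvdE)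
    have "Q * disc_poly = 1" using Q by (simp add: mult.commute)
    then obtain b where "isobaric (row_weight 1) b Q"
      using isobaric_factor[of "row_weight 1" 0 Q disc_poly] isobaric_one by (metis one_neq_zero)
    from isobaric_mult[OF disc_poly_row this] have "isobaric (row_weight 1) (4 + b) (1 :: (idx, int) polynomial)"
      by (simp add: Q)
    then show False by (simp add: isobaric_def weight_def)
  qed
  fix G H assume GH: "disc_poly = G * H"
  \<comment> \<open>A variable that occurs in the product must occur in one of the factors.\<close>
  have var: "\<not> (isobaric w 0 G \<and> isobaric w' 0 H)" if "w p > 0" "w' p > 0" for w w' p
  proof
    assume free: "isobaric w 0 G \<and> isobaric w' 0 H"
    obtain n where n: "n \<in> keys disc_poly" "lookup n p \<noteq> 0" using every by blast
    then obtain g h where "g \<in> keys G" "h \<in> keys H" "n = g + h"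
      using keys_mult[of G H] GH by auto
    then show False using free n(2) that by (auto simp: lookup_add dest: isobaric_0_lookup)
  qed
  have "(\<forall>i. isobaric (row_weight i) 0 G) \<or> (\<forall>i. isobaric (row_weight i) 0 H)"
  proof (rule ccontr)
    assume "\<not> ?thesis"
    then obtain i i' where i: "isobaric (row_weight i) 0 H" "isobaric (row_weight i') 0 G"
      using row_factor[OF GH[symmetric]] by blast
    \<comment> \<open>The factor free of column 1 is paired with the row that the other factor
      lacks. The variable where that row meets column 1 would then occur in neither factor.\<close>
    from col_factor[OF GH[symmetric]] show False
    proof
      assume "isobaric (col_weight 1) 0 G"
      with i var[of "col_weight 1" "(i, 1, 1)" "row_weight i"] show False
        by (simp add: col_weight_def row_weight_def)
    next
      assume "isobaric (col_weight 1) 0 H"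
      with i var[of "row_weight i'" "(i', 1, 1)" "col_weight 1"] show False
        by (simp add: col_weight_def row_weight_def)
    qed
  qed
  then show "G dvd 1 \<or> H dvd 1"
  proof
    assume "\<forall>i. isobaric (row_weight i) 0 G"
    then have "G = single 0 (lookup G 0)" by (intro all_rows_constant) auto
    then have "G dvd 1" using constant_factor_unit[of "lookup G 0" H disc_poly m] one GH by simp
    then show ?thesis ..
  next
    assume "\<forall>i. isobaric (row_weight i) 0 H"
    then have "H = single 0 (lookup H 0)" by (intro all_rows_constant) auto
    then have "H dvd 1" using constant_factor_unit[of "lookup H 0" G disc_poly m] one GH by (simp add: mult.commute)
    then show ?thesis ..
  qed
qed

subsection \<open>Binary cubics with a double root\<close>

text \<open>This and \<open>cubic_partial2\<close> are the partial derivatives, with respect to s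
  and t, of the binary cubic with coefficients \<open>c\<close>. Their common zeros are its multiple
  roots.\<close>

definition cubic_partial1 :: "(nat \<Rightarrow> 'a::comm_ring_1) \<Rightarrow> 'a \<Rightarrow> 'a \<Rightarrow> 'a" where
  "cubic_partial1 c s t = 3 * c 0 * s^2 + 2 * c 1 * s * t + c 2 * t^2"

definition cubic_partial2 :: "(nat \<Rightarrow> 'a::comm_ring_1) \<Rightarrow> 'a \<Rightarrow> 'a \<Rightarrow> 'a" where
  "cubic_partial2 c s t = c 1 * s^2 + 2 * c 2 * s * t + 3 * c 3 * t^2"

text \<open>With \<open>r = t / s\<close> the two equations express \<open>c 1\<close> and then
  \<open>c 0\<close> through \<open>r\<close>, \<open>c 2\<close> and \<open>c 3\<close>; after
  substitution the discriminant vanishes identically.\<close>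

lemma cubic_disc_double_root_aux:
  fixes c :: "nat \<Rightarrow> complex"
  assumes "cubic_partial1 c s t = 0" "cubic_partial2 c s t = 0" "s \<noteq> 0"
  shows "cubic_disc c = 0"
proof -
  define r where "r = t / s"
  have t: "t = r * s" using assms(3) by (simp add: r_def)
  have "s^2 * (3 * c 0 + 2 * c 1 * r + c 2 * r^2) = 0" "s^2 * (c 1 + 2 * c 2 * r + 3 * c 3 * r^2) = 0"
    using assms(1,2) by (simp_all add: cubic_partial1_def cubic_partial2_def t power2_eq_square algebra_simps)
  then have e: "3 * c 0 + 2 * c 1 * r + c 2 * r^2 = 0" "c 1 + 2 * c 2 * r + 3 * c 3 * r^2 = 0"
    using assms(3) by simp_all
  have c1: "c 1 = - 2 * c 2 * r - 3 * c 3 * r^2" using e(2) by algebra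
  have "3 * c 0 = 3 * (c 2 * r^2 + 2 * c 3 * r^3)" using e(1) unfolding c1 by algebra
  then have c0: "c 0 = c 2 * r^2 + 2 * c 3 * r^3"
    by (rule mult_left_cancel[of 3, THEN iffD1, rotated]) simp
  show ?thesis unfolding cubic_disc_def c0 c1 by algebra
qed

lemma cubic_disc_double_root:
  fixes c :: "nat \<Rightarrow> complex"
  assumes "cubic_partial1 c s t = 0" "cubic_partial2 c s t = 0" "s \<noteq> 0 \<or> t \<noteq> 0"
  shows "cubic_disc c = 0"
  using assms(3)
proof
  assume "s \<noteq> 0"
  with assms show ?thesis by (intro cubic_disc_double_root_aux)
next
  assume "t \<noteq> 0"
  \<comment> \<open>Reversing the coefficients exchanges the roles of \<open>s\<close> and
    \<open>t\<close>.\<close>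
  have "cubic_disc (\<lambda>l. c (3 - l)) = 0"
    by (rule cubic_disc_double_root_aux[OF _ _ \<open>t \<noteq> 0\<close>, of _ s])
      (use assms(1,2) in \<open>simp_all add: cubic_partial1_def cubic_partial2_def algebra_simps\<close>)
  then show ?thesis by (simp add: cubic_disc_def algebra_simps)
qed

lemma cubic_root:
  fixes c :: "nat \<Rightarrow> complex"
  assumes "c 0 \<noteq> 0"
  obtains r where "c 0 * r^3 + c 1 * r^2 + c 2 * r + c 3 = 0"
proof -
  have "\<not> constant (poly [:c 3, c 2, c 1, c 0:])"
    using assms by (simp add: constant_degree)
  then obtain r where "poly [:c 3, c 2, c 1, c 0:] r = 0"
    using fundamental_theorem_of_algebra by blast
  then show thesis by (intro that[of r]) (simp add: algebra_simps power2_eq_square power3_eq_cube)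
qed

text \<open>Splitting off one root leaves a quadratic. The discriminant of the cubic is that of the
  quadratic times the squared value of the quadratic at the root, so either the quadratic has a
  double root or the root is repeated.\<close>

lemma cubic_disc_eq_0_imp:
  fixes c :: "nat \<Rightarrow> complex"
  assumes disc: "cubic_disc c = 0"
  obtains s t where "s \<noteq> 0 \<or> t \<noteq> 0" "cubic_partial1 c s t = 0" "cubic_partial2 c s t = 0"
proof (cases "c 0 = 0")
  case True
  show thesis
  proof (cases "c 1 = 0")
    case c1: True
    show thesis by (rule that[of 1 0]) (use True c1 in \<open>simp_all add: cubic_partial1_def cubic_partial2_def\<close>)
  next
    case c1: False
    have "cubic_disc c = c 1 * c 1 * (c 2 * c 2 - 4 * c 1 * c 3)"
      unfolding cubic_disc_def True by (simp add: algebra_simps)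
    with disc c1 have eq: "c 2 * c 2 = 4 * c 1 * c 3" by (simp del: One_nat_def)
    \<comment> \<open>If \<open>c 0\<close> vanishes, t splits off, and this point is the double
      root of the remaining quadratic with coefficients \<open>c 1\<close>, \<open>c 2\<close>,
      \<open>c 3\<close>.\<close>
    show thesis
    proof (rule that[of "- c 2" "2 * c 1"])
      show "cubic_partial1 c (- c 2) (2 * c 1) = 0"
        unfolding cubic_partial1_def True by algebra
      show "cubic_partial2 c (- c 2) (2 * c 1) = 0"
        unfolding cubic_partial2_def using eq by algebra
    qed (use c1 in simp)
  qed
next
  case False
  then obtain r where r: "c 0 * r^3 + c 1 * r^2 + c 2 * r + c 3 = 0" by (rule cubic_root)
  \<comment> \<open>The quotient by s - r t is c0 s^2 + p s t + q t^2.\<close>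
  define p where "p = c 1 + c 0 * r"
  define q where "q = c 2 + p * r"
  have c: "c 1 = p - c 0 * r" "c 2 = q - p * r" by (simp_all add: p_def q_def)
  have c3: "c 3 = - q * r" using r unfolding c by algebra
  have "cubic_disc c = (p^2 - 4 * c 0 * q) * (c 0 * r^2 + p * r + q)^2"
    unfolding cubic_disc_def c c3 by algebra
  with disc consider "p^2 = 4 * c 0 * q" | "c 0 * r^2 + p * r + q = 0" by auto
  then show thesis
  proof cases
    case 1
    show thesis
    proof (rule that[of "- p" "2 * c 0"])
      show "cubic_partial1 c (- p) (2 * c 0) = 0" "cubic_partial2 c (- p) (2 * c 0) = 0"
        unfolding cubic_partial1_def cubic_partial2_def c c3 using 1 by algebra+
    qed (use False in simp)
  next
    case 2
    show thesis
    proof (rule that[of r 1])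
      have "cubic_partial1 c r 1 = c 0 * r^2 + p * r + q"
        "cubic_partial2 c r 1 = - r * (c 0 * r^2 + p * r + q)"
        unfolding cubic_partial1_def cubic_partial2_def c c3
        by (simp_all add: algebra_simps power2_eq_square)
      then show "cubic_partial1 c r 1 = 0" "cubic_partial2 c r 1 = 0" using 2 by simp_all
    qed simp
  qed
qed

subsection \<open>Cofactors\<close>

text \<open>With cyclic indices the minors carry the signs of the cofactors already.\<close>

definition next3 :: "3 \<Rightarrow> 3" where "next3 i = (if i = 1 then 2 else if i = 2 then 3 else 1)"

definition prev3 :: "3 \<Rightarrow> 3" where "prev3 i = (if i = 1 then 3 else if i = 2 then 1 else 2)"

definition cofactor :: "(3 \<Rightarrow> 3 \<Rightarrow> 'a::comm_ring_1) \<Rightarrow> 3 \<Rightarrow> 3 \<Rightarrow> 'a" where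
  "cofactor M i j = M (next3 i) (next3 j) * M (prev3 i) (prev3 j) - M (next3 i) (prev3 j) * M (prev3 i) (next3 j)"

definition det3 :: "(3 \<Rightarrow> 3 \<Rightarrow> 'a::comm_ring_1) \<Rightarrow> 'a" where
  "det3 M = (\<Sum>j\<in>UNIV. M 1 j * cofactor M 1 j)"

text \<open>Laplace expansion, together with its vanishing for a foreign row: the product of a
  matrix and its adjugate is the determinant times the identity.\<close>

lemma sum_cofactor_row: "(\<Sum>j\<in>UNIV. M i j * cofactor M i' j) = (if i = i' then det3 M else 0)"
proof -
  have "\<forall>i i'. (\<Sum>j\<in>UNIV. M i j * cofactor M i' j) = (if i = i' then det3 M else 0)"
    by (simp add: forall_3 det3_def sum_3 cofactor_def next3_def prev3_def algebra_simps)
  then show ?thesis by blast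
qed

lemma sum_cofactor_col: "(\<Sum>i\<in>UNIV. M i j * cofactor M i j') = (if j = j' then det3 M else 0)"
proof -
  have "\<forall>j j'. (\<Sum>i\<in>UNIV. M i j * cofactor M i j') = (if j = j' then det3 M else 0)"
    by (simp add: forall_3 det3_def sum_3 cofactor_def next3_def prev3_def algebra_simps)
  then show ?thesis by blast
qed

text \<open>Each 2 by 2 minor of the cofactor matrix is the determinant times an entry of
  \<open>M\<close>, so a singular \<open>M\<close> has a cofactor matrix of rank at most 1. Two
  indices out of three are equal or cyclic neighbours, so neighbours suffice.\<close>

lemma cofactor_minors:
  assumes "det3 M = 0"
  shows "cofactor M i j * cofactor M i' j' = cofactor M i j' * cofactor M i' j"
proof -
  have id: "cofactor M i j * cofactor M (next3 i) (next3 j) - cofactor M i (next3 j) * cofactor M (next3 i) j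
      = det3 M * M (prev3 i) (prev3 j)" for i j
  proof -
    have "\<forall>i j. cofactor M i j * cofactor M (next3 i) (next3 j) - cofactor M i (next3 j) * cofactor M (next3 i) j
      = det3 M * M (prev3 i) (prev3 j)"
      by (simp add: forall_3 det3_def sum_3 cofactor_def next3_def prev3_def algebra_simps)
    then show ?thesis by blast
  qed
  have step: "cofactor M i j * cofactor M (next3 i) (next3 j) = cofactor M i (next3 j) * cofactor M (next3 i) j" for i j
    using id[of i j] assms by simp
  have c: "k' = k \<or> k' = next3 k \<or> k = next3 k'" for k k' :: 3
    using exhaust_3[of k] exhaust_3[of k'] by (auto simp: next3_def)
  from c[of i i'] c[of j j'] show ?thesis
  proof (elim disjE)
    assume "i' = next3 i" "j' = next3 j"
    then show ?thesis using step[of i j] by simp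
  next
    assume "i' = next3 i" "j = next3 j'"
    then show ?thesis using step[of i j'] by (simp add: mult.commute)
  next
    assume "i = next3 i'" "j' = next3 j"
    then show ?thesis using step[of i' j] by (simp add: mult.commute)
  next
    assume "i = next3 i'" "j = next3 j'"
    then show ?thesis using step[of i' j'] by (simp add: mult.commute)
  qed (simp_all add: mult.commute)
qed

text \<open>Row \<open>i\<close> of the cofactor matrix is the cross product of the other two rows
  of \<open>M\<close>. As \<open>v\<close> annihilates both, it is proportional to that cross
  product.\<close>

lemma cofactor_right_kernel:
  fixes M :: "3 \<Rightarrow> 3 \<Rightarrow> complex"
  assumes "\<And>i. (\<Sum>j\<in>UNIV. M i j * v j) = 0"
  shows "cofactor M i j * v j' = cofactor M i j' * v j"
proof -
  have h: "M i 1 * v 1 + M i 2 * v 2 + M i 3 * v 3 = 0" for i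
    using assms[of i] by (simp add: sum_3)
  have step: "cofactor M i j * v (next3 j) = cofactor M i (next3 j) * v j" for i j
  proof -
    have n: "next3 1 = 2" "next3 2 = 3" "next3 3 = 1" "prev3 1 = 3" "prev3 2 = 1" "prev3 3 = 2"
      by (simp_all add: next3_def prev3_def)
    have cross: "(a2 * b3 - a3 * b2) * v2 = (a3 * b1 - a1 * b3) * v1"
      if "a1 * v1 + a2 * v2 + a3 * v3 = 0" "b1 * v1 + b2 * v2 + b3 * v3 = 0"
      for a1 a2 a3 b1 b2 b3 v1 v2 v3 :: complex
      using that by algebra
    have perm: "x2 + x3 + x1 = 0" "x3 + x1 + x2 = 0" if "x1 + x2 + x3 = 0" for x1 x2 x3 :: complex
      using that by (simp_all add: ac_simps)
    note a = h[of "next3 i"] and b = h[of "prev3 i"]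
    consider "j = 1" | "j = 2" | "j = 3" using exhaust_3[of j] by blast
    then show ?thesis
    proof cases
      case 1
      show ?thesis unfolding cofactor_def 1 n by (rule cross[OF a b])
    next
      case 2
      show ?thesis unfolding cofactor_def 2 n by (rule cross[OF perm(1)[OF a] perm(1)[OF b]])
    next
      case 3
      show ?thesis unfolding cofactor_def 3 n by (rule cross[OF perm(2)[OF a] perm(2)[OF b]])
    qed
  qed
  have "j' = j \<or> j' = next3 j \<or> j = next3 j'"
    using exhaust_3[of j] exhaust_3[of j'] by (auto simp: next3_def)
  then show ?thesis using step[of i j] step[of i j'] by auto
qed

lemma cofactor_transpose: "cofactor (\<lambda>i j. M j i) i j = cofactor M j i"
  by (simp add: cofactor_def mult.commute)

lemma cofactor_left_kernel:
  fixes M :: "3 \<Rightarrow> 3 \<Rightarrow> complex"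
  assumes "\<And>j. (\<Sum>i\<in>UNIV. M i j * u i) = 0"
  shows "cofactor M i j * u i' = cofactor M i' j * u i"
proof -
  have "cofactor (\<lambda>i j. M j i) j i * u i' = cofactor (\<lambda>i j. M j i) j i' * u i"
    by (rule cofactor_right_kernel) (rule assms)
  then show ?thesis by (simp only: cofactor_transpose[of M])
qed

lemma singular_kernel:
  fixes B :: "complex ^ 3 ^ 3"
  assumes "det B = 0"
  obtains x where "x \<noteq> 0" "\<And>i. (\<Sum>j\<in>UNIV. B $ i $ j * x $ j) = 0"
proof -
  have "\<not> invertible B" using assms by (simp add: invertible_det_nz)
  then obtain x where "B *v x = 0" "x \<noteq> 0"
    by (metis invertible_left_inverse matrix_left_invertible_ker)
  then show thesis by (intro that[of x]) (auto simp: matrix_vector_mult_def vec_eq_iff)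
qed

lemma orthogonal_to_two:
  fixes y z :: "3 \<Rightarrow> complex"
  obtains v :: "complex ^ 3" where "v \<noteq> 0" "(\<Sum>j\<in>UNIV. y j * v $ j) = 0" "(\<Sum>j\<in>UNIV. z j * v $ j) = 0"
proof -
  \<comment> \<open>The zero row makes the matrix singular, and its kernel is the space
    sought.\<close>
  let ?B = "\<chi> (i :: 3) j. if i = 1 then y j else if i = 2 then z j else 0"
  have "det ?B = 0" by (simp add: det_3)
  then obtain x where x: "x \<noteq> 0" "\<And>i. (\<Sum>j\<in>UNIV. ?B $ i $ j * x $ j) = 0"
    using singular_kernel[of ?B] by blast
  show thesis using x(1) x(2)[of 1] x(2)[of 2] by (intro that[of x]) simp_all
qed

subsection \<open>Degenerate trilinear forms\<close>

definition pencil :: "complex ^ idx \<Rightarrow> complex ^ 2 \<Rightarrow> 3 \<Rightarrow> 3 \<Rightarrow> complex" where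
  "pencil A w i j = (\<Sum>k\<in>UNIV. A $ (i, j, k) * w $ k)"

text \<open>All first partial derivatives of the trilinear form of \<open>A\<close> vanish at
  \<open>u\<close>, \<open>v\<close>, \<open>w\<close>.\<close>

definition critical_point :: "complex ^ idx \<Rightarrow> complex ^ 3 \<Rightarrow> complex ^ 3 \<Rightarrow> complex ^ 2 \<Rightarrow> bool" where
  "critical_point A u v w \<longleftrightarrow>
     (\<forall>i. (\<Sum>j\<in>UNIV. \<Sum>k\<in>UNIV. A $ (i, j, k) * v $ j * w $ k) = 0) \<and>
     (\<forall>j. (\<Sum>i\<in>UNIV. \<Sum>k\<in>UNIV. A $ (i, j, k) * u $ i * w $ k) = 0) \<and>
     (\<forall>k. (\<Sum>i\<in>UNIV. \<Sum>j\<in>UNIV. A $ (i, j, k) * u $ i * v $ j) = 0)"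

lemma critical_point_pencil:
  "critical_point A u v w \<longleftrightarrow>
     (\<forall>i. (\<Sum>j\<in>UNIV. pencil A w i j * v $ j) = 0) \<and>
     (\<forall>j. (\<Sum>i\<in>UNIV. pencil A w i j * u $ i) = 0) \<and>
     (\<forall>k. (\<Sum>i\<in>UNIV. \<Sum>j\<in>UNIV. A $ (i, j, k) * u $ i * v $ j) = 0)"
proof -
  have "(\<Sum>j\<in>UNIV. pencil A w i j * v $ j) = (\<Sum>j\<in>UNIV. \<Sum>k\<in>UNIV. A $ (i, j, k) * v $ j * w $ k)" for i
    unfolding pencil_def sum_distrib_right by (intro sum.cong refl) (simp add: ac_simps)
  moreover have "(\<Sum>i\<in>UNIV. pencil A w i j * u $ i) = (\<Sum>i\<in>UNIV. \<Sum>k\<in>UNIV. A $ (i, j, k) * u $ i * w $ k)" for j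
    unfolding pencil_def sum_distrib_right by (intro sum.cong refl) (simp add: ac_simps)
  ultimately show ?thesis by (simp add: critical_point_def)
qed

text \<open>Jacobi's formula: the derivative of a determinant is the sum of the cofactors times the
  derivatives of the entries.\<close>

lemma cubic_partial_pencil:
  "cubic_partial1 (cubic_coeff (($) A)) (w $ 1) (w $ 2) =
     (\<Sum>i\<in>UNIV. \<Sum>j\<in>UNIV. cofactor (pencil A w) i j * A $ (i, j, 1))"
  "cubic_partial2 (cubic_coeff (($) A)) (w $ 1) (w $ 2) =
     (\<Sum>i\<in>UNIV. \<Sum>j\<in>UNIV. cofactor (pencil A w) i j * A $ (i, j, 2))"
  by (simp_all add: cubic_partial1_def cubic_partial2_def cubic_coeff_def perm_signs_def slice_choices_def
      col_def slice_def sum_3 sum_2 cofactor_def next3_def prev3_def pencil_def power2_eq_square, algebra+)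

text \<open>Euler's identity for the cubic det (s A + t B), combined with Jacobi's formula.\<close>

lemma det3_pencil:
  "3 * det3 (pencil A w) = w $ 1 * (\<Sum>i\<in>UNIV. \<Sum>j\<in>UNIV. cofactor (pencil A w) i j * A $ (i, j, 1))
     + w $ 2 * (\<Sum>i\<in>UNIV. \<Sum>j\<in>UNIV. cofactor (pencil A w) i j * A $ (i, j, 2))"
proof -
  have "3 * det3 (pencil A w) = (\<Sum>i\<in>UNIV. \<Sum>j\<in>UNIV. pencil A w i j * cofactor (pencil A w) i j)"
    by (simp add: sum_cofactor_row)
  also have "\<dots> = (\<Sum>i\<in>UNIV. \<Sum>j\<in>UNIV. w $ 1 * (cofactor (pencil A w) i j * A $ (i, j, 1)) + w $ 2 * (cofactor (pencil A w) i j * A $ (i, j, 2)))"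
    by (simp add: pencil_def[of A w] sum_2 algebra_simps)
  finally show ?thesis by (simp add: sum.distrib sum_distrib_left)
qed

text \<open>The cofactor matrix at \<open>w\<close> is a multiple of u \<otimes> v. The partial
  derivatives of the cubic at \<open>w\<close> are thus multiples of those of the trilinear form in
  the third argument, which vanish.\<close>

lemma critical_point_imp_disc:
  assumes crit: "critical_point A u v w" and nz: "u \<noteq> 0" "v \<noteq> 0" "w \<noteq> 0"
  shows "pencil_disc (($) A) = 0"
proof -
  let ?C = "cofactor (pencil A w)"
  obtain i0 where i0: "u $ i0 \<noteq> 0" using nz by (auto simp: vec_eq_iff)
  obtain j0 where j0: "v $ j0 \<noteq> 0" using nz by (auto simp: vec_eq_iff)
  have v: "(\<Sum>j\<in>UNIV. pencil A w i j * v $ j) = 0" for i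
    using crit by (simp add: critical_point_pencil)
  have u: "(\<Sum>i\<in>UNIV. pencil A w i j * u $ i) = 0" for j
    using crit by (simp add: critical_point_pencil)
  have C: "u $ i0 * v $ j0 * ?C i j = ?C i0 j0 * u $ i * v $ j" for i j
  proof -
    have "u $ i0 * v $ j0 * ?C i j = u $ i0 * (?C i j * v $ j0)" by simp
    also have "?C i j * v $ j0 = ?C i j0 * v $ j" by (rule cofactor_right_kernel[OF v])
    also have "u $ i0 * (?C i j0 * v $ j) = (?C i j0 * u $ i0) * v $ j" by simp
    also have "?C i j0 * u $ i0 = ?C i0 j0 * u $ i" by (rule cofactor_left_kernel[OF u])
    finally show ?thesis .
  qed
  have "(\<Sum>i\<in>UNIV. \<Sum>j\<in>UNIV. ?C i j * A $ (i, j, k)) = 0" for k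
  proof -
    have "u $ i0 * v $ j0 * (\<Sum>i\<in>UNIV. \<Sum>j\<in>UNIV. ?C i j * A $ (i, j, k)) =
        (\<Sum>i\<in>UNIV. \<Sum>j\<in>UNIV. (u $ i0 * v $ j0 * ?C i j) * A $ (i, j, k))"
      by (simp add: sum_distrib_left mult.assoc)
    also have "\<dots> = ?C i0 j0 * (\<Sum>i\<in>UNIV. \<Sum>j\<in>UNIV. A $ (i, j, k) * u $ i * v $ j)"
      unfolding C by (simp add: sum_distrib_left ac_simps)
    also have "\<dots> = 0" using crit by (simp add: critical_point_def)
    finally show ?thesis using i0 j0 by simp
  qed
  moreover have "w $ 1 \<noteq> 0 \<or> w $ 2 \<noteq> 0" using nz(3) by (auto simp: vec_eq_iff forall_2)
  ultimately show ?thesis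
    unfolding pencil_disc_def by (intro cubic_disc_double_root[of _ "w $ 1" "w $ 2"]) (simp_all add: cubic_partial_pencil)
qed

text \<open>At a double root \<open>w\<close> of the cubic, a nonzero cofactor matrix has rank 1 and
  supplies \<open>u\<close> and \<open>v\<close> as a column and a row. Otherwise the pencil has
  rank at most 1 at \<open>w\<close>, and its large right kernel leaves room for one further linear
  condition on \<open>v\<close>.\<close>

lemma disc_imp_critical_point:
  assumes "pencil_disc (($) A) = 0"
  obtains u v w where "u \<noteq> 0" "v \<noteq> 0" "w \<noteq> 0" "critical_point A u v w"
proof -
  obtain s t where st: "s \<noteq> 0 \<or> t \<noteq> 0"
    "cubic_partial1 (cubic_coeff (($) A)) s t = 0" "cubic_partial2 (cubic_coeff (($) A)) s t = 0"
    using assms unfolding pencil_disc_def by (rule cubic_disc_eq_0_imp)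
  define w :: "complex ^ 2" where "w = (\<chi> k. if k = 1 then s else t)"
  have w12: "w $ 1 = s" "w $ 2 = t" by (simp_all add: w_def)
  then have w: "w \<noteq> 0" using st(1) by auto
  let ?M = "pencil A w" let ?C = "cofactor ?M"
  have CA: "(\<Sum>i\<in>UNIV. \<Sum>j\<in>UNIV. ?C i j * A $ (i, j, k)) = 0" for k
    using st(2,3) cubic_partial_pencil[of A w] exhaust_2[of k] by (auto simp: w12)
  have det: "det3 ?M = 0" using det3_pencil[of A w] by (simp add: CA)
  show thesis
  proof (cases "\<exists>i j. ?C i j \<noteq> 0")
    case True
    then obtain i0 j0 where nz: "?C i0 j0 \<noteq> 0" by blast
    define u v :: "complex ^ 3" where "u = (\<chi> i. ?C i j0)" and "v = (\<chi> j. ?C i0 j)"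
    have "u $ i0 \<noteq> 0" "v $ j0 \<noteq> 0" using nz by (simp_all add: u_def v_def)
    then have "u \<noteq> 0" "v \<noteq> 0" by auto
    moreover have "critical_point A u v w"
      unfolding critical_point_pencil
    proof (intro conjI allI)
      show "(\<Sum>j\<in>UNIV. ?M i j * v $ j) = 0" for i
        using sum_cofactor_row[of ?M i i0] det by (simp add: v_def)
      show "(\<Sum>i\<in>UNIV. ?M i j * u $ i) = 0" for j
        using sum_cofactor_col[of ?M j j0] det by (simp add: u_def)
      show "(\<Sum>i\<in>UNIV. \<Sum>j\<in>UNIV. A $ (i, j, k) * u $ i * v $ j) = 0" for k
      proof -
        have "A $ (i, j, k) * u $ i * v $ j = ?C i0 j0 * (?C i j * A $ (i, j, k))" for i j
          using cofactor_minors[OF det, of i j0 i0 j] by (simp add: u_def v_def mult.commute mult.left_commute)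
        then have "(\<Sum>i\<in>UNIV. \<Sum>j\<in>UNIV. A $ (i, j, k) * u $ i * v $ j) =
            ?C i0 j0 * (\<Sum>i\<in>UNIV. \<Sum>j\<in>UNIV. ?C i j * A $ (i, j, k))"
          by (simp only: sum_distrib_left)
        then show ?thesis by (simp add: CA)
      qed
    qed
    ultimately show thesis using w by (intro that)
  next
    case False
    then have C0: "?C i j = 0" for i j by blast
    have "det (\<chi> i j. ?M j i) = det3 ?M"
      by (simp add: det_3 det3_def sum_3 cofactor_def next3_def prev3_def algebra_simps)
    then obtain u where u: "u \<noteq> 0" "\<And>i. (\<Sum>j\<in>UNIV. (\<chi> i j. ?M j i) $ i $ j * u $ j) = 0"
      using singular_kernel[of "\<chi> i j. ?M j i"] det by auto
    then have uM: "(\<Sum>i\<in>UNIV. ?M i j * u $ i) = 0" for j by simp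
    \<comment> \<open>Only the condition for \<open>k2\<close> is imposed on \<open>v\<close>. Since
      \<open>w $ k1\<close> is nonzero, the condition for \<open>k1\<close> will follow from the
      vanishing of the pencil at \<open>w\<close> on \<open>u\<close> and \<open>v\<close>.\<close>
    obtain k1 k2 :: 2 where k: "w $ k1 \<noteq> 0" "k1 \<noteq> k2" "(UNIV :: 2 set) = {k1, k2}"
    proof (cases "w $ 1 = 0")
      case True
      then have "w $ 2 \<noteq> 0" using w by (auto simp: vec_eq_iff forall_2)
      then show thesis by (intro that[of 2 1]) (auto simp: UNIV_2)
    next
      case False
      then show thesis by (intro that[of 1 2]) (auto simp: UNIV_2)
    qed
    define z where "z j = (\<Sum>i\<in>UNIV. A $ (i, j, k2) * u $ i)" for j
    have minors: "?M i j * ?M i' j' = ?M i j' * ?M i' j" for i j i' j'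
    proof -
      have step: "?M i j * ?M i' j' = ?M i j' * ?M i' j" if "i' = next3 i" "j' = next3 j" for i j i' j'
        using C0[of "prev3 i" "prev3 j"] exhaust_3[of i] exhaust_3[of j] that
        by (auto simp: cofactor_def next3_def prev3_def)
      have c: "k' = k \<or> k' = next3 k \<or> k = next3 k'" for k k' :: 3
        using exhaust_3[of k] exhaust_3[of k'] by (auto simp: next3_def)
      from c[of i i'] c[of j j'] show ?thesis
      proof (elim disjE)
        assume *: "i' = next3 i" "j' = next3 j"
        show ?thesis by (rule step[OF *])
      next
        assume *: "i' = next3 i" "j = next3 j'"
        show ?thesis by (rule step[OF *, symmetric])
      next
        assume *: "i = next3 i'" "j' = next3 j"
        show ?thesis using step[OF *] by (simp only: mult.commute)
      next
        assume *: "i = next3 i'" "j = next3 j'"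
        show ?thesis using step[OF *] by (simp only: mult.commute)
      qed (simp_all only: mult.commute)
    qed
    \<comment> \<open>By the vanishing minors, all rows of the matrix are multiples of one row
      \<open>y\<close>; the zero matrix gets \<open>y = 0\<close>.\<close>
    obtain y where y: "\<And>i. \<exists>c. \<forall>j. ?M i j = c * y j"
    proof (cases "\<exists>i j. ?M i j \<noteq> 0")
      case True
      then obtain i0 j0 where nz: "?M i0 j0 \<noteq> 0" by blast
      have "?M i j = ?M i j0 / ?M i0 j0 * ?M i0 j" for i j
        using minors[of i j i0 j0] nz by (simp add: field_simps)
      then show thesis by (intro that[of "?M i0"]) blast
    next
      case False
      then show thesis by (intro that[of "\<lambda>_. 0"]) auto
    qed
    obtain v where v: "v \<noteq> 0" "(\<Sum>j\<in>UNIV. y j * v $ j) = 0" "(\<Sum>j\<in>UNIV. z j * v $ j) = 0"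
      by (rule orthogonal_to_two)
    have Mv: "(\<Sum>j\<in>UNIV. ?M i j * v $ j) = 0" for i
    proof -
      obtain c where "\<And>j. ?M i j = c * y j" using y by blast
      then have "(\<Sum>j\<in>UNIV. ?M i j * v $ j) = c * (\<Sum>j\<in>UNIV. y j * v $ j)"
        by (simp add: sum_distrib_left mult.assoc)
      then show ?thesis using v(2) by simp
    qed
    let ?S = "\<lambda>k. \<Sum>i\<in>UNIV. \<Sum>j\<in>UNIV. A $ (i, j, k) * u $ i * v $ j"
    have S2: "?S k2 = 0"
    proof -
      have "?S k2 = (\<Sum>j\<in>UNIV. z j * v $ j)"
        unfolding z_def sum_distrib_right by (rule sum.swap)
      then show ?thesis using v(3) by simp
    qed
    have "(\<Sum>k\<in>UNIV. w $ k * ?S k) = (\<Sum>i\<in>UNIV. u $ i * (\<Sum>j\<in>UNIV. ?M i j * v $ j))"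
      by (simp add: pencil_def sum_2 sum_3 algebra_simps)
    then have "w $ k1 * ?S k1 = 0" using k(2) S2 by (simp add: Mv k(3))
    then have "?S k1 = 0" using k(1) by simp
    have "?S k = 0" for k
    proof -
      have "k = k1 \<or> k = k2" using k(3) by blast
      then show ?thesis using S2 \<open>?S k1 = 0\<close> by blast
    qed
    then have "critical_point A u v w"
      using Mv uM by (simp add: critical_point_pencil)
    then show thesis using u(1) v(1) w by (intro that)
  qed
qed

subsection \<open>Tangent spaces of the Segre cone\<close>

text \<open>The value \<open>D\<close> is chosen before the curve \<open>h\<close>: it depends only
  on the starting point and the velocity. This allows lines to be replaced by curves.\<close>

lemma DERIV_monomial:
  fixes x d :: "complex ^ 'n::finite"
  assumes "finite A"
  shows "\<exists>D. \<forall>h. h 0 = x \<longrightarrow> (\<forall>i. ((\<lambda>z. h z $ i) has_field_derivative d $ i) (at 0)) \<longrightarrow>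
     ((\<lambda>z. \<Prod>i\<in>A. (h z $ i) ^ e i) has_field_derivative D) (at (0 :: complex))"
  using assms
proof (induction A)
  case empty
  show ?case by (intro exI[of _ 0]) auto
next
  case (insert a A)
  then obtain D where D: "\<And>h. h 0 = x \<Longrightarrow> (\<And>i. ((\<lambda>z. h z $ i) has_field_derivative d $ i) (at 0)) \<Longrightarrow>
     ((\<lambda>z. \<Prod>i\<in>A. (h z $ i) ^ e i) has_field_derivative D) (at (0 :: complex))"
    by blast
  show ?case
  proof (intro exI allI impI)
    fix h :: "complex \<Rightarrow> complex ^ 'n"
    assume h: "h 0 = x" "\<forall>i. ((\<lambda>z. h z $ i) has_field_derivative d $ i) (at 0)"
    have "((\<lambda>z. (h z $ a) ^ e a * (\<Prod>i\<in>A. (h z $ i) ^ e i)) has_field_derivative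
        of_nat (e a) * (d $ a * (h 0 $ a) ^ (e a - Suc 0)) * (\<Prod>i\<in>A. (h 0 $ i) ^ e i) + D * (h 0 $ a) ^ e a) (at 0)"
      by (intro DERIV_mult DERIV_power D) (use h in auto)
    then show "((\<lambda>z. \<Prod>i\<in>insert a A. (h z $ i) ^ e i) has_field_derivative
        of_nat (e a) * (d $ a * (x $ a) ^ (e a - Suc 0)) * (\<Prod>i\<in>A. (x $ i) ^ e i) + D * (x $ a) ^ e a) (at 0)"
      using insert.hyps h(1) by simp
  qed
qed

lemma DERIV_peval:
  fixes f :: "('n::finite, complex) polynomial" and x d :: "complex ^ 'n"
  shows "\<exists>D. \<forall>h. h 0 = x \<longrightarrow> (\<forall>i. ((\<lambda>z. h z $ i) has_field_derivative d $ i) (at 0)) \<longrightarrow>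
     ((\<lambda>z. peval f (h z)) has_field_derivative D) (at 0)"
proof -
  have "\<exists>D. \<forall>h. h 0 = x \<longrightarrow> (\<forall>i. ((\<lambda>z. h z $ i) has_field_derivative d $ i) (at 0)) \<longrightarrow>
     ((\<lambda>z. \<Prod>i\<in>UNIV. (h z $ i) ^ lookup m i) has_field_derivative D) (at (0 :: complex))" for m :: "'n \<Rightarrow>\<^sub>0 nat"
    by (rule DERIV_monomial) simp
  then have "\<exists>D. \<forall>m. \<forall>h. h 0 = x \<longrightarrow> (\<forall>i. ((\<lambda>z. h z $ i) has_field_derivative d $ i) (at 0)) \<longrightarrow>
     ((\<lambda>z. \<Prod>i\<in>UNIV. (h z $ i) ^ lookup m i) has_field_derivative D m) (at (0 :: complex))"
    by (intro choice allI)
  then obtain D where D: "\<And>m h. h 0 = x \<Longrightarrow> (\<And>i. ((\<lambda>z. h z $ i) has_field_derivative d $ i) (at 0)) \<Longrightarrow>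
     ((\<lambda>z. \<Prod>i\<in>UNIV. (h z $ i) ^ lookup m i) has_field_derivative D m) (at (0 :: complex))"
    by blast
  show ?thesis
    unfolding peval_def
    by (intro exI[of _ "\<Sum>m\<in>keys f. lookup f m * D m"] allI impI DERIV_sum DERIV_cmult D) auto
qed

lemma deriv_along_curve:
  fixes f :: "('n::finite, complex) polynomial"
  assumes "h 0 = x" "\<And>i. ((\<lambda>z. h z $ i) has_field_derivative t $ i) (at 0)"
  shows "deriv (\<lambda>z. peval f (x + z *s t)) 0 = deriv (\<lambda>z. peval f (h z)) 0"
proof -
  obtain D where D: "\<And>h. h 0 = x \<Longrightarrow> (\<And>i. ((\<lambda>z. h z $ i) has_field_derivative t $ i) (at 0)) \<Longrightarrow>
     ((\<lambda>z. peval f (h z)) has_field_derivative D) (at 0)"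
    using DERIV_peval[of x t f] by blast
  have "((\<lambda>z. peval f (x + z *s t)) has_field_derivative D) (at 0)"
    by (rule D) (auto intro!: derivative_eq_intros)
  moreover have "((\<lambda>z. peval f (h z)) has_field_derivative D) (at 0)"
    by (rule D) (use assms in auto)
  ultimately show ?thesis by (simp add: DERIV_imp_deriv)
qed

text \<open>A polynomial of the ideal is constantly zero along a curve inside \<open>X\<close>, and
  its derivative along the line equals that along the curve.\<close>

lemma tangent_space_curve:
  assumes "\<And>z. h z \<in> X" "\<And>i. ((\<lambda>z. h z $ i) has_field_derivative t $ i) (at 0)"
  shows "t \<in> tangent_space X (h 0)"
proof -
  have "deriv (\<lambda>z. peval f (h 0 + z *s t)) 0 = 0" if "f \<in> vanishing_ideal X" for f
  proof -
    have "(\<lambda>z. peval f (h z)) = (\<lambda>_. 0)" using that assms(1) by (auto simp: vanishing_ideal_def)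
    then show ?thesis using deriv_along_curve[of h "h 0" t f] assms(2) by simp
  qed
  then show ?thesis by (simp add: tangent_space_def)
qed

section \<open>Points and tangent vectors of the Segre cone\<close>

definition segre :: "(3 \<Rightarrow> complex) \<Rightarrow> (3 \<Rightarrow> complex) \<Rightarrow> (2 \<Rightarrow> complex) \<Rightarrow> complex ^ idx" where
  "segre u v w = vec_lambda (\<lambda>(i, j, k). u i * v j * w k)"

lemma segre_nth: "segre u v w $ (i, j, k) = u i * v j * w k"
  by (simp add: segre_def)

lemma segre_in_cone: "segre u v w \<in> segre_cone"
  unfolding segre_cone_def segre_def
  by (intro CollectI exI[of _ "vec_lambda u"] exI[of _ "vec_lambda v"] exI[of _ "vec_lambda w"]) simp

lemma segre_cone_cases:
  assumes "p \<in> segre_cone"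
  obtains u v w where "p = segre u v w"
  using assms unfolding segre_cone_def segre_def by blast

text \<open>The product rule, applied to the curve that moves all three factors linearly.\<close>

lemma segre_tangent:
  "segre u' v w + segre u v' w + segre u v w' \<in> tangent_space segre_cone (segre u v w)"
proof -
  let ?h = "\<lambda>z. segre (\<lambda>i. u i + z * u' i) (\<lambda>j. v j + z * v' j) (\<lambda>k. w k + z * w' k)"
  have "segre u' v w + segre u v' w + segre u v w' \<in> tangent_space segre_cone (?h 0)"
  proof (rule tangent_space_curve)
    fix q :: idx
    obtain i j k where q: "q = (i, j, k)" by (cases q)
    show "((\<lambda>z. ?h z $ q) has_field_derivative (segre u' v w + segre u v' w + segre u v w') $ q) (at 0)"
      unfolding q by (auto simp: segre_nth algebra_simps intro!: derivative_eq_intros)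
  qed (rule segre_in_cone)
  then show ?thesis by simp
qed

text \<open>
  In the chart where the entry of \<open>p\<close> at \<open>(i0, j0, k0)\<close> is nonzero, the entries of \<open>t\<close> on the
  three lines through this position determine a tangent vector \<open>t\<close>.
\<close>

definition tangent_entry :: "idx \<Rightarrow> complex ^ idx \<Rightarrow> complex ^ idx \<Rightarrow> idx \<Rightarrow> complex" where
  "tangent_entry = (\<lambda>(i0, j0, k0) p t (i, j, k).
     (t $ (i, j0, k0) * p $ (i0, j, k0) * p $ (i0, j0, k) + p $ (i, j0, k0) * t $ (i0, j, k0) * p $ (i0, j0, k)
       + p $ (i, j0, k0) * p $ (i0, j, k0) * t $ (i0, j0, k)) / (p $ (i0, j0, k0))^2
     - 2 * t $ (i0, j0, k0) * p $ (i, j0, k0) * p $ (i0, j, k0) * p $ (i0, j0, k) / (p $ (i0, j0, k0))^3)"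

lemma tangent_entry_solve:
  fixes c T P X Y t :: complex
  assumes "c \<noteq> 0" "T * c^2 + 2 * P * c * t - X = 0" "P = Y / c^2"
  shows "T = X / c^2 - 2 * t * Y / c^3"
proof -
  have "T * c^2 = X - 2 * P * c * t" using assms(2) by (simp add: algebra_simps)
  also have "\<dots> = X - 2 * t * Y / c" using assms(1) by (simp add: assms(3) power2_eq_square)
  finally have "T = (X - 2 * t * Y / c) / c^2" using assms(1) by (simp add: field_simps)
  then show ?thesis by (simp add: diff_divide_distrib power2_eq_square power3_eq_cube mult.assoc)
qed

lemma tangent_entry_split:
  fixes c a b d ta tb td t :: complex
  assumes "c \<noteq> 0"
  shows "(ta * b * d + a * tb * d + a * b * td) / c^2 - 2 * t * a * b * d / c^3 =
    ta * (b / c) * (d / c) + a * ((tb - t * (b / c)) / c) * (d / c) + a * (b / c) * ((td - t * (d / c)) / c)"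
  using assms by (simp add: field_simps power2_eq_square power3_eq_cube)

text \<open>One inclusion differentiates a cubic equation of the cone and solves for the entry of
  \<open>t\<close>. For the other, a \<open>t\<close> of the given form is a velocity of a curve of
  rank one tensors.\<close>

lemma tangent_space_segre_cone:
  assumes p: "p \<in> segre_cone" and o: "p $ (i0, j0, k0) \<noteq> 0"
  shows "tangent_space segre_cone p = {t. \<forall>q. t $ q = tangent_entry (i0, j0, k0) p t q}"
proof (intro equalityI subsetI CollectI allI)
  fix t and q :: idx assume t: "t \<in> tangent_space segre_cone p"
  obtain i j k where q: "q = (i, j, k)" by (cases q)
  obtain u v w where uvw: "p = segre u v w" using p by (rule segre_cone_cases)
  \<comment> \<open>On the cone, an entry times the square of the base entry is the product of its
    three projections to the lines through the base position.\<close>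
  let ?f = "Var (i, j, k) * (Var (i0, j0, k0) * Var (i0, j0, k0))
     - Var (i, j0, k0) * (Var (i0, j, k0) * Var (i0, j0, k)) :: (idx, complex) polynomial"
  have f: "peval ?f x = x $ (i, j, k) * (x $ (i0, j0, k0) * x $ (i0, j0, k0)) - x $ (i, j0, k0) * (x $ (i0, j, k0) * x $ (i0, j0, k))" for x
    by (simp add: peval_eq_eval_poly hom_id.eval_simps)
  have "?f \<in> vanishing_ideal segre_cone"
    unfolding vanishing_ideal_def f by (auto elim!: segre_cone_cases simp: f segre_nth)
  then have "deriv (\<lambda>z. peval ?f (p + z *s t)) 0 = 0" using t by (simp add: tangent_space_def)
  moreover have "((\<lambda>z. peval ?f (p + z *s t)) has_field_derivative
      t $ (i, j, k) * (p $ (i0, j0, k0))^2 + 2 * p $ (i, j, k) * p $ (i0, j0, k0) * t $ (i0, j0, k0)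
      - (t $ (i, j0, k0) * p $ (i0, j, k0) * p $ (i0, j0, k) + p $ (i, j0, k0) * t $ (i0, j, k0) * p $ (i0, j0, k)
       + p $ (i, j0, k0) * p $ (i0, j, k0) * t $ (i0, j0, k))) (at 0)"
    unfolding f by (auto simp: power2_eq_square algebra_simps intro!: derivative_eq_intros)
  ultimately have "t $ (i, j, k) * (p $ (i0, j0, k0))^2 + 2 * p $ (i, j, k) * p $ (i0, j0, k0) * t $ (i0, j0, k0)
      - (t $ (i, j0, k0) * p $ (i0, j, k0) * p $ (i0, j0, k) + p $ (i, j0, k0) * t $ (i0, j, k0) * p $ (i0, j0, k)
       + p $ (i, j0, k0) * p $ (i0, j, k0) * t $ (i0, j0, k)) = 0"
    by (simp add: DERIV_imp_deriv)
  moreover have "p $ (i, j, k) = p $ (i, j0, k0) * p $ (i0, j, k0) * p $ (i0, j0, k) / (p $ (i0, j0, k0))^2"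
    using o by (simp add: uvw segre_nth field_simps power2_eq_square)
  ultimately show "t $ q = tangent_entry (i0, j0, k0) p t q"
    unfolding q tangent_entry_def prod.case
    using tangent_entry_solve[OF o, of "t $ (i, j, k)" "p $ (i, j, k)"] by (simp only: mult.assoc)
next
  fix t assume "t \<in> {t. \<forall>q. t $ q = tangent_entry (i0, j0, k0) p t q}"
  then have t: "t $ (i, j, k) = tangent_entry (i0, j0, k0) p t (i, j, k)" for i j k by blast
  obtain u v w where uvw: "p = segre u v w" using p by (rule segre_cone_cases)
  define c where "c = p $ (i0, j0, k0)"
  have c: "c \<noteq> 0" using o by (simp add: c_def)
  define U where "U i = p $ (i, j0, k0)" for i
  define V where "V j = p $ (i0, j, k0) / c" for j
  define W where "W k = p $ (i0, j0, k) / c" for k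
  have "p = segre U V W"
    using c by (auto simp: vec_eq_iff segre_nth U_def V_def W_def c_def uvw field_simps)
  \<comment> \<open>The last two summands subtract the part due to \<open>t $ (i0, j0, k0)\<close>,
    which would otherwise be counted three times.\<close>
  have t_eq: "t = segre (\<lambda>i. t $ (i, j0, k0)) V W
      + segre U (\<lambda>j. (t $ (i0, j, k0) - t $ (i0, j0, k0) * V j) / c) W
      + segre U V (\<lambda>k. (t $ (i0, j0, k) - t $ (i0, j0, k0) * W k) / c)" (is "t = ?t")
  proof -
    have "t $ (i, j, k) = ?t $ (i, j, k)" for i j k
      unfolding t[of i j k] tangent_entry_def prod.case vector_add_component segre_nth U_def V_def W_def c_def[symmetric]
      by (rule tangent_entry_split[OF c])
    note entry = this
    show ?thesis
    proof (rule vec_eq_iff[THEN iffD2], rule allI)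
      fix q :: idx
      obtain i j k where "q = (i, j, k)" by (cases q)
      then show "t $ q = ?t $ q" using entry[of i j k] by (rule ssubst)
    qed
  qed
  have "segre u' V W + segre U v' W + segre U V w' \<in> tangent_space segre_cone p" for u' v' w'
    unfolding \<open>p = segre U V W\<close> by (rule segre_tangent)
  then show "t \<in> tangent_space segre_cone p" by (subst t_eq)
qed

section \<open>Dimension of the tangent spaces\<close>

definition star :: "idx \<Rightarrow> idx set" where
  "star = (\<lambda>(i0, j0, k0). (\<lambda>i. (i, j0, k0)) ` UNIV \<union> (\<lambda>j. (i0, j, k0)) ` UNIV \<union> (\<lambda>k. (i0, j0, k)) ` UNIV)"

lemma card_star: "card (star q) = 6"
proof -
  obtain i0 j0 k0 where q: "q = (i0, j0, k0)" by (cases q)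
  have "star q = (\<lambda>i. (i, j0, k0)) ` UNIV \<union> ((\<lambda>j. (i0, j, k0)) ` (UNIV - {j0}) \<union> (\<lambda>k. (i0, j0, k)) ` (UNIV - {k0}))"
    by (auto simp: star_def q)
  also have "card \<dots> = 3 + (2 + 1)"
    by (subst card_Un_disjoint; (subst card_Un_disjoint)?)
      (auto simp: card_image inj_on_def card_Diff_singleton)
  finally show ?thesis by simp
qed

text \<open>The projection \<open>\<pi>\<close> to the six positions in the star maps the tangent
  space isomorphically to a coordinate subspace: \<open>tangent_entry\<close> recovers a tangent
  vector from these entries, and they can be prescribed freely.\<close>

lemma dim_tangent_space_segre_cone:
  assumes p: "p \<in> segre_cone" "p \<noteq> 0"
  shows "vec.dim (tangent_space segre_cone p) = 6"
proof -
  obtain q where "p $ q \<noteq> 0" using p(2) by (auto simp: vec_eq_iff)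
  then obtain i0 j0 k0 where o: "p $ (i0, j0, k0) \<noteq> 0" by (cases q) auto
  let ?T = "tangent_space segre_cone p" and ?e = "tangent_entry (i0, j0, k0) p" and ?S = "star (i0, j0, k0)"
  note T = tangent_space_segre_cone[OF p(1) o]
  define \<pi> :: "complex ^ idx \<Rightarrow> complex ^ idx" where "\<pi> t = (\<chi> q. if q \<in> ?S then t $ q else 0)" for t
  have lin_e: "?e (s + t) q = ?e s q + ?e t q" "?e (a *s t) q = a * ?e t q" for s t q a
    by (cases q; simp add: tangent_entry_def add_divide_distrib diff_divide_distrib algebra_simps)+
  have lin: "Vector_Spaces.linear (*s) (*s) \<pi>"
    by unfold_locales (auto simp: \<pi>_def vec_eq_iff vector_space_over_itself.scale_right_distrib)
  have e0: "?e 0 q = 0" for q by (cases q) (simp add: tangent_entry_def)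
  have "vec.subspace ?T"
    unfolding T vec.subspace_def by (auto simp: lin_e e0)
  then have span: "vec.span ?T = ?T" by (simp add: vec.span_eq_iff)
  have star: "(i, j0, k0) \<in> ?S" "(i0, j, k0) \<in> ?S" "(i0, j0, k) \<in> ?S" for i j k
    by (auto simp: star_def)
  have e_\<pi>: "?e (\<pi> t) q = ?e t q" for t q
    by (cases q) (simp add: tangent_entry_def \<pi>_def star)
  have inj: "inj_on \<pi> ?T"
  proof (rule inj_onI)
    fix s t assume "s \<in> ?T" "t \<in> ?T" "\<pi> s = \<pi> t"
    then have "s $ q = ?e s q" "t $ q = ?e t q" for q unfolding T by blast+
    then have "s $ q = t $ q" for q using e_\<pi>[of s q] e_\<pi>[of t q] \<open>\<pi> s = \<pi> t\<close> by simp
    then show "s = t" by (simp add: vec_eq_iff)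
  qed
  have "\<pi> ` ?T = {x. \<forall>q. q \<notin> ?S \<longrightarrow> x $ q = 0}"
  proof (intro equalityI subsetI)
    fix x :: "complex ^ idx" assume "x \<in> {x. \<forall>q. q \<notin> ?S \<longrightarrow> x $ q = 0}"
    then have x: "\<pi> x = x" by (auto simp: \<pi>_def vec_eq_iff)
    define t where "t = (\<chi> q. ?e x q)"
    have "?e x q = x $ q" if "q \<in> ?S" for q
      using that o by (auto simp: star_def tangent_entry_def field_simps power2_eq_square power3_eq_cube)
    then have "\<pi> t = \<pi> x" by (auto simp: t_def \<pi>_def vec_eq_iff)
    then have "?e t q = t $ q" for q using e_\<pi>[of t q] e_\<pi>[of x q] by (simp add: t_def)
    then have "t \<in> ?T" by (simp add: T)
    moreover have "x = \<pi> t" using \<open>\<pi> t = \<pi> x\<close> x by simp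
    ultimately show "x \<in> \<pi> ` ?T" by blast
  qed (auto simp: \<pi>_def)
  then have "vec.dim (\<pi> ` ?T) = 6"
    by (simp only: dim_substandard_cart card_star)
  moreover have "vec.dim (\<pi> ` ?T) = vec.dim ?T"
    by (rule vec.dim_image_eq[OF lin]) (simp add: span inj)
  ultimately show ?thesis by (simp only:)
qed

text \<open>The dimension is the same at all nonzero points, so all of them are smooth.\<close>

lemma smooth_point_segre_cone: "smooth_point segre_cone p \<longleftrightarrow> p \<in> segre_cone \<and> p \<noteq> 0"
  by (auto simp: smooth_point_def dim_tangent_space_segre_cone)

subsection \<open>The dual variety\<close>

lemma sum_idx: "(\<Sum>q\<in>UNIV. f q) = (\<Sum>i\<in>UNIV. \<Sum>j\<in>UNIV. \<Sum>k\<in>UNIV. f (i, j, k))" for f :: "idx \<Rightarrow> 'a::comm_monoid_add"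
  by (simp add: sum.cartesian_product flip: UNIV_Times_UNIV)

lemma segre_eq_0_iff: "segre (($) u) (($) v) (($) w) = 0 \<longleftrightarrow> u = 0 \<or> v = 0 \<or> w = 0"
  by (auto simp: vec_eq_iff segre_nth)

text \<open>Moving one factor of \<open>p\<close> at a time gives tangent vectors that test each
  partial derivative. Conversely, the entry formula writes the pairing with any tangent vector as a
  combination of the partial derivatives.\<close>

lemma tangent_hyperplane_iff:
  assumes nz: "u \<noteq> 0" "v \<noteq> 0" "w \<noteq> 0"
  defines "p \<equiv> segre (($) u) (($) v) (($) w)"
  shows "(\<forall>t\<in>tangent_space segre_cone p. (\<Sum>q\<in>UNIV. A $ q * t $ q) = 0) \<longleftrightarrow> critical_point A u v w"
proof
  assume tangent: "\<forall>t\<in>tangent_space segre_cone p. (\<Sum>q\<in>UNIV. A $ q * t $ q) = 0"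
  have "segre u' (($) v) (($) w) \<in> tangent_space segre_cone p" "segre (($) u) v' (($) w) \<in> tangent_space segre_cone p"
    "segre (($) u) (($) v) w' \<in> tangent_space segre_cone p" for u' v' w'
  proof -
    have "segre (\<lambda>_. 0) f g = 0" "segre f (\<lambda>_. 0) g' = 0" "segre f f' (\<lambda>_. 0) = 0" for f f' g g'
      by (simp_all add: vec_eq_iff segre_nth)
    then show "segre u' (($) v) (($) w) \<in> tangent_space segre_cone p" "segre (($) u) v' (($) w) \<in> tangent_space segre_cone p"
      "segre (($) u) (($) v) w' \<in> tangent_space segre_cone p"
      using segre_tangent[of u' "($) v" "($) w" "($) u" "\<lambda>_. 0" "\<lambda>_. 0"]
        segre_tangent[of "\<lambda>_. 0" "($) v" "($) w" "($) u" v' "\<lambda>_. 0"]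
        segre_tangent[of "\<lambda>_. 0" "($) v" "($) w" "($) u" "\<lambda>_. 0" w']
      by (simp_all add: p_def)
  qed
  note t = tangent[THEN bspec, OF this(1)] tangent[THEN bspec, OF this(2)] tangent[THEN bspec, OF this(3)]
  show "critical_point A u v w"
    unfolding critical_point_def
  proof (intro conjI allI)
    fix i
    show "(\<Sum>j\<in>UNIV. \<Sum>k\<in>UNIV. A $ (i, j, k) * v $ j * w $ k) = 0"
      using t(1)[of "\<lambda>i'. if i' = i then 1 else 0"] exhaust_3[of i]
      by (auto simp: sum_idx segre_nth sum_3 sum_2 mult.assoc)
  next
    fix j
    show "(\<Sum>i\<in>UNIV. \<Sum>k\<in>UNIV. A $ (i, j, k) * u $ i * w $ k) = 0"
      using t(2)[of "\<lambda>j'. if j' = j then 1 else 0"] exhaust_3[of j]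
      by (auto simp: sum_idx segre_nth sum_3 sum_2 mult.assoc)
  next
    fix k
    show "(\<Sum>i\<in>UNIV. \<Sum>j\<in>UNIV. A $ (i, j, k) * u $ i * v $ j) = 0"
      using t(3)[of "\<lambda>k'. if k' = k then 1 else 0"]
      by (simp add: sum_idx segre_nth if_distrib[of "\<lambda>x. _ * x"] sum.delta mult.assoc cong: if_cong)
  qed
next
  assume crit: "critical_point A u v w"
  obtain i0 where i0: "u $ i0 \<noteq> 0" using nz by (auto simp: vec_eq_iff)
  obtain j0 where j0: "v $ j0 \<noteq> 0" using nz by (auto simp: vec_eq_iff)
  obtain k0 where k0: "w $ k0 \<noteq> 0" using nz by (auto simp: vec_eq_iff)
  define c where "c = u $ i0 * v $ j0 * w $ k0"
  have c: "p $ (i0, j0, k0) = c" "c \<noteq> 0" using i0 j0 k0 by (simp_all add: p_def segre_nth c_def)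
  show "\<forall>t\<in>tangent_space segre_cone p. (\<Sum>q\<in>UNIV. A $ q * t $ q) = 0"
  proof
    fix t assume "t \<in> tangent_space segre_cone p"
    moreover have "p \<in> segre_cone" unfolding p_def by (rule segre_in_cone)
    ultimately have t: "t $ q = tangent_entry (i0, j0, k0) p t q" for q
      using tangent_space_segre_cone[of p i0 j0 k0] c by blast
    \<comment> \<open>These factors come from expanding \<open>tangent_entry\<close> at
      \<open>p\<close>. After summation, each of the four terms contains a partial derivative of the
      trilinear form.\<close>
    define a b d e where "a = u $ i0 * v $ j0 * (u $ i0 * w $ k0) / c^2"
      and "b = u $ i0 * v $ j0 * (v $ j0 * w $ k0) / c^2"
      and "d = u $ i0 * w $ k0 * (v $ j0 * w $ k0) / c^2"
      and "e = 2 * t $ (i0, j0, k0) * (v $ j0 * w $ k0) * (u $ i0 * w $ k0) * (u $ i0 * v $ j0) / c^3"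
    have "A $ (i, j, k) * t $ (i, j, k) = a * (t $ (i, j0, k0) * (A $ (i, j, k) * v $ j * w $ k))
        + b * (t $ (i0, j, k0) * (A $ (i, j, k) * u $ i * w $ k))
        + d * (t $ (i0, j0, k) * (A $ (i, j, k) * u $ i * v $ j))
        - e * (w $ k * (A $ (i, j, k) * u $ i * v $ j))" for i j k
      unfolding t[of "(i, j, k)"] tangent_entry_def prod.case c(1) unfolding p_def segre_nth a_def b_def d_def e_def
      by (simp add: add_divide_distrib diff_divide_distrib algebra_simps)
    then have "(\<Sum>q\<in>UNIV. A $ q * t $ q) = (\<Sum>i\<in>UNIV. \<Sum>j\<in>UNIV. \<Sum>k\<in>UNIV.
        a * (t $ (i, j0, k0) * (A $ (i, j, k) * v $ j * w $ k))
        + b * (t $ (i0, j, k0) * (A $ (i, j, k) * u $ i * w $ k))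
        + d * (t $ (i0, j0, k) * (A $ (i, j, k) * u $ i * v $ j))
        - e * (w $ k * (A $ (i, j, k) * u $ i * v $ j)))"
      unfolding sum_idx by (simp only:)
    also have "\<dots> = a * (\<Sum>i\<in>UNIV. t $ (i, j0, k0) * (\<Sum>j\<in>UNIV. \<Sum>k\<in>UNIV. A $ (i, j, k) * v $ j * w $ k))
        + b * (\<Sum>j\<in>UNIV. t $ (i0, j, k0) * (\<Sum>i\<in>UNIV. \<Sum>k\<in>UNIV. A $ (i, j, k) * u $ i * w $ k))
        + d * (\<Sum>k\<in>UNIV. t $ (i0, j0, k) * (\<Sum>i\<in>UNIV. \<Sum>j\<in>UNIV. A $ (i, j, k) * u $ i * v $ j))
        - e * (\<Sum>k\<in>UNIV. w $ k * (\<Sum>i\<in>UNIV. \<Sum>j\<in>UNIV. A $ (i, j, k) * u $ i * v $ j))"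
      by (simp add: sum_3 sum_2 algebra_simps)
    also have "\<dots> = 0" using crit by (simp add: critical_point_def)
    finally show "(\<Sum>q\<in>UNIV. A $ q * t $ q) = 0" .
  qed
qed

lemma tangent_hyperplanes_eq:
  "{A. \<exists>p. smooth_point segre_cone p \<and> (\<forall>t\<in>tangent_space segre_cone p. (\<Sum>q\<in>UNIV. A $ q * t $ q) = 0)}
    = {A. pencil_disc (($) A) = 0}"
proof (intro equalityI subsetI CollectI; elim CollectE exE conjE)
  fix A p
  assume p: "smooth_point segre_cone p" and tangent: "\<forall>t\<in>tangent_space segre_cone p. (\<Sum>q\<in>UNIV. A $ q * t $ q) = 0"
  from p have "p \<in> segre_cone" "p \<noteq> 0" by (simp_all add: smooth_point_segre_cone)
  then obtain u v w where "p = segre u v w" by (elim segre_cone_cases)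
  then have uvw: "p = segre (($) (vec_lambda u)) (($) (vec_lambda v)) (($) (vec_lambda w))"
    by (simp add: vec_lambda_inverse)
  with \<open>p \<noteq> 0\<close> have nz: "vec_lambda u \<noteq> 0" "vec_lambda v \<noteq> 0" "vec_lambda w \<noteq> 0"
    by (simp_all only: segre_eq_0_iff) blast+
  show "pencil_disc (($) A) = 0"
    using tangent unfolding uvw tangent_hyperplane_iff[OF nz] by (rule critical_point_imp_disc[OF _ nz])
next
  fix A :: "complex ^ idx"
  assume "pencil_disc (($) A) = 0"
  then obtain u v w where nz: "u \<noteq> 0" "v \<noteq> 0" "w \<noteq> 0" and crit: "critical_point A u v w"
    by (rule disc_imp_critical_point)
  show "\<exists>p. smooth_point segre_cone p \<and> (\<forall>t\<in>tangent_space segre_cone p. (\<Sum>q\<in>UNIV. A $ q * t $ q) = 0)"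
    by (intro exI[of _ "segre (($) u) (($) v) (($) w)"] conjI)
      (use nz crit in \<open>simp_all add: smooth_point_segre_cone segre_in_cone segre_eq_0_iff tangent_hyperplane_iff\<close>)
qed

lemma complex_zeros_disc_poly: "complex_zeros disc_poly = {A. pencil_disc (($) A) = 0}"
  by (simp add: complex_zeros_def peval_map_of_int disc_poly_def hom_of_int.eval_disc_poly)

text \<open>The tangent hyperplanes already form the zero set of a polynomial, which belongs to its
  own vanishing ideal; so taking the closure adds nothing.\<close>

lemma dual_variety_segre_cone: "dual_variety segre_cone = complex_zeros disc_poly"
proof -
  have "zariski_closure (complex_zeros P) = complex_zeros P" for P :: "(idx, int) polynomial"
  proof -
    have "(Poly_Mapping.map of_int P :: (idx, complex) polynomial) \<in> vanishing_ideal (complex_zeros P)"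
      by (simp add: vanishing_ideal_def complex_zeros_def)
    then show ?thesis by (auto simp: zariski_closure_def complex_zeros_def vanishing_ideal_def)
  qed
  then show ?thesis
    unfolding dual_variety_def tangent_hyperplanes_eq complex_zeros_disc_poly[symmetric] .
qed

lemma hyperdeterminant_disc_poly:
  "irreducible disc_poly" "is_hyperdeterminant disc_poly"
proof -
  have n: "(1 :: nat) \<in> {1..178}" by simp
  have "coeff_at 1 = 1" by (simp add: coeff_at_def table_def)
  then have one: "lookup disc_poly (exponents_at 1) = 1" using row_at(3)[OF n] by simp
  have every: "\<exists>m\<in>keys disc_poly. lookup m p \<noteq> 0" for p
  proof -
    have m: "exponents_at 1 \<in> orbit_at 1" by (simp add: orbit_at_def mem_sym_orbit)
    obtain i j k where p: "p = (i, j, k)" by (cases p)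
    have "grid (exponents_at 1) = grid_of (fst (snd (table ! 0)))"
      using grid_exponents_at[OF n] by simp
    also have "\<dots> = [[(0, 0), (0, 0), (0, 4)], [(0, 0), (2, 2), (0, 0)], [(4, 0), (0, 0), (0, 0)]]"
      by (simp add: table_def grid_of_def)
    finally have q: "lookup (exponents_at 1) (3, 1, 1) \<noteq> 0"
      by (simp add: grid_def grid_row_def)
    \<comment> \<open>The group is transitive on the variables: this symmetry carries
      \<open>p\<close> to \<open>(3, 1, 1)\<close>, where the first representative has exponent
      4.\<close>
    define \<alpha> \<beta> :: "3 \<Rightarrow> 3" where "\<alpha> = Transposition.transpose 3 i" and "\<beta> = Transposition.transpose 1 j"
    define \<gamma> :: "2 \<Rightarrow> 2" where "\<gamma> = Transposition.transpose 1 k"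
    have \<pi>: "idx_map \<alpha> \<beta> \<gamma> \<in> index_symmetries"
      by (intro idx_map_symmetry) (simp_all add: \<alpha>_def \<beta>_def \<gamma>_def)
    then have "act (idx_map \<alpha> \<beta> \<gamma>) (exponents_at 1) \<in> orbit_at 1"
      by (simp add: orbit_at_def sym_orbit_def)
    then have "act (idx_map \<alpha> \<beta> \<gamma>) (exponents_at 1) \<in> keys disc_poly"
      using orbit_at_subset_keys[OF n] by blast
    moreover have "lookup (act (idx_map \<alpha> \<beta> \<gamma>) (exponents_at 1)) p = lookup (exponents_at 1) (3, 1, 1)"
      using \<pi> by (simp add: lookup_map_key symmetry_inj p) (simp add: idx_map_def \<alpha>_def \<beta>_def \<gamma>_def)
    ultimately show ?thesis using q by metis
  qed
  show irr: "irreducible disc_poly" by (rule irreducible_disc_poly[OF one every])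
  have "exponents_at 1 \<in> keys disc_poly" using one by (simp add: in_keys_iff)
  \<comment> \<open>The first representative has coefficient 1, so the content is 1.\<close>
  then have "Gcd (lookup disc_poly ` keys disc_poly) dvd lookup disc_poly (exponents_at 1)"
    by (intro Gcd_dvd imageI)
  then have "Gcd (lookup disc_poly ` keys disc_poly) = 1"
    unfolding one using Gcd_int_greater_eq_0[of "lookup disc_poly ` keys disc_poly"] by simp
  with irr show "is_hyperdeterminant disc_poly"
    by (simp add: is_hyperdeterminant_def dual_variety_segre_cone)
qed

theorem theorem15:
  shows "is_hyperdeterminant F332
    \<and> irreducible F332
    \<and> homogeneous_of_degree 12 F332
    \<and> card (Poly_Mapping.keys F332) = 16749
    \<and> card (Poly_Mapping.lookup F332 ` Poly_Mapping.keys F332) = 41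
    \<and> sym_orbit ` Poly_Mapping.keys F332 = orbit_at ` {1..178}
    \<and> card (sym_orbit ` Poly_Mapping.keys F332) = 178
    \<and> (\<forall>n\<in>{1..178}. orbit_at n \<subseteq> Poly_Mapping.keys F332 \<and> card (orbit_at n) = size_at n)"
  unfolding F332_eq_disc_poly
proof (intro conjI ballI)
  show "card (lookup disc_poly ` keys disc_poly) = 41"
    unfolding coefficient_values by (rule card_coeffs)
  show "card (sym_orbit ` keys disc_poly) = 178"
    unfolding orbits_of_keys card_image[OF inj_on_orbit_at] by simp
qed (simp_all only: hyperdeterminant_disc_poly disc_poly_homogeneous card_keys_disc_poly orbits_of_keys
    orbit_at_subset_keys card_orbit_at)

end
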